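(* Let $\alpha,\beta$ be adjacent simple roots of $\mathfrak{sl}_n$ and let $T,S\in\mathbf T_n$ both lie in $D_{\alpha,\beta}$. Then $S$ is in the geometric cover of $T$ if and only if $\mathcal T_{\alpha,\beta}(S)$ is in the geometric cover of $\mathcal T_{\alpha,\beta}(T)$.
   Context: $\mathbf T_n$ is the set of standard Young tableaux with $n$ boxes. Let $\mathbf G=SL_n(\mathbb C)$, $\mathbf B$ its upper triangular subgroup, $\mathfrak n$ the strictly upper triangular matrices, with conjugation action. For $w\in\mathbf S_n$ put $\mathfrak n\cap{}^w\mathfrak n=\operatorname{span}\{e_{ij}: i<j,\ w^{-1}(i)<w^{-1}(j)\}$; $\overline{\mathbf G(\mathfrak n\cap{}^w\mathfrak n)}$ is the closure of a unique nilpotent orbit $\mathcal O_w$, and $\mathcal V_w:=\overline{\mathbf B(\mathfrak n\cap{}^w\mathfrak n)}\cap\mathcal O_w$ is an orbital variety. Let $P(w)$ be the Robinson–Schensted (row) insertion tableau of the word $[w(1),\dots,w(n)]$. $\mathcal V_w=\mathcal V_y$ iff $P(w)=P(y)$; put $\mathcal V_T:=\mathcal V_w$ if $P(w)=T$. Geometric order: $T\stackrel{G}{\le}S$ iff $\overline{\mathcal V}_T\supset\overline{\mathcal V}_S$. The (geometric) cover of $T$ is the set of $S$ with $S\stackrel{G}{>}T$ such that $T\stackrel{G}{\le}Q\stackrel{G}{\le}S$ implies $Q=T$ or $Q=S$. $\Pi=\{\alpha_1,\dots,\alpha_{n-1}\}$, $\alpha_i=\varepsilon_i-\varepsilon_{i+1}$,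 $s_{\alpha_i}=(i,i+1)$; $\tau(w)=\{\alpha_i: w^{-1}(i)>w^{-1}(i+1)\}$ depends only on $P(w)$, and $\tau(T):=\tau(w)$ for $P(w)=T$. For adjacent $\alpha,\beta\in\Pi$, $D_{\alpha,\beta}$ is the set of $w$ (resp. of $T$) with $\alpha\notin\tau$ and $\beta\in\tau$. For $w\in D_{\alpha,\beta}$, $\mathcal T_{\alpha,\beta}(w)=s_\alpha w$ if $\beta\notin\tau(s_\alpha w)$ and $\mathcal T_{\alpha,\beta}(w)=s_\beta w$ otherwise. For $T=P(w)\in D_{\alpha,\beta}$, $\mathcal T_{\alpha,\beta}(T):=P(\mathcal T_{\alpha,\beta}(w))\in D_{\beta,\alpha}$, which is independent of the choice of $w$. *)

theory Defs
  imports "HOL-Combinatorics.Permutations" "Jordan_Normal_Form.Determinant"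
begin

section \<open>Zariski closure in the space of complex matrices\<close>

text \<open>The polynomial functions on the affine space of \<open>n \<times> n\<close> complex matrices.\<close>

inductive_set poly_functions :: "nat \<Rightarrow> (complex mat \<Rightarrow> complex) set" for n where
  const: "(\<lambda>X. c) \<in> poly_functions n"
| entry: "a < n \<Longrightarrow> b < n \<Longrightarrow> (\<lambda>X. X $$ (a, b)) \<in> poly_functions n"
| add: "f \<in> poly_functions n \<Longrightarrow> g \<in> poly_functions n \<Longrightarrow> (\<lambda>X. f X + g X) \<in> poly_functions n"
| mult: "f \<in> poly_functions n \<Longrightarrow> g \<in> poly_functions n \<Longrightarrow> (\<lambda>X. f X * g X) \<in> poly_functions n"

definition zariski_closure :: "nat \<Rightarrow> complex mat set \<Rightarrow> complex mat set" where
  "zariski_closure n A =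
     {X \<in> carrier_mat n n. \<forall>f \<in> poly_functions n. (\<forall>Y \<in> A. f Y = 0) \<longrightarrow> f X = 0}"

section \<open>Orbital varieties\<close>

definition SL :: "nat \<Rightarrow> complex mat set" where
  "SL n = {g \<in> carrier_mat n n. det g = 1}"

definition Borel :: "nat \<Rightarrow> complex mat set" where
  "Borel n = {g \<in> SL n. upper_triangular g}"

definition conj_sweep :: "nat \<Rightarrow> complex mat set \<Rightarrow> complex mat set \<Rightarrow> complex mat set" where
  "conj_sweep n H A =
     {g * X * h | g X h. g \<in> H \<and> X \<in> A \<and> h \<in> carrier_mat n n \<and> inverts_mat g h}"

definition nilpotent_orbits :: "nat \<Rightarrow> complex mat set set" where
  "nilpotent_orbits n =
     {conj_sweep n (SL n) {X} | X. X \<in> carrier_mat n n \<and> (\<exists>k. X ^\<^sub>m k = 0\<^sub>m n n)}"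

text \<open>
  The span of the matrix units \<open>e\<^sub>i\<^sub>j\<close> with \<open>i < j\<close> and \<open>w\<^sup>-\<^sup>1(i) < w\<^sup>-\<^sup>1(j)\<close>.
  Permutations act on \<open>{1..n}\<close>, whereas matrix entries are indexed from 0, whence the
  shift by one.
\<close>

definition nil_inter :: "nat \<Rightarrow> (nat \<Rightarrow> nat) \<Rightarrow> complex mat set" where
  "nil_inter n w =
     {X \<in> carrier_mat n n. \<forall>a < n. \<forall>b < n.
        X $$ (a, b) \<noteq> 0 \<longrightarrow> a < b \<and> inv_into UNIV w (Suc a) < inv_into UNIV w (Suc b)}"

definition nil_orbit :: "nat \<Rightarrow> (nat \<Rightarrow> nat) \<Rightarrow> complex mat set" where
  "nil_orbit n w =
     (THE Orb. Orb \<in> nilpotent_orbits n \<and>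
        zariski_closure n Orb = zariski_closure n (conj_sweep n (SL n) (nil_inter n w)))"

definition orbital_variety :: "nat \<Rightarrow> (nat \<Rightarrow> nat) \<Rightarrow> complex mat set" where
  "orbital_variety n w =
     zariski_closure n (conj_sweep n (Borel n) (nil_inter n w)) \<inter> nil_orbit n w"

section \<open>Standard Young tableaux and Robinson--Schensted insertion\<close>

text \<open>A tableau is the list of its rows, from top to bottom.\<close>

definition SYT :: "nat \<Rightarrow> nat list list set" where
  "SYT n = {T.
     (\<forall>r \<in> set T. r \<noteq> [] \<and> sorted_wrt (<) r) \<and>
     sorted_wrt (\<ge>) (map length T) \<and>
     (\<forall>k c. Suc k < length T \<longrightarrow> c < length (T ! Suc k) \<longrightarrow> T ! k ! c < T ! Suc k ! c) \<and>
     distinct (concat T) \<and> set (concat T) = {1..n}}"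

text \<open>The second component is the entry bumped into the next row, if any.\<close>

fun row_insert :: "nat \<Rightarrow> nat list \<Rightarrow> nat list \<times> nat option" where
  "row_insert x [] = ([x], None)"
| "row_insert x (y # ys) =
     (if x < y then (x # ys, Some y)
      else (case row_insert x ys of (zs, b) \<Rightarrow> (y # zs, b)))"

fun tableau_insert :: "nat \<Rightarrow> nat list list \<Rightarrow> nat list list" where
  "tableau_insert x [] = [[x]]"
| "tableau_insert x (r # rs) =
     (case row_insert x r of
        (r', None) \<Rightarrow> r' # rs
      | (r', Some y) \<Rightarrow> r' # tableau_insert y rs)"

definition RS :: "nat \<Rightarrow> (nat \<Rightarrow> nat) \<Rightarrow> nat list list" where
  "RS n w = fold tableau_insert (map w [1..<Suc n]) []"

text \<open>
  Several notions are defined for \<open>T\<close> through an arbitrary \<open>w\<close> with insertion tableau \<open>T\<close>,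
  the result being independent of \<open>w\<close>.
\<close>

definition RS_rep :: "nat \<Rightarrow> nat list list \<Rightarrow> (nat \<Rightarrow> nat)" where
  "RS_rep n T = (SOME w. w permutes {1..n} \<and> RS n w = T)"

section \<open>The geometric order and its covers\<close>

definition orbital_variety_tab :: "nat \<Rightarrow> nat list list \<Rightarrow> complex mat set" where
  "orbital_variety_tab n T = orbital_variety n (RS_rep n T)"

definition geom_le :: "nat \<Rightarrow> nat list list \<Rightarrow> nat list list \<Rightarrow> bool" where
  "geom_le n T S \<longleftrightarrow>
     zariski_closure n (orbital_variety_tab n T) \<supseteq> zariski_closure n (orbital_variety_tab n S)"

definition geom_cover :: "nat \<Rightarrow> nat list list \<Rightarrow> nat list list set" where
  "geom_cover n T =
     {S \<in> SYT n. geom_le n T S \<and> S \<noteq> T \<and>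
        (\<forall>Q \<in> SYT n. geom_le n T Q \<and> geom_le n Q S \<longrightarrow> Q = T \<or> Q = S)}"

section \<open>The \<open>\<tau>\<close>-invariant and the operators \<open>\<T>\<^sub>\<alpha>\<^sub>\<beta>\<close>\<close>

text \<open>The simple root \<open>\<alpha>\<^sub>i = \<epsilon>\<^sub>i - \<epsilon>\<^sub>i\<^sub>+\<^sub>1\<close> is represented by its index \<open>i\<close>.\<close>

definition simple_roots :: "nat \<Rightarrow> nat set" where
  "simple_roots n = {1..<n}"

definition adjacent_roots :: "nat \<Rightarrow> nat \<Rightarrow> bool" where
  "adjacent_roots \<alpha> \<beta> \<longleftrightarrow> \<beta> = Suc \<alpha> \<or> \<alpha> = Suc \<beta>"

definition simple_refl :: "nat \<Rightarrow> nat \<Rightarrow> nat" where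
  "simple_refl \<alpha> = transpose \<alpha> (Suc \<alpha>)"

definition tau :: "nat \<Rightarrow> (nat \<Rightarrow> nat) \<Rightarrow> nat set" where
  "tau n w = {\<alpha> \<in> simple_roots n. inv_into UNIV w \<alpha> > inv_into UNIV w (Suc \<alpha>)}"

definition tau_tab :: "nat \<Rightarrow> nat list list \<Rightarrow> nat set" where
  "tau_tab n T = tau n (RS_rep n T)"

definition D_tab :: "nat \<Rightarrow> nat \<Rightarrow> nat \<Rightarrow> nat list list set" where
  "D_tab n \<alpha> \<beta> = {T \<in> SYT n. \<alpha> \<notin> tau_tab n T \<and> \<beta> \<in> tau_tab n T}"

text \<open>Of interest only for \<open>w\<close> with \<open>\<alpha> \<notin> tau n w\<close> and \<open>\<beta> \<in> tau n w\<close>.\<close>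

definition T_op :: "nat \<Rightarrow> nat \<Rightarrow> nat \<Rightarrow> (nat \<Rightarrow> nat) \<Rightarrow> (nat \<Rightarrow> nat)" where
  "T_op n \<alpha> \<beta> w =
     (if \<beta> \<notin> tau n (simple_refl \<alpha> \<circ> w) then simple_refl \<alpha> \<circ> w else simple_refl \<beta> \<circ> w)"

definition T_op_tab :: "nat \<Rightarrow> nat \<Rightarrow> nat \<Rightarrow> nat list list \<Rightarrow> nat list list" where
  "T_op_tab n \<alpha> \<beta> T = RS n (T_op n \<alpha> \<beta> (RS_rep n T))"

end

(*
  Write Z(w) for the closure of B(\<nn> \<inter> w\<nn>).  The generic elements of \<nn> \<inter> w\<nn> are conjugate to each
  other, so Z(w) is the closure of the orbital variety of w and the geometric order is reverse inclusion
  of the sets Z(w).  A Knuth move of w removes from \<nn> \<inter> w\<nn> one coordinate that a root subgroup of B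
  can clear generically; hence Z(w) depends only on P(w).

  If \<beta> lies in tau(w), then \<nn> \<inter> w\<nn> is stable under the root subgroup of -\<beta>, so Z(w) is stable under
  the minimal parabolic P_\<beta>.  For w in D_{\<alpha>,\<beta>}, Z(T_{\<alpha>,\<beta>} w) is the closure of the P_\<alpha>-sweep of those
  X in Z(w) whose \<alpha>-coordinate vanishes and whose (\<alpha>+\<beta>)-coordinate does not.  This description is
  monotone in Z(w), so T_{\<alpha>,\<beta>} preserves the geometric order.  As tau is monotone, every tableau between
  two elements of D_{\<beta>,\<alpha>} lies in D_{\<beta>,\<alpha>}, and T_{\<beta>,\<alpha>} inverts T_{\<alpha>,\<beta>}; covers therefore correspond
  to covers.
*)

theory Submission
  imports Defs
    "Jordan_Normal_Form.Jordan_Normal_Form_Existence"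
    "Jordan_Normal_Form.Jordan_Normal_Form_Uniqueness"
    "Jordan_Normal_Form.DL_Rank"
begin

section \<open>Knuth equivalence and Robinson--Schensted insertion\<close>

text \<open>The delicate point is the slice of Z(w) on which the \<alpha>-coordinate vanishes and
  the (\<alpha>+\<beta>)-coordinate does not. As Z(w) is a closure, a point of the slice need not be
  a limit of points of the Borel sweep that themselves lie in the slice. The remedy is a polynomial
  map defined on all of Z(w): the root subgroup of -\<beta> cancels the \<alpha>-coordinate against
  the (\<alpha>+\<beta>)-coordinate, with denominators cleared. By the Bruhat decomposition in rank
  one it sends the sweep of a dense part of \<nn> \<inter> w\<nn> into Z(T w), hence all of Z(w) as
  well; on the slice it is multiplication by a nonzero scalar, and Z(T w) is a cone.

  Dimension theory is avoided: density comes from restricting a polynomial to a line or a polynomial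
  curve, where infinitely many zeros make it vanish. The orbit in the definition of an orbital
  variety is pinned down by the kernel dimensions of powers, which are upper semicontinuous and
  classify nilpotent matrices.\<close>

inductive knuth_step :: "nat list \<Rightarrow> nat list \<Rightarrow> bool" where
  xzy: "x < y \<Longrightarrow> y < z \<Longrightarrow> knuth_step (l @ [x, z, y] @ r) (l @ [z, x, y] @ r)"
| yxz: "x < y \<Longrightarrow> y < z \<Longrightarrow> knuth_step (l @ [y, x, z] @ r) (l @ [y, z, x] @ r)"

abbreviation knuth_equiv :: "nat list \<Rightarrow> nat list \<Rightarrow> bool" where
  "knuth_equiv \<equiv> equivclp knuth_step"

lemma knuth_step_context: "knuth_step u v \<Longrightarrow> knuth_step (l @ u @ r) (l @ v @ r)"
proof (induction rule: knuth_step.induct)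
  case (xzy x y z l' r')
  then show ?case using knuth_step.xzy[of x y z "l @ l'" "r' @ r"] by simp
next
  case (yxz x y z l' r')
  then show ?case using knuth_step.yxz[of x y z "l @ l'" "r' @ r"] by simp
qed

lemma knuth_equiv_context: "knuth_equiv u v \<Longrightarrow> knuth_equiv (l @ u @ r) (l @ v @ r)"
proof (induction rule: equivclp_induct)
  case base
  then show ?case by simp
next
  case (step v w)
  then have "knuth_equiv (l @ v @ r) (l @ w @ r)"
    by (meson knuth_step_context r_into_equivclp converse_r_into_equivclp)
  with step.IH show ?case by (rule equivclp_trans)
qed

lemma knuth_equiv_appendI: "knuth_equiv u v \<Longrightarrow> knuth_equiv (l @ u) (l @ v)"
  using knuth_equiv_context[of u v l "[]"] by simp

lemma knuth_equiv_appendI2: "knuth_equiv u v \<Longrightarrow> knuth_equiv (u @ r) (v @ r)"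
  using knuth_equiv_context[of u v "[]" r] by simp

lemma knuth_step_mset: "knuth_step u v \<Longrightarrow> mset u = mset v"
  by (induction rule: knuth_step.induct) auto

section \<open>Letters and row order under insertion\<close>

lemma row_insert_None_mset: "row_insert x r = (s, None) \<Longrightarrow> mset s = add_mset x (mset r)"
  by (induction x r arbitrary: s rule: row_insert.induct) (auto split: if_splits prod.splits)

lemma row_insert_Some_mset:
  "row_insert x r = (s, Some b) \<Longrightarrow> add_mset b (mset s) = add_mset x (mset r)"
  by (induction x r arbitrary: s rule: row_insert.induct) (auto split: if_splits prod.splits)

lemma row_insert_Some_gt: "row_insert x r = (s, Some b) \<Longrightarrow> x < b \<and> b \<in> set r"
  by (induction x r arbitrary: s rule: row_insert.induct) (auto split: if_splits prod.splits)

lemma row_insert_set: "row_insert x r = (s, c) \<Longrightarrow> x \<in> set s \<and> set s \<subseteq> insert x (set r)"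
  by (induction x r arbitrary: s rule: row_insert.induct) (auto split: if_splits prod.splits)

lemma row_insert_sorted:
  "row_insert x r = (s, c) \<Longrightarrow> sorted_wrt (<) r \<Longrightarrow> x \<notin> set r \<Longrightarrow> sorted_wrt (<) s"
proof (induction x r arbitrary: s rule: row_insert.induct)
  case (2 x y ys)
  then show ?case
    by (auto split: if_splits prod.splits dest!: row_insert_set) (use le_neq_implies_less in force)+
qed auto

lemma tableau_insert_mset: "mset (concat (tableau_insert x T)) = add_mset x (mset (concat T))"
proof (induction x T rule: tableau_insert.induct)
  case (2 x r rs)
  then show ?case
    by (auto split: prod.splits option.splits dest: row_insert_None_mset row_insert_Some_mset)
qed simp

lemma fold_tableau_insert_mset:
  "mset (concat (fold tableau_insert u T)) = mset u + mset (concat T)"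
  by (induction u arbitrary: T) (auto simp: tableau_insert_mset)

lemma tableau_insert_sorted:
  "\<forall>r \<in> set T. sorted_wrt (<) r \<Longrightarrow> distinct (x # concat T) \<Longrightarrow>
    \<forall>r \<in> set (tableau_insert x T). sorted_wrt (<) r"
proof (induction x T rule: tableau_insert.induct)
  case (2 x r rs)
  obtain s c where s: "row_insert x r = (s, c)" by force
  show ?case
  proof (cases c)
    case None
    with 2 s show ?thesis by (auto intro: row_insert_sorted)
  next
    case (Some b)
    have "b \<in> set r" using s Some row_insert_Some_gt by simp
    then have "distinct (b # concat rs)" using "2.prems" by auto
    with 2 s Some show ?thesis by (auto intro: row_insert_sorted)
  qed
qed simp

lemma fold_tableau_insert_sorted:
  "\<forall>r \<in> set T. sorted_wrt (<) r \<Longrightarrow> distinct (u @ concat T) \<Longrightarrow>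
    \<forall>r \<in> set (fold tableau_insert u T). sorted_wrt (<) r"
proof (induction u arbitrary: T)
  case (Cons x u)
  have eq: "mset (u @ concat (tableau_insert x T)) = mset ((x # u) @ concat T)"
    using tableau_insert_mset[of x T] by simp
  have "distinct (u @ concat (tableau_insert x T))"
    using Cons.prems(2) mset_eq_imp_distinct_iff[OF eq] by simp
  with Cons tableau_insert_sorted[of T x] show ?case by simp
qed simp

section \<open>Knuth moves pushed through a tableau row by row\<close>

fun row_insert_word :: "nat list \<Rightarrow> nat list \<Rightarrow> nat list \<times> nat list" where
  "row_insert_word [] r = (r, [])"
| "row_insert_word (x # u) r =
     (case row_insert x r of
        (s, None) \<Rightarrow> row_insert_word u s
      | (s, Some b) \<Rightarrow> apsnd ((#) b) (row_insert_word u s))"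

lemma fold_tableau_insert_Cons:
  "fold tableau_insert u (r # rs) =
     fst (row_insert_word u r) # fold tableau_insert (snd (row_insert_word u r)) rs"
  by (induction u arbitrary: r rs) (auto split: prod.splits option.splits)

lemma fold_tableau_insert_Nil:
  assumes "u \<noteq> []"
  shows "fold tableau_insert u [] =
     fst (row_insert_word u []) # fold tableau_insert (snd (row_insert_word u [])) []"
  using assms by (cases u) (auto simp: fold_tableau_insert_Cons)

text \<open>Letters not smaller than the head never bump it, so a proof about a row may peel off its
  head until some letter does.\<close>

lemma row_insert_word_ge:
  "\<forall>x \<in> set u. \<not> x < a \<Longrightarrow> row_insert_word u (a # r) = apfst ((#) a) (row_insert_word u r)"
  by (induction u arbitrary: r) (auto split: prod.splits option.splits)

lemma row_insert_word_set: "set (snd (row_insert_word u r)) \<subseteq> set u \<union> set r"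
proof (induction u arbitrary: r)
  case (Cons x u)
  obtain s c where s: "row_insert x r = (s, c)" by force
  show ?case using Cons[of s] s row_insert_set[OF s] row_insert_Some_gt[of x r s]
    by (cases c) (fastforce simp: image_iff)+
qed simp

text \<open>A Knuth move on exactly three letters, in either direction. Both kinds and both
  directions are needed: the letters that two related triples bump out of a row may be related by
  the other kind, reversed.\<close>

definition knuth_triple :: "nat list \<Rightarrow> nat list \<Rightarrow> bool" where
  "knuth_triple u v \<longleftrightarrow> (\<exists>x y z. x < y \<and> y < z \<and>
     (u = [x, z, y] \<and> v = [z, x, y] \<or> u = [y, x, z] \<and> v = [y, z, x] \<or>
      v = [x, z, y] \<and> u = [z, x, y] \<or> v = [y, x, z] \<and> u = [y, z, x]))"

lemma row_insert_smaller:
  "row_insert y s = (t, c) \<Longrightarrow> z \<in> set s \<Longrightarrow> sorted_wrt (<) s \<Longrightarrow> y < z \<Longrightarrow> \<exists>b. c = Some b \<and> b \<le> z"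
  by (induction y s arbitrary: t rule: row_insert.induct) (auto split: if_splits prod.splits)

text \<open>Increasing letters bump at places that move to the right: if the later letter still
  finds something to bump, the earlier one did so further left.\<close>

lemma row_insert_larger:
  "row_insert y r = (s, c) \<Longrightarrow> row_insert z s = (t, Some d) \<Longrightarrow> sorted_wrt (<) r \<Longrightarrow> y < z \<Longrightarrow>
    \<exists>b. c = Some b \<and> b < d"
proof (induction y r arbitrary: s t rule: row_insert.induct)
  case (2 y a r)
  show ?case
  proof (cases "y < a")
    case True
    with 2 show ?thesis by (auto split: prod.splits dest: row_insert_Some_gt)
  next
    case False
    obtain s' c' where s': "row_insert y r = (s', c')" by force
    obtain t' d' where t': "row_insert z s' = (t', d')" by force
    have "\<not> z < a" using False 2 by simp
    with 2 False s' t' show ?thesis by auto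
  qed
qed (auto split: if_splits)

lemma row_insert_word_xzy:
  assumes "sorted_wrt (<) r" "x < y" "y < z" "{x, y, z} \<inter> set r = {}"
  shows "fst (row_insert_word [x, z, y] r) = fst (row_insert_word [z, x, y] r) \<and>
    (snd (row_insert_word [x, z, y] r) = snd (row_insert_word [z, x, y] r) \<or>
     knuth_triple (snd (row_insert_word [x, z, y] r)) (snd (row_insert_word [z, x, y] r)))"
  using assms
proof (induction r)
  case (Cons a r)
  consider "a < x" | "x < a" "a < z" | "z < a" using Cons.prems by force
  then show ?case
  proof cases
    case 1
    with Cons show ?thesis
      by (subst (1 2 3 4 5 6) row_insert_word_ge) auto
  next
    case 2
    \<comment> \<open>In both orders \<open>x\<close> has replaced \<open>a\<close> before
      \<open>y\<close> arrives, and \<open>z\<close> and \<open>y\<close> act on \<open>r\<close>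
      alone. Only the place of \<open>a\<close> among the bumped letters differs.\<close>
    obtain s c where s: "row_insert z r = (s, c)" by force
    obtain t d where t: "row_insert y s = (t, d)" by force
    have "sorted_wrt (<) s" using row_insert_sorted[OF s] Cons.prems by auto
    then obtain b where b: "d = Some b" "b \<le> z"
      using row_insert_smaller[OF t] row_insert_set[OF s] Cons.prems by auto
    have ab: "a < b"
      using b row_insert_Some_gt[of y s t b] t row_insert_set[OF s] Cons.prems 2 by auto
    have c: "z < e" if "c = Some e" for e
      using row_insert_Some_gt[of z r s e] s that by simp
    have ny: "\<not> y < x" "\<not> z < x" using Cons.prems by auto
    show ?thesis
    proof (cases c)
      case None
      then show ?thesis using 2 s t b ny by simp
    next
      case (Some e)
      have "knuth_triple [a, e, b] [e, a, b]"
        unfolding knuth_triple_def using ab b c[OF Some] le_less_trans by blast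
      then show ?thesis using 2 s t b ny Some by simp
    qed
  next
    case 3
    show ?thesis
    proof (cases r)
      case Nil
      then show ?thesis using 3 Cons.prems by simp
    next
      case (Cons h r')
      have "a < h" using Cons.prems Cons by simp
      then have "knuth_triple [a, h, z] [a, z, h]"
        unfolding knuth_triple_def using 3 by blast
      then show ?thesis using 3 Cons Cons.prems \<open>a < h\<close> by simp
    qed
  qed
qed simp

lemma row_insert_word_yxz:
  assumes "sorted_wrt (<) r" "x < y" "y < z" "{x, y, z} \<inter> set r = {}"
  shows "fst (row_insert_word [y, x, z] r) = fst (row_insert_word [y, z, x] r) \<and>
    (snd (row_insert_word [y, x, z] r) = snd (row_insert_word [y, z, x] r) \<or>
     knuth_triple (snd (row_insert_word [y, x, z] r)) (snd (row_insert_word [y, z, x] r)))"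
  using assms
proof (induction r)
  case (Cons a r)
  consider "a < x" | "x < a" "a < y" | "y < a" using Cons.prems by force
  then show ?case
  proof cases
    case 1
    with Cons show ?thesis
      by (subst (1 2 3 4 5 6) row_insert_word_ge) auto
  next
    case 2
    obtain s c where s: "row_insert y r = (s, c)" by force
    obtain t d where t: "row_insert z s = (t, d)" by force
    have ny: "\<not> y < a" "\<not> z < a" "\<not> z < x" using Cons.prems 2 by auto
    show ?thesis
    proof (cases d)
      case None
      then show ?thesis using 2 s t ny by (cases c) simp_all
    next
      case (Some e)
      then obtain b where b: "c = Some b" "b < e"
        using row_insert_larger[OF s t[unfolded Some]] Cons.prems by auto
      have "a < b" using b row_insert_Some_gt[of y r s b] s Cons.prems by simp
      then have "knuth_triple [b, a, e] [b, e, a]"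
        unfolding knuth_triple_def using b by blast
      then show ?thesis using 2 s t ny Some b by simp
    qed
  next
    case 3
    obtain s c where s: "row_insert z r = (s, c)" by force
    have ny: "\<not> z < x" "\<not> z < y" using Cons.prems by auto
    show ?thesis
    proof (cases c)
      case None
      then show ?thesis using 3 s ny Cons.prems by simp
    next
      case (Some e)
      then have "a < e" using row_insert_Some_gt[of z r s e] s Cons.prems by simp
      then have "knuth_triple [a, y, e] [a, e, y]"
        unfolding knuth_triple_def using 3 by blast
      then show ?thesis using 3 s ny Cons.prems Some by simp
    qed
  qed
qed simp

lemma knuth_triple_sym: "knuth_triple u v \<Longrightarrow> knuth_triple v u"
  unfolding knuth_triple_def by blast

lemma row_insert_word_triple:
  assumes "sorted_wrt (<) r" "knuth_triple u v" "set u \<inter> set r = {}"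
  shows "fst (row_insert_word u r) = fst (row_insert_word v r) \<and>
    (snd (row_insert_word u r) = snd (row_insert_word v r) \<or>
     knuth_triple (snd (row_insert_word u r)) (snd (row_insert_word v r)))"
proof -
  obtain x y z where xyz: "x < y" "y < z" and
    uv: "u = [x, z, y] \<and> v = [z, x, y] \<or> u = [y, x, z] \<and> v = [y, z, x] \<or>
      v = [x, z, y] \<and> u = [z, x, y] \<or> v = [y, x, z] \<and> u = [y, z, x]"
    using assms(2) unfolding knuth_triple_def by blast
  have disj: "{x, y, z} \<inter> set r = {}" using uv assms(3) by auto
  show ?thesis
    using uv row_insert_word_xzy[OF assms(1) xyz disj] row_insert_word_yxz[OF assms(1) xyz disj]
      knuth_triple_sym by metis
qed

text \<open>Induction down the rows: each row ends up the same for both words and hands equal words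
  or again a triple to the next one.\<close>

lemma fold_tableau_insert_triple:
  assumes "\<forall>r \<in> set T. sorted_wrt (<) r" "knuth_triple u v" "distinct (concat T)"
    "set u \<inter> set (concat T) = {}"
  shows "fold tableau_insert u T = fold tableau_insert v T"
  using assms
proof (induction T arbitrary: u v)
  case Nil
  obtain x y z where "x < y" "y < z"
    "u = [x, z, y] \<and> v = [z, x, y] \<or> u = [y, x, z] \<and> v = [y, z, x] \<or>
      v = [x, z, y] \<and> u = [z, x, y] \<or> v = [y, x, z] \<and> u = [y, z, x]"
    using Nil(2) unfolding knuth_triple_def by blast
  then show ?case by auto
next
  case (Cons r T)
  let ?bu = "snd (row_insert_word u r)" and ?bv = "snd (row_insert_word v r)"
  have row: "fst (row_insert_word u r) = fst (row_insert_word v r)"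
    "?bu = ?bv \<or> knuth_triple ?bu ?bv"
    using row_insert_word_triple[of r u v] Cons.prems by auto
  have "set ?bu \<inter> set (concat T) = {}"
    using row_insert_word_set[of u r] Cons.prems by fastforce
  then have "fold tableau_insert ?bu T = fold tableau_insert ?bv T"
    using row(2) Cons.IH[of ?bu ?bv] Cons.prems by auto
  then show ?case using row(1) by (simp add: fold_tableau_insert_Cons)
qed

lemma knuth_step_tripleE:
  assumes "knuth_step u v"
  obtains l r s t where "u = l @ s @ r" "v = l @ t @ r" "knuth_triple s t"
  using assms unfolding knuth_triple_def
  by (cases rule: knuth_step.cases) blast+

lemma knuth_step_fold_tableau_insert:
  assumes "knuth_step u v" "distinct u"
  shows "fold tableau_insert u [] = fold tableau_insert v []"
proof -
  obtain l r s t where uv: "u = l @ s @ r" "v = l @ t @ r" "knuth_triple s t"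
    using knuth_step_tripleE[OF assms(1)] .
  let ?T = "fold tableau_insert l []"
  have mset: "mset (concat ?T) = mset l" using fold_tableau_insert_mset[of l "[]"] by simp
  have "distinct (concat ?T)" "set (concat ?T) = set l"
    using mset_eq_imp_distinct_iff[OF mset] mset_eq_setD[OF mset] uv assms(2) by auto
  then have "fold tableau_insert s ?T = fold tableau_insert t ?T"
    using fold_tableau_insert_sorted[of "[]" l] uv assms(2)
    by (intro fold_tableau_insert_triple) auto
  then show ?thesis using uv by simp
qed

lemma knuth_equiv_mset: "knuth_equiv u v \<Longrightarrow> mset u = mset v"
  by (induction rule: equivclp_induct) (auto dest: knuth_step_mset)

lemma knuth_equiv_fold_tableau_insert:
  assumes "knuth_equiv u v" "distinct u"
  shows "fold tableau_insert u [] = fold tableau_insert v []"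
  using assms
proof (induction rule: equivclp_induct)
  case (step v w)
  have "distinct v"
    using mset_eq_imp_distinct_iff[OF knuth_equiv_mset[OF step.hyps(1)]] step.prems by simp
  moreover have "mset v = mset w" using step.hyps(2) knuth_step_mset by metis
  ultimately have "distinct v" "distinct w" using mset_eq_imp_distinct_iff by metis+
  then have "fold tableau_insert v [] = fold tableau_insert w []"
    using step.hyps(2) knuth_step_fold_tableau_insert by metis
  with step show ?case by simp
qed simp

text \<open>The head of \<open>zs\<close> stands right after \<open>a\<close> and \<open>b\<close>
  and lies between them in value, so it witnesses the exchange.\<close>

lemma knuth_equiv_row_cons:
  assumes "sorted_wrt (<) (a # zs)" "zs \<noteq> []" "hd zs < b"
  shows "knuth_equiv (a # b # zs) (b # a # zs)"
proof -
  obtain h t where zs: "zs = h # t" using assms(2) by (cases zs) auto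
  have "knuth_step ([] @ [a, b, h] @ t) ([] @ [b, a, h] @ t)"
    using assms zs by (intro knuth_step.xzy) auto
  then show ?thesis using zs by (simp add: r_into_equivclp)
qed

text \<open>The letter \<open>x\<close> travels left past the letters that are larger than the bumped one.\<close>

lemma knuth_equiv_bump_head:
  assumes "sorted_wrt (<) (y # ys)" "x < y"
  shows "knuth_equiv (y # ys @ [x]) (y # x # ys)"
  using assms
proof (induction ys arbitrary: y)
  case (Cons b ys)
  have "knuth_equiv (y # (b # ys @ [x])) (y # (b # x # ys))"
    using Cons knuth_equiv_appendI[of "b # ys @ [x]" "b # x # ys" "[y]"] by auto
  moreover have "knuth_step ([] @ [y, x, b] @ ys) ([] @ [y, b, x] @ ys)"
    using Cons.prems by (intro knuth_step.yxz) auto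
  ultimately show ?case
    by (metis append_Cons append_Nil converse_r_into_equivclp equivclp_trans)
qed simp

lemma knuth_equiv_row_insert_Some:
  assumes "row_insert x r = (s, Some b)" "sorted_wrt (<) r" "x \<notin> set r"
  shows "knuth_equiv (r @ [x]) (b # s)"
  using assms
proof (induction x r arbitrary: s rule: row_insert.induct)
  case (2 x a r)
  show ?case
  proof (cases "x < a")
    case True
    with 2 knuth_equiv_bump_head[of a r x] show ?thesis by simp
  next
    case False
    with 2 obtain t where t: "row_insert x r = (t, Some b)" "s = a # t"
      by (auto split: prod.splits)
    have "knuth_equiv (a # r @ [x]) (a # b # t)"
      using 2 False t knuth_equiv_appendI[of "r @ [x]" "b # t" "[a]"] by simp
    moreover have "knuth_equiv (a # b # t) (b # a # t)"
    proof (rule knuth_equiv_row_cons)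
      have tx: "x \<in> set t" using row_insert_set[OF t(1)] by simp
      then show "t \<noteq> []" by auto
      have st: "sorted_wrt (<) (a # t)"
        using row_insert_sorted[of x "a # r" "a # t"] 2(2-) t False by simp
      then show "sorted_wrt (<) (a # t)" .
      have "hd t \<le> x" using tx st by (cases t) auto
      then show "hd t < b" using row_insert_Some_gt[OF t(1)] by simp
    qed
    ultimately show ?thesis using t equivclp_trans by fastforce
  qed
qed simp

lemma row_insert_None_append:
  "row_insert x r = (s, None) \<Longrightarrow> s = r @ [x]"
  by (induction x r arbitrary: s rule: row_insert.induct) (auto split: if_splits prod.splits)

section \<open>Words and the reading words of their tableaux\<close>

definition reading_word :: "nat list list \<Rightarrow> nat list" where
  "reading_word T = concat (rev T)"

text \<open>Rows are read from the bottom up, so a bumped letter, once moved to the front of its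
  row, stands right behind the row that it has to enter next.\<close>

lemma knuth_equiv_tableau_insert:
  assumes "\<forall>r \<in> set T. sorted_wrt (<) r" "distinct (x # concat T)"
  shows "knuth_equiv (reading_word T @ [x]) (reading_word (tableau_insert x T))"
  using assms
proof (induction x T rule: tableau_insert.induct)
  case (1 x)
  then show ?case by (simp add: reading_word_def)
next
  case (2 x r rs)
  obtain s c where s: "row_insert x r = (s, c)" by force
  show ?case
  proof (cases c)
    case None
    then show ?thesis using s row_insert_None_append[of x r s] by (simp add: reading_word_def)
  next
    case (Some b)
    have "knuth_equiv (reading_word rs @ r @ [x]) (reading_word rs @ b # s)"
      using s Some 2(2-) by (intro knuth_equiv_appendI knuth_equiv_row_insert_Some) auto
    moreover have "b \<in> set r" using s Some row_insert_Some_gt by simp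
    then have "knuth_equiv ((reading_word rs @ [b]) @ s) (reading_word (tableau_insert b rs) @ s)"
      using "2.IH"[OF s[symmetric], of b] Some "2.prems" by (intro knuth_equiv_appendI2) auto
    ultimately show ?thesis using s Some equivclp_trans by (fastforce simp: reading_word_def)
  qed
qed

lemma knuth_equiv_reading_word:
  "distinct u \<Longrightarrow> knuth_equiv u (reading_word (fold tableau_insert u []))"
proof (induction u rule: rev_induct)
  case Nil
  then show ?case by (simp add: reading_word_def)
next
  case (snoc x u)
  let ?T = "fold tableau_insert u []"
  have mset: "mset (x # concat ?T) = mset (u @ [x])"
    using fold_tableau_insert_mset[of u "[]"] by simp
  have "distinct (x # concat ?T)" using mset_eq_imp_distinct_iff[OF mset] snoc by blast
  then have "knuth_equiv (reading_word ?T @ [x]) (reading_word (tableau_insert x ?T))"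
    using fold_tableau_insert_sorted[of "[]" u] snoc by (intro knuth_equiv_tableau_insert) auto
  moreover have "knuth_equiv (u @ [x]) (reading_word ?T @ [x])"
    using snoc by (intro knuth_equiv_appendI2) auto
  ultimately show ?case using equivclp_trans by fastforce
qed

theorem knuth_equiv_iff:
  assumes "distinct u" "distinct v"
  shows "knuth_equiv u v \<longleftrightarrow> fold tableau_insert u [] = fold tableau_insert v []"
  using knuth_equiv_fold_tableau_insert[OF _ assms(1)] knuth_equiv_reading_word[OF assms(1)]
    knuth_equiv_reading_word[OF assms(2)] by (metis equivclp_sym equivclp_trans)

section \<open>Standardness of insertion tableaux and reinsertion of reading words\<close>

fun dominates :: "nat list \<Rightarrow> nat list \<Rightarrow> bool" where
  "dominates r [] \<longleftrightarrow> True"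
| "dominates [] (c # s) \<longleftrightarrow> False"
| "dominates (a # r) (c # s) \<longleftrightarrow> a < c \<and> dominates r s"

lemma dominates_iff:
  "dominates r s \<longleftrightarrow> length s \<le> length r \<and> (\<forall>c < length s. r ! c < s ! c)"
  by (induction r s rule: dominates.induct) (auto simp: less_Suc_eq_0_disj All_less_Suc2)

fun is_tableau :: "nat list list \<Rightarrow> bool" where
  "is_tableau [] \<longleftrightarrow> True"
| "is_tableau (r # T) \<longleftrightarrow>
     r \<noteq> [] \<and> sorted_wrt (<) r \<and> (T \<noteq> [] \<longrightarrow> dominates r (hd T)) \<and> is_tableau T"

lemma is_tableau_iff:
  "is_tableau T \<longleftrightarrow>
     (\<forall>r \<in> set T. r \<noteq> [] \<and> sorted_wrt (<) r) \<and> sorted_wrt (\<ge>) (map length T) \<and>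
     (\<forall>k c. Suc k < length T \<longrightarrow> c < length (T ! Suc k) \<longrightarrow> T ! k ! c < T ! Suc k ! c)"
proof (induction T)
  case (Cons r T)
  show ?case
  proof (cases T)
    case (Cons s T')
    have all: "(\<forall>k c. Suc k < length (r # T) \<longrightarrow> c < length ((r # T) ! Suc k) \<longrightarrow>
        (r # T) ! k ! c < (r # T) ! Suc k ! c) \<longleftrightarrow>
      (\<forall>c < length s. r ! c < s ! c) \<and>
      (\<forall>k c. Suc k < length T \<longrightarrow> c < length (T ! Suc k) \<longrightarrow> T ! k ! c < T ! Suc k ! c)"
      (is "?l \<longleftrightarrow> ?r1 \<and> ?r2")
    proof (intro iffI conjI)
      assume l: ?l
      show ?r1 using l[rule_format, of 0] Cons by simp
      show ?r2 using l[rule_format, of "Suc _"] by simp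
    next
      assume r: "?r1 \<and> ?r2"
      show ?l
      proof (intro allI impI)
        fix k c
        assume "Suc k < length (r # T)" "c < length ((r # T) ! Suc k)"
        then show "(r # T) ! k ! c < (r # T) ! Suc k ! c"
          using r Cons by (cases k) auto
      qed
    qed
    have srt: "sorted_wrt (\<ge>) (map length (r # T)) \<longleftrightarrow>
        length s \<le> length r \<and> sorted_wrt (\<ge>) (map length T)"
      using Cons by auto
    show ?thesis
      unfolding is_tableau.simps Cons.IH all srt using Cons by (auto simp: dominates_iff)
  qed simp
qed simp

lemma SYT_iff: "T \<in> SYT n \<longleftrightarrow> is_tableau T \<and> distinct (concat T) \<and> set (concat T) = {1..n}"
  unfolding SYT_def is_tableau_iff by auto

lemma dominates_row_insert: "row_insert x r = (r', c) \<Longrightarrow> dominates r s \<Longrightarrow> dominates r' s"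
proof (induction r s arbitrary: r' rule: dominates.induct)
  case (3 a r c s)
  then show ?case by (auto split: if_splits prod.splits)
qed (auto split: if_splits prod.splits)

text \<open>Whatever stood below \<open>b\<close> was larger than \<open>b\<close>, so
  \<open>b\<close> settles weakly to the left of the column it came from, where the entries above
  are now smaller than \<open>b\<close>.\<close>

lemma dominates_row_insert_bumped:
  assumes "row_insert x r = (r', Some b)" "row_insert b s = (s', c)" "dominates r s"
    "sorted_wrt (<) r"
  shows "dominates r' s'"
  using assms
proof (induction r s arbitrary: r' s' rule: dominates.induct)
  case (1 r)
  then show ?case
    by (cases r) (auto split: if_splits prod.splits dest: row_insert_Some_gt)
next
  case (3 a r c s)
  show ?case
  proof (cases "x < a")
    case True
    with 3 show ?thesis by auto
  next
    case False
    then obtain t where t: "row_insert x r = (t, Some b)" "r' = a # t"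
      using 3 by (auto split: prod.splits)
    have "a < b" using row_insert_Some_gt[OF t(1)] 3 by simp
    with 3 t dominates_row_insert[OF t(1)] show ?thesis by (auto split: if_splits prod.splits)
  qed
qed simp

lemma row_insert_not_Nil: "row_insert x r = (s, c) \<Longrightarrow> s \<noteq> []"
  by (auto dest: row_insert_set)

lemma hd_tableau_insert: "T \<noteq> [] \<Longrightarrow> hd (tableau_insert x T) = fst (row_insert x (hd T))"
  by (cases T) (auto split: prod.splits option.splits)

lemma is_tableau_insert:
  "is_tableau T \<Longrightarrow> distinct (x # concat T) \<Longrightarrow> is_tableau (tableau_insert x T)"
proof (induction x T rule: tableau_insert.induct)
  case (2 x r T)
  obtain s c where s: "row_insert x r = (s, c)" by force
  have srt: "sorted_wrt (<) s" "s \<noteq> []"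
    using row_insert_sorted[OF s] row_insert_not_Nil[OF s] 2 by auto
  show ?case
  proof (cases c)
    case None
    with 2 s srt dominates_row_insert[OF s] show ?thesis by auto
  next
    case (Some b)
    have b: "b \<in> set r" "x < b" using s Some row_insert_Some_gt by auto
    have dom: "dominates s (hd (tableau_insert b T))"
    proof (cases "T = []")
      case True
      have "dominates s [b]"
        using dominates_row_insert_bumped[of x r s b "[]" "[b]" None] s Some 2 by simp
      with True show ?thesis by simp
    next
      case False
      obtain t d where "row_insert b (hd T) = (t, d)" by force
      with False show ?thesis
        using dominates_row_insert_bumped[of x r s b "hd T" t d] s Some 2
        by (simp add: hd_tableau_insert)
    qed
    have "is_tableau (tableau_insert b T)"
      using "2.IH"[OF s[symmetric] Some] "2.prems" b by auto
    with srt dom s Some show ?thesis by simp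
  qed
qed simp

lemma is_tableau_fold_insert:
  "is_tableau T \<Longrightarrow> distinct (u @ concat T) \<Longrightarrow> is_tableau (fold tableau_insert u T)"
proof (induction u arbitrary: T)
  case (Cons x u)
  have eq: "mset (u @ concat (tableau_insert x T)) = mset ((x # u) @ concat T)"
    using tableau_insert_mset[of x T] by simp
  have "distinct (u @ concat (tableau_insert x T))"
    using Cons.prems(2) mset_eq_imp_distinct_iff[OF eq] by simp
  with Cons is_tableau_insert[of T x] show ?case by simp
qed simp

text \<open>Each letter of \<open>r\<close> bumps the letter of \<open>s\<close> in its own column,
  or is appended if there is none; thus \<open>s\<close> is handed on whole.\<close>

lemma row_insert_word_dominated:
  "sorted_wrt (<) r \<Longrightarrow> sorted_wrt (<) s \<Longrightarrow> dominates r s \<Longrightarrow> row_insert_word r s = (r, s)"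
proof (induction r s rule: dominates.induct)
  case (1 r)
  have "sorted_wrt (<) (l @ r) \<Longrightarrow> row_insert_word r l = (l @ r, [])" for l
  proof (induction r arbitrary: l)
    case (Cons x r)
    have "\<forall>y \<in> set l. y < x \<Longrightarrow> row_insert x l = (l @ [x], None)" for l
      by (induction l) auto
    with Cons show ?case by (simp add: sorted_wrt_append)
  qed simp
  from this[of "[]"] 1 show ?case by simp
next
  case (3 a r c s)
  have ge: "\<forall>x \<in> set r. \<not> x < a" using 3 by auto
  show ?case using 3 by (simp add: row_insert_word_ge[OF ge])
qed simp

lemma fold_insert_row:
  "is_tableau (r # T) \<Longrightarrow> fold tableau_insert r T = r # T"
proof (induction T arbitrary: r)
  case Nil
  then show ?case
    using row_insert_word_dominated[of r "[]"] fold_tableau_insert_Nil[of r] by simp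
next
  case (Cons s T)
  then show ?case
    using row_insert_word_dominated[of r s] by (simp add: fold_tableau_insert_Cons)
qed

lemma fold_insert_reading_word: "is_tableau T \<Longrightarrow> fold tableau_insert (reading_word T) [] = T"
  by (induction T) (auto simp: reading_word_def fold_insert_row)

section \<open>Words of permutations\<close>

definition perm_word :: "nat \<Rightarrow> (nat \<Rightarrow> nat) \<Rightarrow> nat list" where
  "perm_word n w = map w [1..<Suc n]"

text \<open>The inverse permutation of a one-line word, with positions counted from 0; for a letter
  that does not occur it is the length of the word.\<close>

definition pos :: "nat list \<Rightarrow> nat \<Rightarrow> nat" where
  "pos u i = length (takeWhile (\<lambda>x. x \<noteq> i) u)"

lemma RS_perm_word: "RS n w = fold tableau_insert (perm_word n w) []"
  by (simp add: RS_def perm_word_def)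

lemma perm_word_distinct: "w permutes {1..n} \<Longrightarrow> distinct (perm_word n w)"
  unfolding perm_word_def by (simp add: distinct_map permutes_inj_on del: upt_Suc)

lemma perm_word_set: "w permutes {1..n} \<Longrightarrow> set (perm_word n w) = {1..n}"
  unfolding perm_word_def using permutes_image[of w "{1..n}"]
  by (simp add: atLeastLessThanSuc_atLeastAtMost del: upt_Suc)

lemma perm_word_exists:
  assumes "distinct u" "set u = {1..n}"
  obtains w where "w permutes {1..n}" "perm_word n w = u"
proof -
  define w where "w i = (if i \<in> {1..n} then u ! (i - 1) else i)" for i
  have len: "length u = n" using distinct_card[OF assms(1)] assms(2) by simp
  have "bij_betw w {1..n} {1..n}"
  proof (rule bij_betwI')
    fix i j assume "i \<in> {1..n}" "j \<in> {1..n}"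
    then show "w i = w j \<longleftrightarrow> i = j"
      using assms(1) len by (auto simp: w_def nth_eq_iff_index_eq)
  next
    fix i assume "i \<in> {1..n}"
    then have "u ! (i - 1) \<in> set u" using len by (intro nth_mem) auto
    with \<open>i \<in> {1..n}\<close> show "w i \<in> {1..n}" using assms(2) by (simp add: w_def)
  next
    fix j assume "j \<in> {1..n}"
    then obtain p where "p < length u" "u ! p = j" using assms(2) by (metis in_set_conv_nth)
    then show "\<exists>i \<in> {1..n}. j = w i" using len by (intro bexI[of _ "Suc p"]) (auto simp: w_def)
  qed
  then have perm: "w permutes {1..n}" by (rule bij_imp_permutes) (auto simp: w_def)
  have "perm_word n w = u"
    by (rule nth_equalityI) (auto simp: perm_word_def len w_def simp del: upt_Suc)
  with perm that show thesis by blast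
qed

lemma RS_in_SYT:
  assumes "w permutes {1..n}"
  shows "RS n w \<in> SYT n"
proof -
  have mset: "mset (concat (RS n w)) = mset (perm_word n w)"
    using fold_tableau_insert_mset[of "perm_word n w" "[]"] by (simp add: RS_perm_word)
  then show ?thesis
    unfolding SYT_iff
    using is_tableau_fold_insert[of "[]" "perm_word n w"] perm_word_distinct[OF assms]
      perm_word_set[OF assms] mset_eq_setD[OF mset] mset_eq_imp_distinct_iff[OF mset]
    by (simp add: RS_perm_word)
qed

text \<open>The reading word of \<open>T\<close>, taken as a one-line word, inserts to
  \<open>T\<close>, so the choice in \<open>RS_rep\<close> has a candidate.\<close>

lemma SYT_rep:
  assumes "T \<in> SYT n"
  shows "RS_rep n T permutes {1..n}" "RS n (RS_rep n T) = T"
proof -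
  have mset: "mset (reading_word T) = mset (concat T)"
    by (simp add: reading_word_def mset_concat rev_map[symmetric] flip: mset_map)
  have "distinct (reading_word T)" "set (reading_word T) = {1..n}"
    using assms mset_eq_setD[OF mset] mset_eq_imp_distinct_iff[OF mset] by (auto simp: SYT_iff)
  then obtain w where "w permutes {1..n}" "perm_word n w = reading_word T"
    by (rule perm_word_exists)
  then have "\<exists>w. w permutes {1..n} \<and> RS n w = T"
    using fold_insert_reading_word[of T] assms by (auto simp: RS_perm_word SYT_iff)
  from someI_ex[OF this] show "RS_rep n T permutes {1..n}" "RS n (RS_rep n T) = T"
    unfolding RS_rep_def by blast+
qed

lemma RS_eq_iff:
  assumes "w permutes {1..n}" "y permutes {1..n}"
  shows "RS n w = RS n y \<longleftrightarrow> knuth_equiv (perm_word n w) (perm_word n y)"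
  using knuth_equiv_iff[OF perm_word_distinct[OF assms(1)] perm_word_distinct[OF assms(2)]]
  by (simp add: RS_perm_word)

lemma pos_less: "i \<in> set u \<Longrightarrow> pos u i < length u"
  unfolding pos_def by (induction u) auto

lemma nth_pos: "i \<in> set u \<Longrightarrow> u ! pos u i = i"
  unfolding pos_def by (induction u) auto

lemma inv_perm_word:
  assumes "w permutes {1..n}" "i \<in> {1..n}"
  shows "inv_into UNIV w i = Suc (pos (perm_word n w) i)"
proof -
  let ?p = "pos (perm_word n w) i"
  have "?p < length (perm_word n w)" "perm_word n w ! ?p = i"
    using pos_less nth_pos perm_word_set[OF assms(1)] assms(2) by auto
  then have "w (Suc ?p) = i" by (simp add: perm_word_def del: upt_Suc)
  then show ?thesis using permutes_inverses(2)[OF assms(1)] by metis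
qed

lemma pos_inj: "i \<in> set u \<Longrightarrow> j \<in> set u \<Longrightarrow> pos u i = pos u j \<longleftrightarrow> i = j"
  by (metis nth_pos)

lemma pos_map:
  assumes "\<And>x. s (s x) = x"
  shows "pos (map s u) i = pos u (s i)"
proof -
  have "(\<lambda>x. x \<noteq> i) \<circ> s = (\<lambda>x. x \<noteq> s i)" using assms by (auto simp: fun_eq_iff)
  then show ?thesis by (simp add: pos_def takeWhile_map)
qed

lemma pos_append: "pos (u @ v) i = (if i \<in> set u then pos u i else length u + pos v i)"
  unfolding pos_def by (auto simp: takeWhile_append)

lemma pos_Cons: "pos (a # u) i = (if a = i then 0 else Suc (pos u i))"
  by (simp add: pos_def)

section \<open>The operators on one-line words\<close>

definition in_D :: "nat \<Rightarrow> nat \<Rightarrow> nat list \<Rightarrow> bool" where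
  "in_D \<alpha> \<beta> u \<longleftrightarrow> pos u \<alpha> < pos u (Suc \<alpha>) \<and> pos u (Suc \<beta>) < pos u \<beta>"

text \<open>Left multiplication by a reflection renames letters, so the test on the tau-invariant of
  the reflected word becomes a comparison of renamed letters in \<open>u\<close>. For adjacent roots
  with smaller index i it always compares the places of i and i + 2.\<close>

definition word_op :: "nat \<Rightarrow> nat \<Rightarrow> nat list \<Rightarrow> nat list" where
  "word_op \<alpha> \<beta> u =
     (if pos u (simple_refl \<alpha> \<beta>) < pos u (simple_refl \<alpha> (Suc \<beta>))
      then map (simple_refl \<alpha>) u else map (simple_refl \<beta>) u)"

lemma simple_refl_invol [simp]: "simple_refl \<alpha> (simple_refl \<alpha> i) = i"
  by (simp add: simple_refl_def)

lemma simple_refl_apply: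
  "simple_refl \<alpha> i = (if i = \<alpha> then Suc \<alpha> else if i = Suc \<alpha> then \<alpha> else i)"
  by (simp add: simple_refl_def transpose_def)

lemma pos_map_refl: "pos (map (simple_refl \<alpha>) u) i = pos u (simple_refl \<alpha> i)"
  by (rule pos_map) simp

lemma simple_refl_mono:
  "i < j \<Longrightarrow> \<not> (i = \<alpha> \<and> j = Suc \<alpha>) \<Longrightarrow> simple_refl \<alpha> i < simple_refl \<alpha> j"
  by (auto simp: simple_refl_apply)

text \<open>Of the letters i, i + 1, i + 2, with i the smaller root, i + 1 comes last if \<alpha> =
  i and first if \<beta> = i. The operator brings it to the other end, and the operator for the
  exchanged roots picks the same reflection to bring it back.\<close>

lemma word_op_inverse:
  assumes "adjacent_roots \<alpha> \<beta>" "in_D \<alpha> \<beta> u"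
    and "{\<alpha>, Suc \<alpha>, \<beta>, Suc \<beta>} \<subseteq> set u"
  shows "in_D \<beta> \<alpha> (word_op \<alpha> \<beta> u)" "word_op \<beta> \<alpha> (word_op \<alpha> \<beta> u) = u"
proof -
  have inv: "map (simple_refl \<gamma>) (map (simple_refl \<gamma>) u) = u" for \<gamma>
    by (simp add: o_def)
  from assms consider (A) "\<beta> = Suc \<alpha>" | (B) "\<alpha> = Suc \<beta>" by (auto simp: adjacent_roots_def)
  then have "in_D \<beta> \<alpha> (word_op \<alpha> \<beta> u) \<and> word_op \<beta> \<alpha> (word_op \<alpha> \<beta> u) = u"
  proof cases
    case A
    have ne: "pos u \<alpha> \<noteq> pos u (Suc (Suc \<alpha>))"
      using pos_inj[of \<alpha> u "Suc (Suc \<alpha>)"] assms A by simp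
    show ?thesis
      using assms(2) ne unfolding A in_D_def word_op_def
      by (auto simp: pos_map_refl simple_refl_apply inv simp del: map_map)
  next
    case B
    have ne: "pos u \<beta> \<noteq> pos u (Suc (Suc \<beta>))"
      using pos_inj[of \<beta> u "Suc (Suc \<beta>)"] assms B by simp
    show ?thesis
      using assms(2) ne unfolding B in_D_def word_op_def
      by (auto simp: pos_map_refl simple_refl_apply inv simp del: map_map)
  qed
  then show "in_D \<beta> \<alpha> (word_op \<alpha> \<beta> u)" "word_op \<beta> \<alpha> (word_op \<alpha> \<beta> u) = u" by auto
qed

lemma map_refl_id: "\<alpha> \<notin> set u \<Longrightarrow> Suc \<alpha> \<notin> set u \<Longrightarrow> map (simple_refl \<alpha>) u = u"
  by (rule map_idI) (auto simp: simple_refl_apply)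

text \<open>No position lies between \<open>k\<close> and \<open>Suc k\<close>, so the exchange
  affects only the comparison of \<open>x\<close> with \<open>z\<close>.\<close>

lemma swap_adjacent_less:
  fixes p q :: "nat \<Rightarrow> nat"
  assumes "p x = k" "p z = Suc k" "q x = Suc k" "q z = k"
    and "a \<noteq> x \<Longrightarrow> a \<noteq> z \<Longrightarrow> q a = p a \<and> p a \<noteq> k \<and> p a \<noteq> Suc k"
    and "b \<noteq> x \<Longrightarrow> b \<noteq> z \<Longrightarrow> q b = p b \<and> p b \<noteq> k \<and> p b \<noteq> Suc k"
    and "\<not> (a = x \<and> b = z)" "\<not> (a = z \<and> b = x)"
  shows "p a < p b \<longleftrightarrow> q a < q b"
  using assms by (cases "a = x"; cases "a = z"; cases "b = x"; cases "b = z") auto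

text \<open>A Knuth move exchanges neighbours \<open>p < q\<close> with a witness strictly between them in value,
  so the only relative order among \<open>i, i + 1, i + 2\<close> that it can change is that of \<open>i\<close> and
  \<open>i + 2\<close>, and then \<open>i + 1\<close> is the witness.\<close>

lemma word_op_knuth_step:
  assumes "knuth_step u v" "adjacent_roots \<alpha> \<beta>" "distinct u"
    and "{\<alpha>, Suc \<alpha>, \<beta>, Suc \<beta>} \<subseteq> set u"
    and "in_D \<alpha> \<beta> u \<or> in_D \<alpha> \<beta> v"
  shows "in_D \<alpha> \<beta> u" "in_D \<alpha> \<beta> v" "knuth_equiv (word_op \<alpha> \<beta> u) (word_op \<alpha> \<beta> v)"
proof -
  define i where "i = min \<alpha> \<beta>"
  have i: "\<alpha> = i \<and> \<beta> = Suc i \<or> \<alpha> = Suc i \<and> \<beta> = i"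
    using assms(2) by (auto simp: adjacent_roots_def i_def)
  have mem: "i \<in> set u" "Suc i \<in> set u" "Suc (Suc i) \<in> set u" using assms(4) i by auto
  have "in_D \<alpha> \<beta> u \<and> in_D \<alpha> \<beta> v \<and> knuth_equiv (word_op \<alpha> \<beta> u) (word_op \<alpha> \<beta> v)"
    using assms(1)
  proof (cases rule: knuth_step.cases)
    case (xzy x y z l r)
    have dist: "distinct (l @ [x, z, y] @ r)" using assms(3) xzy by simp
    have pu: "pos u j = (if j = x then length l else if j = z then Suc (length l)
        else if j = y then Suc (Suc (length l)) else if j \<in> set l then pos l j
        else Suc (Suc (Suc (length l + pos r j))))" for j
      unfolding xzy using dist by (auto simp: pos_append pos_Cons)
    have pv: "pos v j = (if j = z then length l else if j = x then Suc (length l)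
        else if j = y then Suc (Suc (length l)) else if j \<in> set l then pos l j
        else Suc (Suc (Suc (length l + pos r j))))" for j
      unfolding xzy using dist by (auto simp: pos_append pos_Cons)
    have pl: "j \<in> set l \<Longrightarrow> pos l j < length l" for j by (rule pos_less)
    show ?thesis
    proof (cases "x = i \<and> z = Suc (Suc i)")
      case True
      then have xyz: "x = i" "y = Suc i" "z = Suc (Suc i)" using xzy by auto
      have l: "i \<notin> set l" "Suc i \<notin> set l" "Suc (Suc i) \<notin> set l"
        and r: "i \<notin> set r" "Suc i \<notin> set r" "Suc (Suc i) \<notin> set r"
        using dist xyz by auto
      have id: "map (simple_refl i) l = l" "map (simple_refl (Suc i)) l = l"
        "map (simple_refl i) r = r" "map (simple_refl (Suc i)) r = r"
        using l r by (auto intro!: map_refl_id)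
      have D: "\<alpha> = i" "\<beta> = Suc i"
        using assms(5) i unfolding in_D_def pu pv xyz by auto
      \<comment> \<open>The order of i and i + 2 decides which reflection is applied, so
        \<open>u\<close> and \<open>v\<close> get different ones. Their images differ by a Knuth
        move of the other kind, in the opposite direction.\<close>
      have k: "knuth_step (l @ [Suc i, i, Suc (Suc i)] @ r) (l @ [Suc i, Suc (Suc i), i] @ r)"
        by (rule knuth_step.yxz) auto
      have "word_op \<alpha> \<beta> u = l @ [Suc i, Suc (Suc i), i] @ r"
        "word_op \<alpha> \<beta> v = l @ [Suc i, i, Suc (Suc i)] @ r"
        unfolding word_op_def D pu pv unfolding xzy xyz
        by (simp_all add: simple_refl_apply id[unfolded simple_refl_apply] id)
      moreover have "in_D \<alpha> \<beta> u" "in_D \<alpha> \<beta> v" unfolding in_D_def D pu pv xyz by auto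
      ultimately show ?thesis using k by (metis equivclp_sym r_into_equivclp)
    next
      case False
      have px: "pos u x = length l" "pos u z = Suc (length l)" "pos u y = Suc (Suc (length l))"
        using dist by (simp_all add: pu)
      have mid: "j = z" if "j \<in> set u" "pos u j = Suc (length l)" for j
        using that px(2) pos_inj[of j u z] xzy by auto
      have mid0: "j = x"
        if "j \<in> set u" "pos u j < Suc (length l)" "\<not> pos u j < length l" for j
        using that px(1) pos_inj[of j u x] xzy by auto
      have mid2: "j = y"
        if "j \<in> set u" "Suc (length l) < pos u j" "\<not> Suc (Suc (length l)) < pos u j" for j
        using that px(3) pos_inj[of j u y] xzy by auto
      have ord: "pos u a < pos u b \<longleftrightarrow> pos v a < pos v b"
        if "a \<in> {i, Suc i, Suc (Suc i)}" "b \<in> {i, Suc i, Suc (Suc i)}" for a b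
      proof (rule swap_adjacent_less[of "pos u" x "length l" z "pos v"])
        have in_u: "a \<in> set u" "b \<in> set u" using that mem by auto
        have "pos v c = pos u c \<and> pos u c \<noteq> length l \<and> pos u c \<noteq> Suc (length l)"
          if "c \<noteq> x" "c \<noteq> z" "c \<in> set u" for c
        proof -
          have "x \<in> set u" "z \<in> set u" by (simp_all add: xzy)
          moreover have "pos v c = pos u c" unfolding pu pv using that by simp
          ultimately show ?thesis
            using that px pos_inj[OF that(3), of x] pos_inj[OF that(3), of z] by metis
        qed
        from this[of a] this[of b] in_u
        show "a \<noteq> x \<Longrightarrow> a \<noteq> z \<Longrightarrow> pos v a = pos u a \<and> pos u a \<noteq> length l \<and> pos u a \<noteq> Suc (length l)"
          "b \<noteq> x \<Longrightarrow> b \<noteq> z \<Longrightarrow> pos v b = pos u b \<and> pos u b \<noteq> length l \<and> pos u b \<noteq> Suc (length l)"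
          by auto
      qed (use px dist that False xzy(3,4) in \<open>auto simp: pv\<close>)
      have D: "in_D \<alpha> \<beta> u \<longleftrightarrow> in_D \<alpha> \<beta> v"
        using i ord[of \<alpha> "Suc \<alpha>"] ord[of "Suc \<beta>" \<beta>] unfolding in_D_def by auto
      have same: "pos u (simple_refl \<alpha> \<beta>) < pos u (simple_refl \<alpha> (Suc \<beta>)) \<longleftrightarrow>
          pos v (simple_refl \<alpha> \<beta>) < pos v (simple_refl \<alpha> (Suc \<beta>))"
        by (rule ord) (use i in \<open>auto simp: simple_refl_apply\<close>)
      have step: "knuth_step (map s u) (map s v)" if "s x < s y" "s y < s z" for s :: "nat \<Rightarrow> nat"
        using knuth_step.xzy[OF that, of "map s l" "map s r"] unfolding xzy by simp
      define \<gamma> where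
        "\<gamma> = (if pos u (simple_refl \<alpha> \<beta>) < pos u (simple_refl \<alpha> (Suc \<beta>)) then \<alpha> else \<beta>)"
      have op: "word_op \<alpha> \<beta> u = map (simple_refl \<gamma>) u" "word_op \<alpha> \<beta> v = map (simple_refl \<gamma>) v"
        unfolding word_op_def same \<gamma>_def by simp_all
      have "knuth_equiv (word_op \<alpha> \<beta> u) (word_op \<alpha> \<beta> v)" if inD: "in_D \<alpha> \<beta> u"
      proof -
        \<comment> \<open>By \<open>inD\<close> and the choice of \<gamma>, the third of the letters
          i, i + 1, i + 2 stands between \<gamma> and \<gamma> + 1 in the word. Between
          \<open>x\<close> and \<open>y\<close> there is only \<open>z\<close>, which gives the
          excluded case, and between \<open>y\<close> and \<open>z\<close> there is nothing.\<close>
        have ex: "\<not> (a = \<gamma> \<and> b = Suc \<gamma>)" if "a = x \<and> b = y \<or> a = y \<and> b = z" for a b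
          using i
        proof
          assume i: "\<alpha> = i \<and> \<beta> = Suc i"
          show ?thesis
            using that inD False xzy(3,4) mid0[OF mem(1)] mid0[OF mem(3)] mid2[OF mem(1)] mid2[OF mem(3)]
              mid[OF mem(1)] mid[OF mem(2)] mid[OF mem(3)] px
            unfolding in_D_def \<gamma>_def i[THEN conjunct1] i[THEN conjunct2]
            by (cases "pos u i < pos u (Suc (Suc i))") (auto simp: simple_refl_apply)
        next
          assume i: "\<alpha> = Suc i \<and> \<beta> = i"
          show ?thesis
            using that inD False xzy(3,4) mid0[OF mem(1)] mid0[OF mem(3)] mid2[OF mem(1)] mid2[OF mem(3)]
              mid[OF mem(1)] mid[OF mem(2)] mid[OF mem(3)] px
            unfolding in_D_def \<gamma>_def i[THEN conjunct1] i[THEN conjunct2]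
            by (cases "pos u i < pos u (Suc (Suc i))") (auto simp: simple_refl_apply)
        qed
        have "knuth_step (map (simple_refl \<gamma>) u) (map (simple_refl \<gamma>) v)"
          by (rule step; rule simple_refl_mono; use xzy(3,4) ex in blast)
        then show ?thesis unfolding op by (rule r_into_equivclp)
      qed
      with D assms(5) show ?thesis by auto
    qed
  next
    case (yxz x y z l r)
    have dist: "distinct (l @ [y, x, z] @ r)" using assms(3) yxz by simp
    have pu: "pos u j = (if j = y then length l else if j = x then Suc (length l)
        else if j = z then Suc (Suc (length l)) else if j \<in> set l then pos l j
        else Suc (Suc (Suc (length l + pos r j))))" for j
      unfolding yxz using dist by (auto simp: pos_append pos_Cons)
    have pv: "pos v j = (if j = y then length l else if j = z then Suc (length l)
        else if j = x then Suc (Suc (length l)) else if j \<in> set l then pos l j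
        else Suc (Suc (Suc (length l + pos r j))))" for j
      unfolding yxz using dist by (auto simp: pos_append pos_Cons)
    have pl: "j \<in> set l \<Longrightarrow> pos l j < length l" for j by (rule pos_less)
    show ?thesis
    proof (cases "x = i \<and> z = Suc (Suc i)")
      case True
      then have xyz: "x = i" "y = Suc i" "z = Suc (Suc i)" using yxz by auto
      have l: "i \<notin> set l" "Suc i \<notin> set l" "Suc (Suc i) \<notin> set l"
        and r: "i \<notin> set r" "Suc i \<notin> set r" "Suc (Suc i) \<notin> set r"
        using dist xyz by auto
      have id: "map (simple_refl i) l = l" "map (simple_refl (Suc i)) l = l"
        "map (simple_refl i) r = r" "map (simple_refl (Suc i)) r = r"
        using l r by (auto intro!: map_refl_id)
      have D: "\<alpha> = Suc i" "\<beta> = i"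
        using assms(5) i unfolding in_D_def pu pv xyz by auto
      have k: "knuth_step (l @ [i, Suc (Suc i), Suc i] @ r) (l @ [Suc (Suc i), i, Suc i] @ r)"
        by (rule knuth_step.xzy) auto
      have "word_op \<alpha> \<beta> u = l @ [Suc (Suc i), i, Suc i] @ r"
        "word_op \<alpha> \<beta> v = l @ [i, Suc (Suc i), Suc i] @ r"
        unfolding word_op_def D pu pv unfolding yxz xyz
        by (simp_all add: simple_refl_apply id[unfolded simple_refl_apply] id)
      moreover have "in_D \<alpha> \<beta> u" "in_D \<alpha> \<beta> v" unfolding in_D_def D pu pv xyz by auto
      ultimately show ?thesis using k by (metis equivclp_sym r_into_equivclp)
    next
      case False
      have px: "pos u y = length l" "pos u x = Suc (length l)" "pos u z = Suc (Suc (length l))"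
        using dist by (simp_all add: pu)
      have mid: "j = x" if "j \<in> set u" "pos u j = Suc (length l)" for j
        using that px(2) pos_inj[of j u x] yxz by auto
      have mid0: "j = y"
        if "j \<in> set u" "pos u j < Suc (length l)" "\<not> pos u j < length l" for j
        using that px(1) pos_inj[of j u y] yxz by auto
      have mid2: "j = z"
        if "j \<in> set u" "Suc (length l) < pos u j" "\<not> Suc (Suc (length l)) < pos u j" for j
        using that px(3) pos_inj[of j u z] yxz by auto
      have ord: "pos u a < pos u b \<longleftrightarrow> pos v a < pos v b"
        if "a \<in> {i, Suc i, Suc (Suc i)}" "b \<in> {i, Suc i, Suc (Suc i)}" for a b
      proof (rule swap_adjacent_less[of "pos u" x "Suc (length l)" z "pos v"])
        have in_u: "a \<in> set u" "b \<in> set u" using that mem by auto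
        have "pos v c = pos u c \<and> pos u c \<noteq> Suc (length l) \<and> pos u c \<noteq> Suc (Suc (length l))"
          if "c \<noteq> x" "c \<noteq> z" "c \<in> set u" for c
        proof -
          have "x \<in> set u" "z \<in> set u" by (simp_all add: yxz)
          moreover have "pos v c = pos u c" unfolding pu pv using that by simp
          ultimately show ?thesis
            using that px pos_inj[OF that(3), of x] pos_inj[OF that(3), of z] by metis
        qed
        from this[of a] this[of b] in_u
        show "a \<noteq> x \<Longrightarrow> a \<noteq> z \<Longrightarrow> pos v a = pos u a \<and> pos u a \<noteq> Suc (length l) \<and> pos u a \<noteq> Suc (Suc (length l))"
          "b \<noteq> x \<Longrightarrow> b \<noteq> z \<Longrightarrow> pos v b = pos u b \<and> pos u b \<noteq> Suc (length l) \<and> pos u b \<noteq> Suc (Suc (length l))"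
          by auto
      qed (use px dist that False yxz(3,4) in \<open>auto simp: pv\<close>)
      have D: "in_D \<alpha> \<beta> u \<longleftrightarrow> in_D \<alpha> \<beta> v"
        using i ord[of \<alpha> "Suc \<alpha>"] ord[of "Suc \<beta>" \<beta>] unfolding in_D_def by auto
      have same: "pos u (simple_refl \<alpha> \<beta>) < pos u (simple_refl \<alpha> (Suc \<beta>)) \<longleftrightarrow>
          pos v (simple_refl \<alpha> \<beta>) < pos v (simple_refl \<alpha> (Suc \<beta>))"
        by (rule ord) (use i in \<open>auto simp: simple_refl_apply\<close>)
      have step: "knuth_step (map s u) (map s v)" if "s x < s y" "s y < s z" for s :: "nat \<Rightarrow> nat"
        using knuth_step.yxz[OF that, of "map s l" "map s r"] unfolding yxz by simp
      define \<gamma> where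
        "\<gamma> = (if pos u (simple_refl \<alpha> \<beta>) < pos u (simple_refl \<alpha> (Suc \<beta>)) then \<alpha> else \<beta>)"
      have op: "word_op \<alpha> \<beta> u = map (simple_refl \<gamma>) u" "word_op \<alpha> \<beta> v = map (simple_refl \<gamma>) v"
        unfolding word_op_def same \<gamma>_def by simp_all
      have "knuth_equiv (word_op \<alpha> \<beta> u) (word_op \<alpha> \<beta> v)" if inD: "in_D \<alpha> \<beta> u"
      proof -
        have ex: "\<not> (a = \<gamma> \<and> b = Suc \<gamma>)" if "a = x \<and> b = y \<or> a = y \<and> b = z" for a b
          using i
        proof
          assume i: "\<alpha> = i \<and> \<beta> = Suc i"
          show ?thesis
            using that inD False yxz(3,4) mid0[OF mem(1)] mid0[OF mem(3)] mid2[OF mem(1)] mid2[OF mem(3)]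
              mid[OF mem(1)] mid[OF mem(2)] mid[OF mem(3)] px
            unfolding in_D_def \<gamma>_def i[THEN conjunct1] i[THEN conjunct2]
            by (cases "pos u i < pos u (Suc (Suc i))") (auto simp: simple_refl_apply)
        next
          assume i: "\<alpha> = Suc i \<and> \<beta> = i"
          show ?thesis
            using that inD False yxz(3,4) mid0[OF mem(1)] mid0[OF mem(3)] mid2[OF mem(1)] mid2[OF mem(3)]
              mid[OF mem(1)] mid[OF mem(2)] mid[OF mem(3)] px
            unfolding in_D_def \<gamma>_def i[THEN conjunct1] i[THEN conjunct2]
            by (cases "pos u i < pos u (Suc (Suc i))") (auto simp: simple_refl_apply)
        qed
        have "knuth_step (map (simple_refl \<gamma>) u) (map (simple_refl \<gamma>) v)"
          by (rule step; rule simple_refl_mono; use yxz(3,4) ex in blast)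
        then show ?thesis unfolding op by (rule r_into_equivclp)
      qed
      with D assms(5) show ?thesis by auto
    qed
  qed
  then show "in_D \<alpha> \<beta> u" "in_D \<alpha> \<beta> v" "knuth_equiv (word_op \<alpha> \<beta> u) (word_op \<alpha> \<beta> v)"
    by auto
qed

lemma word_op_knuth_equiv:
  assumes "knuth_equiv u v" "adjacent_roots \<alpha> \<beta>" "distinct u"
    and "{\<alpha>, Suc \<alpha>, \<beta>, Suc \<beta>} \<subseteq> set u" "in_D \<alpha> \<beta> u"
  shows "in_D \<alpha> \<beta> v \<and> knuth_equiv (word_op \<alpha> \<beta> u) (word_op \<alpha> \<beta> v)"
  using assms
proof (induction rule: equivclp_induct)
  case (step v w)
  have mset: "mset v = mset u" using knuth_equiv_mset[OF step.hyps(1)] by simp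
  then have v: "distinct v" "set v = set u"
    using mset_eq_setD step.prems mset_eq_imp_distinct_iff by metis+
  have mset': "mset w = mset v" using step.hyps(2) knuth_step_mset by metis
  then have w: "distinct w" "set w = set u"
    using mset_eq_setD v mset_eq_imp_distinct_iff by metis+
  have IH: "in_D \<alpha> \<beta> v" "knuth_equiv (word_op \<alpha> \<beta> u) (word_op \<alpha> \<beta> v)" using step by auto
  from step.hyps(2) have "in_D \<alpha> \<beta> w \<and> knuth_equiv (word_op \<alpha> \<beta> v) (word_op \<alpha> \<beta> w)"
  proof
    assume "knuth_step v w"
    from word_op_knuth_step[OF this] v w IH step.prems show ?thesis by auto
  next
    assume "knuth_step w v"
    from word_op_knuth_step[OF this] v w IH step.prems show ?thesis by (auto intro: equivclp_sym)
  qed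
  with IH show ?case by (auto intro: equivclp_trans)
qed simp

lemma simple_refl_permutes:
  assumes "\<alpha> \<in> simple_roots n"
  shows "simple_refl \<alpha> permutes {1..n}"
  using assms unfolding simple_refl_def simple_roots_def by (intro permutes_swap_id) auto

lemma perm_word_refl: "perm_word n (simple_refl \<alpha> \<circ> w) = map (simple_refl \<alpha>) (perm_word n w)"
  by (simp add: perm_word_def)

lemma tau_perm_word:
  assumes "w permutes {1..n}"
  shows "tau n w = {\<alpha> \<in> simple_roots n. pos (perm_word n w) (Suc \<alpha>) < pos (perm_word n w) \<alpha>}"
  using assms by (auto simp: tau_def simple_roots_def inv_perm_word)

lemma T_op_perm_word:
  assumes "w permutes {1..n}" "\<alpha> \<in> simple_roots n" "\<beta> \<in> simple_roots n"
  shows "T_op n \<alpha> \<beta> w permutes {1..n}"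
    and "perm_word n (T_op n \<alpha> \<beta> w) = word_op \<alpha> \<beta> (perm_word n w)"
proof -
  have perm: "simple_refl \<gamma> \<circ> w permutes {1..n}" if "\<gamma> \<in> simple_roots n" for \<gamma>
    using permutes_compose[OF assms(1) simple_refl_permutes[OF that]] .
  show "T_op n \<alpha> \<beta> w permutes {1..n}" using perm assms by (simp add: T_op_def)
  let ?u = "perm_word n w"
  have mem: "simple_refl \<alpha> \<beta> \<in> set ?u" "simple_refl \<alpha> (Suc \<beta>) \<in> set ?u"
    using assms by (auto simp: perm_word_set simple_refl_apply simple_roots_def)
  have "pos ?u (simple_refl \<alpha> \<beta>) \<noteq> pos ?u (simple_refl \<alpha> (Suc \<beta>))"
    using pos_inj[OF mem] by (metis n_not_Suc_n simple_refl_invol)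
  then have "\<beta> \<notin> tau n (simple_refl \<alpha> \<circ> w) \<longleftrightarrow>
      pos ?u (simple_refl \<alpha> \<beta>) < pos ?u (simple_refl \<alpha> (Suc \<beta>))"
    using assms perm by (auto simp: tau_perm_word perm_word_refl pos_map_refl)
  then show "perm_word n (T_op n \<alpha> \<beta> w) = word_op \<alpha> \<beta> ?u"
    unfolding T_op_def word_op_def by (simp add: perm_word_refl)
qed

lemma in_D_iff:
  assumes "w permutes {1..n}" "\<alpha> \<in> simple_roots n" "\<beta> \<in> simple_roots n"
  shows "in_D \<alpha> \<beta> (perm_word n w) \<longleftrightarrow> \<alpha> \<notin> tau n w \<and> \<beta> \<in> tau n w"
proof -
  have "\<alpha> \<in> set (perm_word n w)" "Suc \<alpha> \<in> set (perm_word n w)"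
    using assms by (auto simp: perm_word_set simple_roots_def)
  from pos_inj[OF this] show ?thesis using assms by (auto simp: tau_perm_word in_D_def)
qed

section \<open>Polynomial maps and Zariski closures\<close>

lemma poly_functions_sum:
  "(\<And>i. i \<in> A \<Longrightarrow> f i \<in> poly_functions n) \<Longrightarrow> (\<lambda>X. \<Sum>i\<in>A. f i X) \<in> poly_functions n"
  by (induction A rule: infinite_finite_induct) (auto intro: poly_functions.intros)

lemma poly_functions_prod:
  "(\<And>i. i \<in> A \<Longrightarrow> f i \<in> poly_functions n) \<Longrightarrow> (\<lambda>X. \<Prod>i\<in>A. f i X) \<in> poly_functions n"
  by (induction A rule: infinite_finite_induct) (auto intro: poly_functions.intros)

text \<open>Agreement with polynomials is asked on \<open>carrier_mat n n\<close> only, since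
  products and powers of matrices of other sizes do not follow the entry formulas for size
  \<open>n\<close>.\<close>

definition poly_map :: "nat \<Rightarrow> (complex mat \<Rightarrow> complex mat) \<Rightarrow> bool" where
  "poly_map n \<phi> \<longleftrightarrow> (\<forall>X \<in> carrier_mat n n. \<phi> X \<in> carrier_mat n n) \<and>
     (\<forall>a < n. \<forall>b < n. \<exists>f \<in> poly_functions n. \<forall>X \<in> carrier_mat n n. \<phi> X $$ (a, b) = f X)"

lemma poly_map_carrier: "poly_map n \<phi> \<Longrightarrow> X \<in> carrier_mat n n \<Longrightarrow> \<phi> X \<in> carrier_mat n n"
  by (simp add: poly_map_def)

lemma poly_map_compose:
  assumes "f \<in> poly_functions n" "poly_map n \<phi>"
  shows "\<exists>g \<in> poly_functions n. \<forall>X \<in> carrier_mat n n. f (\<phi> X) = g X"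
  using assms(1)
proof induction
  case (const c)
  then show ?case by (intro bexI[of _ "\<lambda>X. c"]) (auto intro: poly_functions.intros)
next
  case (entry a b)
  with assms(2) show ?case by (auto simp: poly_map_def)
next
  case (add f g)
  then obtain f' g' where "f' \<in> poly_functions n" "g' \<in> poly_functions n"
    "\<forall>X \<in> carrier_mat n n. f (\<phi> X) = f' X" "\<forall>X \<in> carrier_mat n n. g (\<phi> X) = g' X" by blast
  then show ?case by (intro bexI[of _ "\<lambda>X. f' X + g' X"]) (auto intro: poly_functions.intros)
next
  case (mult f g)
  then obtain f' g' where "f' \<in> poly_functions n" "g' \<in> poly_functions n"
    "\<forall>X \<in> carrier_mat n n. f (\<phi> X) = f' X" "\<forall>X \<in> carrier_mat n n. g (\<phi> X) = g' X" by blast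
  then show ?case by (intro bexI[of _ "\<lambda>X. f' X * g' X"]) (auto intro: poly_functions.intros)
qed

lemma poly_map_const: "A \<in> carrier_mat n n \<Longrightarrow> poly_map n (\<lambda>X. A)"
  unfolding poly_map_def by (auto intro: poly_functions.const)

lemma poly_map_id: "poly_map n (\<lambda>X. X)"
  unfolding poly_map_def by (auto intro!: poly_functions.entry)

lemma poly_map_mult:
  assumes "poly_map n \<phi>" "poly_map n \<psi>"
  shows "poly_map n (\<lambda>X. \<phi> X * \<psi> X)"
  unfolding poly_map_def
proof (intro conjI ballI allI impI)
  fix X :: "complex mat" assume "X \<in> carrier_mat n n"
  then show "\<phi> X * \<psi> X \<in> carrier_mat n n"
    using assms poly_map_carrier by (metis mult_carrier_mat)
next
  fix a b assume ab: "a < n" "b < n"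
  have "\<forall>k. \<exists>f. k < n \<longrightarrow> f \<in> poly_functions n \<and> (\<forall>X \<in> carrier_mat n n. \<phi> X $$ (a, k) = f X)"
    using assms(1) ab unfolding poly_map_def by blast
  then obtain f where f: "\<And>k. k < n \<Longrightarrow> f k \<in> poly_functions n \<and>
      (\<forall>X \<in> carrier_mat n n. \<phi> X $$ (a, k) = f k X)" by metis
  have "\<forall>k. \<exists>f. k < n \<longrightarrow> f \<in> poly_functions n \<and> (\<forall>X \<in> carrier_mat n n. \<psi> X $$ (k, b) = f X)"
    using assms(2) ab unfolding poly_map_def by blast
  then obtain g where g: "\<And>k. k < n \<Longrightarrow> g k \<in> poly_functions n \<and>
      (\<forall>X \<in> carrier_mat n n. \<psi> X $$ (k, b) = g k X)" by metis
  show "\<exists>h \<in> poly_functions n. \<forall>X \<in> carrier_mat n n. (\<phi> X * \<psi> X) $$ (a, b) = h X"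
  proof (intro bexI ballI)
    show "(\<lambda>X. \<Sum>k\<in>{0..<n}. f k X * g k X) \<in> poly_functions n"
      using f g by (intro poly_functions_sum poly_functions.mult) auto
    fix X :: "complex mat" assume X: "X \<in> carrier_mat n n"
    have "\<phi> X \<in> carrier_mat n n" "\<psi> X \<in> carrier_mat n n" using X assms poly_map_carrier by auto
    then show "(\<phi> X * \<psi> X) $$ (a, b) = (\<Sum>k\<in>{0..<n}. f k X * g k X)"
      using ab f g X by (auto simp: scalar_prod_def intro!: sum.cong)
  qed
qed

lemma poly_map_add:
  assumes "poly_map n \<phi>" "poly_map n \<psi>"
  shows "poly_map n (\<lambda>X. \<phi> X + \<psi> X)"
  unfolding poly_map_def
proof (intro conjI ballI allI impI)
  fix X :: "complex mat" assume "X \<in> carrier_mat n n"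
  then show "\<phi> X + \<psi> X \<in> carrier_mat n n"
    using assms poly_map_carrier by (metis add_carrier_mat)
next
  fix a b assume ab: "a < n" "b < n"
  obtain f where f: "f \<in> poly_functions n" "\<forall>X \<in> carrier_mat n n. \<phi> X $$ (a, b) = f X"
    using assms(1) ab unfolding poly_map_def by blast
  obtain g where g: "g \<in> poly_functions n" "\<forall>X \<in> carrier_mat n n. \<psi> X $$ (a, b) = g X"
    using assms(2) ab unfolding poly_map_def by blast
  show "\<exists>h \<in> poly_functions n. \<forall>X \<in> carrier_mat n n. (\<phi> X + \<psi> X) $$ (a, b) = h X"
  proof (intro bexI ballI)
    show "(\<lambda>X. f X + g X) \<in> poly_functions n" using f g by (intro poly_functions.add)
    fix X :: "complex mat" assume X: "X \<in> carrier_mat n n"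
    have "\<phi> X \<in> carrier_mat n n" "\<psi> X \<in> carrier_mat n n" using X assms poly_map_carrier by auto
    then show "(\<phi> X + \<psi> X) $$ (a, b) = f X + g X" using ab f g X by auto
  qed
qed

lemma poly_map_pow: "poly_map n \<phi> \<Longrightarrow> poly_map n (\<lambda>X. \<phi> X ^\<^sub>m k)"
proof (induction k)
  case 0
  have "dim_row (\<phi> X) = n" if "X \<in> carrier_mat n n" for X
    using poly_map_carrier[OF 0 that] by auto
  moreover have "poly_map n (\<lambda>X. 1\<^sub>m n)" by (rule poly_map_const) simp
  ultimately show ?case unfolding poly_map_def by (auto simp: pow_mat.simps)
next
  case (Suc k)
  then show ?case using poly_map_mult[OF Suc.IH[OF Suc.prems] Suc.prems] by (simp add: pow_mat.simps)
qed

lemma poly_map_det: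
  assumes "poly_map n \<phi>"
  shows "\<exists>g \<in> poly_functions n. \<forall>X \<in> carrier_mat n n. det (\<phi> X) = g X"
proof -
  have "\<forall>a b. \<exists>f. a < n \<longrightarrow> b < n \<longrightarrow>
      f \<in> poly_functions n \<and> (\<forall>X \<in> carrier_mat n n. \<phi> X $$ (a, b) = f X)"
    using assms unfolding poly_map_def by blast
  then obtain f where f: "\<And>a b. a < n \<Longrightarrow> b < n \<Longrightarrow>
      f a b \<in> poly_functions n \<and> (\<forall>X \<in> carrier_mat n n. \<phi> X $$ (a, b) = f a b X)" by metis
  show ?thesis
  proof (intro bexI ballI)
    show "(\<lambda>X. \<Sum>p\<in>{p. p permutes {0..<n}}. signof p * (\<Prod>i\<in>{0..<n}. f i (p i) X)) \<in> poly_functions n"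
      using f by (intro poly_functions_sum poly_functions.mult poly_functions.const
          poly_functions_prod) (auto dest: permutes_in_image)
    fix X :: "complex mat" assume X: "X \<in> carrier_mat n n"
    have "\<phi> X \<in> carrier_mat n n" using X assms poly_map_carrier by auto
    then show "det (\<phi> X) = (\<Sum>p\<in>{p. p permutes {0..<n}}. signof p * (\<Prod>i\<in>{0..<n}. f i (p i) X))"
      using f X by (subst det_def') (auto intro!: sum.cong prod.cong dest: permutes_in_image)
  qed
qed

lemma zariski_closure_carrier: "zariski_closure n A \<subseteq> carrier_mat n n"
  by (auto simp: zariski_closure_def)

lemma zariski_closure_superset: "A \<subseteq> carrier_mat n n \<Longrightarrow> A \<subseteq> zariski_closure n A"
  by (auto simp: zariski_closure_def)

lemma zariski_closure_subset:
  "A \<subseteq> zariski_closure n B \<Longrightarrow> zariski_closure n A \<subseteq> zariski_closure n B"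
  by (auto simp: zariski_closure_def) blast

lemma zariski_closureD:
  "X \<in> zariski_closure n A \<Longrightarrow> f \<in> poly_functions n \<Longrightarrow> (\<And>Y. Y \<in> A \<Longrightarrow> f Y = 0) \<Longrightarrow> f X = 0"
  unfolding zariski_closure_def by blast

lemma zariski_closure_mono: "A \<subseteq> B \<Longrightarrow> zariski_closure n A \<subseteq> zariski_closure n B"
  by (auto simp: zariski_closure_def)

lemma zariski_closure_image:
  assumes "poly_map n \<phi>" "\<And>X. X \<in> A \<Longrightarrow> \<phi> X \<in> zariski_closure n B" "A \<subseteq> carrier_mat n n"
    "X \<in> zariski_closure n A"
  shows "\<phi> X \<in> zariski_closure n B"
proof -
  have X: "X \<in> carrier_mat n n" using assms(4) zariski_closure_carrier by auto
  show ?thesis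
    unfolding zariski_closure_def
  proof (intro CollectI conjI ballI impI)
    show "\<phi> X \<in> carrier_mat n n" using X assms(1) poly_map_carrier by auto
    fix f assume f: "f \<in> poly_functions n" "\<forall>Y \<in> B. f Y = 0"
    obtain g where g: "g \<in> poly_functions n" "\<forall>X \<in> carrier_mat n n. f (\<phi> X) = g X"
      using poly_map_compose[OF f(1) assms(1)] by blast
    have "g Y = 0" if "Y \<in> A" for Y
    proof -
      have "f (\<phi> Y) = 0" using assms(2)[OF that] f unfolding zariski_closure_def by blast
      with g(2) assms(3) that show ?thesis by auto
    qed
    then show "f (\<phi> X) = 0" using assms(4) g X unfolding zariski_closure_def by auto
  qed
qed

section \<open>Density along curves and lines\<close>

definition poly_curve :: "nat \<Rightarrow> (complex \<Rightarrow> complex mat) \<Rightarrow> bool" where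
  "poly_curve n M \<longleftrightarrow> (\<forall>c. M c \<in> carrier_mat n n) \<and>
     (\<forall>a < n. \<forall>b < n. \<exists>q. \<forall>c. M c $$ (a, b) = poly q c)"

lemma poly_curve_compose:
  assumes "f \<in> poly_functions n" "poly_curve n M"
  shows "\<exists>q. \<forall>c. f (M c) = poly q c"
  using assms(1)
proof induction
  case (const c)
  then show ?case by (intro exI[of _ "[:c:]"]) auto
next
  case (entry a b)
  with assms(2) show ?case by (auto simp: poly_curve_def)
next
  case (add f g)
  then show ?case by (metis poly_add)
next
  case (mult f g)
  then show ?case by (metis poly_mult)
qed

text \<open>An equation of the closed set, pulled back to the curve, is a polynomial in one variable
  with cofinitely many zeros. This stands in for irreducibility arguments.\<close>

lemma poly_curve_zariski_closure:
  assumes "poly_curve n M" "finite S" "\<And>c. c \<notin> S \<Longrightarrow> M c \<in> zariski_closure n A"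
  shows "M c \<in> zariski_closure n A"
  unfolding zariski_closure_def
proof (intro CollectI conjI ballI impI)
  show "M c \<in> carrier_mat n n" using assms(1) by (simp add: poly_curve_def)
  fix f assume f: "f \<in> poly_functions n" "\<forall>Y \<in> A. f Y = 0"
  obtain q where q: "\<And>c. f (M c) = poly q c" using poly_curve_compose[OF f(1) assms(1)] by blast
  have "q = 0"
  proof (rule ccontr)
    assume "q \<noteq> 0"
    then have "finite {c. poly q c = 0}" by (rule poly_roots_finite)
    moreover have "- S \<subseteq> {c. poly q c = 0}"
    proof
      fix c assume "c \<in> - S"
      then have "f (M c) = 0" using assms(3)[of c] f unfolding zariski_closure_def by blast
      then show "c \<in> {c. poly q c = 0}" by (simp add: q)
    qed
    ultimately have "finite (- S)" by (rule rev_finite_subset)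
    with assms(2) have "finite (UNIV :: complex set)"
      by (metis Compl_partition finite_Un)
    then show False using infinite_UNIV_char_0 by blast
  qed
  then show "f (M c) = 0" using q by simp
qed

text \<open>A linear space is irreducible: join a point to a point outside the hypersurface by a line.\<close>

definition closed_under_lines :: "complex mat set \<Rightarrow> bool" where
  "closed_under_lines L \<longleftrightarrow> (\<forall>X \<in> L. \<forall>Y \<in> L. \<forall>c. X + c \<cdot>\<^sub>m (Y - X) \<in> L)"

lemma generic_dense:
  assumes "L \<subseteq> carrier_mat n n" "closed_under_lines L" "p \<in> poly_functions n" "X0 \<in> L" "p X0 \<noteq> 0"
  shows "L \<subseteq> zariski_closure n {X \<in> L. p X \<noteq> 0}"
proof
  fix X assume X: "X \<in> L"
  let ?M = "\<lambda>c. X + c \<cdot>\<^sub>m (X0 - X)"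
  have car: "X \<in> carrier_mat n n" "X0 \<in> carrier_mat n n" using X assms by auto
  have curve: "poly_curve n ?M"
    unfolding poly_curve_def
  proof (intro conjI allI impI)
    show "?M c \<in> carrier_mat n n" for c using car by auto
    fix a b assume "a < n" "b < n"
    then have "\<forall>c. ?M c $$ (a, b) = poly [:X $$ (a, b), X0 $$ (a, b) - X $$ (a, b):] c"
      using car by auto
    then show "\<exists>q. \<forall>c. ?M c $$ (a, b) = poly q c" by blast
  qed
  obtain q where q: "\<And>c. p (?M c) = poly q c" using poly_curve_compose[OF assms(3) curve] by blast
  have "?M 1 = X0" using car by (intro eq_matI) auto
  then have "q \<noteq> 0" using q[of 1] assms(5) by auto
  then have "finite {c. poly q c = 0}" by (rule poly_roots_finite)
  moreover have "?M c \<in> zariski_closure n {X \<in> L. p X \<noteq> 0}" if "c \<notin> {c. poly q c = 0}" for c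
  proof -
    have "?M c \<in> L" using assms(2,4) X unfolding closed_under_lines_def by blast
    moreover have "p (?M c) \<noteq> 0" using that q by simp
    ultimately show ?thesis using zariski_closure_superset[of "{X \<in> L. p X \<noteq> 0}" n] assms(1) by blast
  qed
  ultimately have "?M 0 \<in> zariski_closure n {X \<in> L. p X \<noteq> 0}"
    using poly_curve_zariski_closure[OF curve] by blast
  moreover have "?M 0 = X" using car by (intro eq_matI) auto
  ultimately show "X \<in> zariski_closure n {X \<in> L. p X \<noteq> 0}" by simp
qed

section \<open>Borel sweeps\<close>

text \<open>For a permutation \<open>w\<close> the relevant \<open>p a\<close> is the position of the letter \<open>a + 1\<close>: matrix indices start
  from 0, letters from 1.\<close>

definition nspace :: "nat \<Rightarrow> (nat \<Rightarrow> nat) \<Rightarrow> complex mat set" where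
  "nspace n p = {X \<in> carrier_mat n n. \<forall>a < n. \<forall>b < n. X $$ (a, b) \<noteq> 0 \<longrightarrow> a < b \<and> p a < p b}"

lemma nspace_carrier: "nspace n p \<subseteq> carrier_mat n n"
  by (auto simp: nspace_def)

lemma nspace_carrierD: "X \<in> nspace n p \<Longrightarrow> X \<in> carrier_mat n n"
  using nspace_carrier by blast

lemma nspace_zero: "X \<in> nspace n p \<Longrightarrow> a < n \<Longrightarrow> b < n \<Longrightarrow> \<not> (a < b \<and> p a < p b) \<Longrightarrow> X $$ (a, b) = 0"
  by (auto simp: nspace_def)

lemma nspaceI:
  "X \<in> carrier_mat n n \<Longrightarrow>
    (\<And>a b. a < n \<Longrightarrow> b < n \<Longrightarrow> \<not> (a < b \<and> p a < p b) \<Longrightarrow> X $$ (a, b) = 0) \<Longrightarrow> X \<in> nspace n p"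
  unfolding nspace_def by blast

lemma nspace_closed_under_lines: "closed_under_lines (nspace n p)"
  unfolding closed_under_lines_def
proof (intro ballI allI)
  fix X Y c assume XY: "X \<in> nspace n p" "Y \<in> nspace n p"
  then have "X \<in> carrier_mat n n" "Y \<in> carrier_mat n n" using nspace_carrier by auto
  then show "X + c \<cdot>\<^sub>m (Y - X) \<in> nspace n p"
    using nspace_zero[OF XY(1)] nspace_zero[OF XY(2)] by (intro nspaceI) auto
qed

lemma nspace_0: "0\<^sub>m n n \<in> nspace n p"
  by (auto simp: nspace_def)

lemma nspace_smult: "X \<in> nspace n p \<Longrightarrow> c \<cdot>\<^sub>m X \<in> nspace n p"
  by (auto simp: nspace_def)

lemma nspace_entry_dense:
  assumes "a < b" "p a < p b" "b < n"
  shows "nspace n p \<subseteq> zariski_closure n {X \<in> nspace n p. X $$ (a, b) \<noteq> 0}"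
proof (rule generic_dense)
  show "mat n n (\<lambda>ij. if ij = (a, b) then 1 else 0) \<in> nspace n p"
    using assms by (auto simp: nspace_def)
qed (use assms nspace_carrier nspace_closed_under_lines in \<open>auto intro: poly_functions.entry\<close>)

lemma mult_carrier_mat_square [simp]:
  "A \<in> carrier_mat n n \<Longrightarrow> B \<in> carrier_mat n n \<Longrightarrow> A * B \<in> carrier_mat n n"
  by (rule mult_carrier_mat)

definition inverse_pair :: "nat \<Rightarrow> complex mat \<Rightarrow> complex mat \<Rightarrow> bool" where
  "inverse_pair n g h \<longleftrightarrow> g \<in> carrier_mat n n \<and> h \<in> carrier_mat n n \<and> g * h = 1\<^sub>m n \<and> h * g = 1\<^sub>m n"

text \<open>Carries a two-sided triangular inverse along with the group element, whereas
  \<open>conj_sweep\<close> records only a right inverse of unspecified shape.\<close>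

definition borel_pair :: "nat \<Rightarrow> complex mat \<Rightarrow> complex mat \<Rightarrow> bool" where
  "borel_pair n g h \<longleftrightarrow>
     inverse_pair n g h \<and> upper_triangular g \<and> upper_triangular h \<and> det g = 1 \<and> det h = 1"

text \<open>Take the lowest nonzero entry (i, j) of \<open>h\<close> below the diagonal in its
  column. In the entry (i, j) of \<open>g * h\<close>, which is 0, it is multiplied by a nonzero
  diagonal entry of \<open>g\<close>, and all other terms vanish.\<close>

lemma upper_triangular_inverse:
  assumes "inverse_pair n g h" "upper_triangular g"
  shows "upper_triangular h"
proof (rule ccontr)
  assume "\<not> upper_triangular h"
  then obtain i0 j where "j < i0" "i0 < n" "h $$ (i0, j) \<noteq> 0"
    using assms(1) by (auto simp: upper_triangular_def inverse_pair_def)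
  define i where "i = Max {i. i < n \<and> j < i \<and> h $$ (i, j) \<noteq> 0}"
  have fin: "finite {i. i < n \<and> j < i \<and> h $$ (i, j) \<noteq> 0}" by simp
  have "i \<in> {i. i < n \<and> j < i \<and> h $$ (i, j) \<noteq> 0}"
    unfolding i_def using \<open>j < i0\<close> \<open>i0 < n\<close> \<open>h $$ (i0, j) \<noteq> 0\<close> by (intro Max_in[OF fin]) auto
  then have i: "i < n" "j < i" "h $$ (i, j) \<noteq> 0" by auto
  have above: "h $$ (k, j) = 0" if "i < k" "k < n" for k
    using that i Max_ge[OF fin, of k] unfolding i_def[symmetric] by auto
  have car: "g \<in> carrier_mat n n" "h \<in> carrier_mat n n" using assms by (auto simp: inverse_pair_def)
  have "(g * h) $$ (i, j) = (\<Sum>k\<in>{0..<n}. g $$ (i, k) * h $$ (k, j))"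
    using car i by (auto simp: scalar_prod_def)
  also have "\<dots> = (\<Sum>k\<in>{i}. g $$ (i, k) * h $$ (k, j))"
  proof (rule sum.mono_neutral_right)
    show "\<forall>k \<in> {0..<n} - {i}. g $$ (i, k) * h $$ (k, j) = 0"
    proof
      fix k assume "k \<in> {0..<n} - {i}"
      then consider "k < i" | "i < k" "k < n" by force
      then show "g $$ (i, k) * h $$ (k, j) = 0"
        using assms(2) car i above by cases (auto simp: upper_triangular_def)
    qed
  qed (use i in auto)
  finally have "g $$ (i, i) * h $$ (i, j) = 0"
    using assms(1) i by (simp add: inverse_pair_def)
  moreover have "det g \<noteq> 0"
  proof
    assume "det g = 0"
    moreover have "det g * det h = det (g * h)" using car by (simp add: det_mult)
    ultimately show False using assms(1) by (simp add: inverse_pair_def)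
  qed
  then have "g $$ (i, i) \<noteq> 0"
    using upper_triangular_imp_det_eq_0_iff[OF car(1) assms(2)] i car by (auto simp: diag_mat_def)
  ultimately show False using i by simp
qed

lemma inverse_pair_sym: "inverse_pair n g h \<Longrightarrow> inverse_pair n h g"
  by (auto simp: inverse_pair_def)

lemma borel_pair_sym: "borel_pair n g h \<Longrightarrow> borel_pair n h g"
  by (auto simp: borel_pair_def inverse_pair_sym)

lemma det_inverse: "inverse_pair n g h \<Longrightarrow> det g = 1 \<Longrightarrow> det h = 1"
  unfolding inverse_pair_def by (metis det_mult det_one mult_1)

lemma borel_pairI:
  "inverse_pair n g h \<Longrightarrow> upper_triangular g \<Longrightarrow> det g = 1 \<Longrightarrow> borel_pair n g h"
  by (auto simp: borel_pair_def intro: upper_triangular_inverse det_inverse)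

lemma conj_compose:
  assumes "g \<in> carrier_mat n n" "g' \<in> carrier_mat n n" "X \<in> carrier_mat n n"
    "h' \<in> carrier_mat n n" "h \<in> carrier_mat n n"
  shows "g * (g' * X * h') * h = (g * g') * X * (h' * h)"
  using assms by (simp add: assoc_mult_mat[of _ n n _ n _ n])

lemma inverse_pair_mult:
  assumes "inverse_pair n g h" "inverse_pair n g' h'"
  shows "inverse_pair n (g * g') (h' * h)"
proof -
  have car: "g \<in> carrier_mat n n" "g' \<in> carrier_mat n n" "h' \<in> carrier_mat n n" "h \<in> carrier_mat n n"
    using assms by (auto simp: inverse_pair_def)
  have "(g * g') * (h' * h) = g * (g' * h') * h"
    using car by (simp add: assoc_mult_mat[of _ n n _ n _ n])
  moreover have "(h' * h) * (g * g') = h' * (h * g) * g'"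
    using car by (simp add: assoc_mult_mat[of _ n n _ n _ n])
  ultimately show ?thesis using assms car by (auto simp: inverse_pair_def)
qed

lemma upper_triangular_mult:
  assumes "g \<in> carrier_mat n n" "h \<in> carrier_mat n n" "upper_triangular g" "upper_triangular h"
  shows "upper_triangular (g * h :: complex mat)"
proof (rule upper_triangularI)
  fix i j assume ij: "j < i" "i < dim_row (g * h)"
  have "g $$ (i, k) * h $$ (k, j) = 0" if "k < n" for k
  proof (cases "k < i")
    case True
    then show ?thesis using ij assms by (auto simp: upper_triangular_def)
  next
    case False
    then show ?thesis using ij assms that by (auto simp: upper_triangular_def)
  qed
  then show "(g * h) $$ (i, j) = 0" using ij assms by (auto simp: scalar_prod_def intro!: sum.neutral)
qed

lemma borel_pair_mult:
  assumes "borel_pair n g h" "borel_pair n g' h'"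
  shows "borel_pair n (g * g') (h' * h)"
proof (rule borel_pairI)
  show "inverse_pair n (g * g') (h' * h)"
    using assms inverse_pair_mult by (auto simp: borel_pair_def)
  show "upper_triangular (g * g')" "det (g * g') = 1"
    using assms upper_triangular_mult[of g n g'] det_mult[of g n g']
    by (auto simp: borel_pair_def inverse_pair_def)
qed

lemma borel_sweep:
  "conj_sweep n (Borel n) A = {g * X * h | g X h. borel_pair n g h \<and> X \<in> A}"
proof -
  have "g \<in> Borel n \<and> h \<in> carrier_mat n n \<and> inverts_mat g h \<longleftrightarrow> borel_pair n g h" for g h
  proof
    assume l: "g \<in> Borel n \<and> h \<in> carrier_mat n n \<and> inverts_mat g h"
    then have g: "g \<in> carrier_mat n n" "g * h = 1\<^sub>m n" "det g = 1" "upper_triangular g"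
      by (auto simp: Borel_def SL_def inverts_mat_def)
    then have "inverse_pair n g h"
      using l mat_mult_left_right_inverse[of g n h] by (auto simp: inverse_pair_def)
    then show "borel_pair n g h" using g borel_pairI by blast
  qed (auto simp: borel_pair_def inverse_pair_def Borel_def SL_def inverts_mat_def)
  then show ?thesis unfolding conj_sweep_def by blast
qed

text \<open>For strictly triangular \<open>X\<close> the entry of a Borel conjugate at \<open>(i, j)\<close> depends only on
  the entries of \<open>X\<close> in the block between \<open>i\<close> and \<open>j\<close>.\<close>

lemma upper_conj_zero:
  assumes "borel_pair n g h" "X \<in> carrier_mat n n" "i < n" "j < n"
    and "\<And>r s. i \<le> r \<Longrightarrow> r < n \<Longrightarrow> s \<le> j \<Longrightarrow> X $$ (r, s) = 0"
  shows "(g * X * h) $$ (i, j) = 0"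
proof -
  have car: "g \<in> carrier_mat n n" "h \<in> carrier_mat n n" and up: "upper_triangular g" "upper_triangular h"
    using assms(1) by (auto simp: borel_pair_def inverse_pair_def)
  have gX: "(g * X) $$ (i, s) = 0" if "s \<le> j" "s < n" for s
  proof -
    have "g $$ (i, r) * X $$ (r, s) = 0" if "r < n" for r
      using that \<open>s \<le> j\<close> assms(3,5) car up by (cases "r < i") (auto simp: upper_triangular_def)
    then show ?thesis using that assms car by (auto simp: scalar_prod_def intro!: sum.neutral)
  qed
  have "(g * X) $$ (i, s) * h $$ (s, j) = 0" if "s < n" for s
    using that gX[of s] car up by (cases "s \<le> j") (auto simp: upper_triangular_def)
  then have "(\<Sum>s\<in>{0..<n}. (g * X) $$ (i, s) * h $$ (s, j)) = 0"
    by (intro sum.neutral) auto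
  moreover have "(Y * h) $$ (i, j) = (\<Sum>s\<in>{0..<n}. Y $$ (i, s) * h $$ (s, j))"
    if "Y \<in> carrier_mat n n" for Y
    using that assms(3,4) car by (auto simp: scalar_prod_def)
  from this[of "g * X"] have "(g * X * h) $$ (i, j) = (\<Sum>s\<in>{0..<n}. (g * X) $$ (i, s) * h $$ (s, j))"
    using car assms(2) mult_carrier_mat by blast
  ultimately show ?thesis by simp
qed

section \<open>The closed sets attached to position functions\<close>

definition Zv :: "nat \<Rightarrow> (nat \<Rightarrow> nat) \<Rightarrow> complex mat set" where
  "Zv n p = zariski_closure n (conj_sweep n (Borel n) (nspace n p))"

lemma borel_sweep_carrier: "A \<subseteq> carrier_mat n n \<Longrightarrow> conj_sweep n (Borel n) A \<subseteq> carrier_mat n n"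
  unfolding borel_sweep by (auto simp: borel_pair_def inverse_pair_def)

lemma Zv_carrier: "Zv n p \<subseteq> carrier_mat n n"
  unfolding Zv_def by (rule zariski_closure_carrier)

lemma borel_pair_one: "borel_pair n (1\<^sub>m n) (1\<^sub>m n)"
  by (auto simp: borel_pair_def inverse_pair_def)

lemma subset_borel_sweep:
  assumes "A \<subseteq> carrier_mat n n"
  shows "A \<subseteq> conj_sweep n (Borel n) A"
proof
  fix X assume "X \<in> A"
  then show "X \<in> conj_sweep n (Borel n) A"
    unfolding borel_sweep using assms borel_pair_one[of n]
    by (intro CollectI exI[of _ "1\<^sub>m n"] exI[of _ X]) auto
qed

lemma nspace_subset_Zv: "nspace n p \<subseteq> Zv n p"
  unfolding Zv_def using subset_borel_sweep[OF nspace_carrier] zariski_closure_superset[OF borel_sweep_carrier[OF nspace_carrier]]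
  by blast

lemma poly_map_conj:
  "g \<in> carrier_mat n n \<Longrightarrow> h \<in> carrier_mat n n \<Longrightarrow> poly_map n (\<lambda>X. g * X * h)"
  by (intro poly_map_mult poly_map_const poly_map_id)

lemma borel_sweep_closure_stable:
  assumes "borel_pair n g h" "A \<subseteq> carrier_mat n n"
    "X \<in> zariski_closure n (conj_sweep n (Borel n) A)"
  shows "g * X * h \<in> zariski_closure n (conj_sweep n (Borel n) A)"
proof (rule zariski_closure_image[OF _ _ borel_sweep_carrier[OF assms(2)] assms(3)])
  show "poly_map n (\<lambda>X. g * X * h)"
    using assms(1) by (intro poly_map_conj) (auto simp: borel_pair_def inverse_pair_def)
  fix Y assume "Y \<in> conj_sweep n (Borel n) A"
  then obtain g' X h' where Y: "Y = g' * X * h'" "borel_pair n g' h'" "X \<in> A"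
    unfolding borel_sweep by blast
  have "g * Y * h = (g * g') * X * (h' * h)"
    unfolding Y using assms Y by (intro conj_compose[of _ n]) (auto simp: borel_pair_def inverse_pair_def)
  then have "g * Y * h \<in> conj_sweep n (Borel n) A"
    unfolding borel_sweep using borel_pair_mult[OF assms(1) Y(2)] Y(3) by blast
  then show "g * Y * h \<in> zariski_closure n (conj_sweep n (Borel n) A)"
    using zariski_closure_superset[OF borel_sweep_carrier[OF assms(2)]] by blast
qed

lemma Zv_borel: "borel_pair n g h \<Longrightarrow> X \<in> Zv n p \<Longrightarrow> g * X * h \<in> Zv n p"
  unfolding Zv_def by (rule borel_sweep_closure_stable[OF _ nspace_carrier])

text \<open>Conjugation is continuous, so density may be tested before sweeping. Genericity
  assumptions on entries enter the later arguments through this lemma.\<close>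

lemma borel_sweep_dense:
  assumes "nspace n p \<subseteq> zariski_closure n D" "D \<subseteq> carrier_mat n n"
  shows "Zv n p \<subseteq> zariski_closure n (conj_sweep n (Borel n) D)"
  unfolding Zv_def
proof (rule zariski_closure_subset, rule subsetI)
  fix Y assume "Y \<in> conj_sweep n (Borel n) (nspace n p)"
  then obtain g X h where Y: "Y = g * X * h" "borel_pair n g h" "X \<in> nspace n p"
    unfolding borel_sweep by blast
  have "X \<in> zariski_closure n (conj_sweep n (Borel n) D)"
    using Y(3) assms zariski_closure_mono[OF subset_borel_sweep[OF assms(2)]] by blast
  then show "Y \<in> zariski_closure n (conj_sweep n (Borel n) D)"
    unfolding Y(1) by (rule borel_sweep_closure_stable[OF Y(2) assms(2)])
qed

lemma Zv_subsetI:
  assumes "nspace n p \<subseteq> zariski_closure n D" "D \<subseteq> Zv n q"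
  shows "Zv n p \<subseteq> Zv n q"
proof -
  have D: "D \<subseteq> carrier_mat n n" using assms(2) Zv_carrier by blast
  have "conj_sweep n (Borel n) D \<subseteq> Zv n q"
    unfolding borel_sweep using assms(2) Zv_borel by blast
  then have "zariski_closure n (conj_sweep n (Borel n) D) \<subseteq> Zv n q"
    unfolding Zv_def by (rule zariski_closure_subset)
  with borel_sweep_dense[OF assms(1) D] show ?thesis by blast
qed

lemma Zv_entry_zero:
  assumes "X \<in> Zv n p" "i < n" "j < n"
    and "\<And>r s. i \<le> r \<Longrightarrow> r < s \<Longrightarrow> s \<le> j \<Longrightarrow> \<not> p r < p s"
  shows "X $$ (i, j) = 0"
proof -
  have "Y $$ (i, j) = 0" if Y: "Y \<in> conj_sweep n (Borel n) (nspace n p)" for Y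
  proof -
    obtain g X h where gXh: "Y = g * X * h" "borel_pair n g h" "X \<in> nspace n p"
      using Y unfolding borel_sweep by blast
    show ?thesis
      unfolding gXh(1)
    proof (rule upper_conj_zero[OF gXh(2)])
      show "X $$ (r, s) = 0" if "i \<le> r" "r < n" "s \<le> j" for r s
        using that assms(3,4) by (intro nspace_zero[OF gXh(3)]) auto
    qed (use assms gXh nspace_carrier[of n p] in auto)
  qed
  moreover have "(\<lambda>X. X $$ (i, j)) \<in> poly_functions n" using assms by (intro poly_functions.entry)
  ultimately show ?thesis using assms(1) unfolding Zv_def zariski_closure_def by auto
qed

lemma Zv_strict: "X \<in> Zv n p \<Longrightarrow> i < n \<Longrightarrow> j \<le> i \<Longrightarrow> X $$ (i, j) = 0"
  by (rule Zv_entry_zero) auto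

text \<open>The block at a simple root holds a single entry above the diagonal, so no other entry
  can feed it under Borel conjugation. The closed set therefore determines the
  tau-invariant.\<close>

lemma Zv_simple_root:
  assumes "Suc j < n"
  shows "(\<forall>X \<in> Zv n p. X $$ (j, Suc j) = 0) \<longleftrightarrow> \<not> p j < p (Suc j)"
proof
  assume z: "\<forall>X \<in> Zv n p. X $$ (j, Suc j) = 0"
  show "\<not> p j < p (Suc j)"
  proof
    assume "p j < p (Suc j)"
    then have "mat n n (\<lambda>rs. if rs = (j, Suc j) then 1 else 0) \<in> nspace n p"
      using assms by (auto simp: nspace_def)
    then show False using z nspace_subset_Zv[of n p] assms by fastforce
  qed
next
  assume "\<not> p j < p (Suc j)"
  then show "\<forall>X \<in> Zv n p. X $$ (j, Suc j) = 0"
  proof (intro ballI)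
    fix X assume n: "\<not> p j < p (Suc j)" and X: "X \<in> Zv n p"
    show "X $$ (j, Suc j) = 0"
    proof (rule Zv_entry_zero[OF X])
      fix r s assume "j \<le> r" "r < s" "s \<le> Suc j"
      then have "r = j" "s = Suc j" by auto
      with n show "\<not> p r < p s" by simp
    qed (use assms in auto)
  qed
qed

lemma poly_map_smult: "poly_map n (\<lambda>X. c \<cdot>\<^sub>m X)"
  unfolding poly_map_def
proof (intro conjI ballI allI impI)
  fix a b assume "a < n" "b < n"
  then show "\<exists>f \<in> poly_functions n. \<forall>X \<in> carrier_mat n n. (c \<cdot>\<^sub>m X) $$ (a, b) = f X"
    by (intro bexI[of _ "\<lambda>X. c * X $$ (a, b)"]) (auto intro: poly_functions.intros)
qed auto

text \<open>The closed set is a cone; this allows a factor introduced to clear denominators to be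
  removed again.\<close>

lemma Zv_smult:
  assumes "X \<in> Zv n p"
  shows "c \<cdot>\<^sub>m X \<in> Zv n p"
  unfolding Zv_def
proof (rule zariski_closure_image[OF poly_map_smult _ borel_sweep_carrier[OF nspace_carrier]])
  show "X \<in> zariski_closure n (conj_sweep n (Borel n) (nspace n p))" using assms by (simp add: Zv_def)
  fix Y assume "Y \<in> conj_sweep n (Borel n) (nspace n p)"
  then obtain g X h where Y: "Y = g * X * h" "borel_pair n g h" "X \<in> nspace n p"
    unfolding borel_sweep by blast
  have "c \<cdot>\<^sub>m Y = g * (c \<cdot>\<^sub>m X) * h"
  proof -
    have car: "g \<in> carrier_mat n n" "h \<in> carrier_mat n n" "X \<in> carrier_mat n n"
      using Y(2,3) nspace_carrier[of n p] by (auto simp: borel_pair_def inverse_pair_def)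
    then have "g * X \<in> carrier_mat n n" by simp
    with car show ?thesis
      unfolding Y(1) by (simp only: mult_smult_distrib[of _ n n _ n] mult_smult_assoc_mat[of _ n n _ n])
  qed
  then have "c \<cdot>\<^sub>m Y \<in> conj_sweep n (Borel n) (nspace n p)"
    unfolding borel_sweep using Y(2) nspace_smult[OF Y(3)] by blast
  then show "c \<cdot>\<^sub>m Y \<in> zariski_closure n (conj_sweep n (Borel n) (nspace n p))"
    using zariski_closure_superset[OF borel_sweep_carrier[OF nspace_carrier]] by blast
qed

section \<open>Elementary conjugations\<close>

definition elem_conj :: "nat \<Rightarrow> nat \<Rightarrow> nat \<Rightarrow> complex \<Rightarrow> complex mat \<Rightarrow> complex mat" where
  "elem_conj n i j t X = addrow_mat n t i j * X * addrow_mat n (- t) i j"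

lemma addrow_inverse_pair:
  assumes "i \<noteq> j" "i < n" "j < n"
  shows "inverse_pair n (addrow_mat n t i j) (addrow_mat n (- t) i j)"
proof -
  have "addrow_mat n t i j * addrow_mat n (- t) i j = 1\<^sub>m n" for t :: complex
    unfolding addrow_mat[OF addrow_mat_carrier assms(3), symmetric]
    by (rule eq_matI) (use assms in auto)
  from this[of t] this[of "- t"] show ?thesis by (simp add: inverse_pair_def)
qed

lemma addrow_borel_pair:
  "i < j \<Longrightarrow> j < n \<Longrightarrow> borel_pair n (addrow_mat n t i j) (addrow_mat n (- t) i j)"
  by (intro borel_pairI addrow_inverse_pair upper_triangularI det_addrow_mat) auto

lemma elem_conj_carrier: "X \<in> carrier_mat n n \<Longrightarrow> elem_conj n i j t X \<in> carrier_mat n n"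
  by (simp add: elem_conj_def)

lemma elem_conj_index:
  assumes "X \<in> carrier_mat n n" "i \<noteq> j" "i < n" "j < n" "a < n" "b < n"
  shows "elem_conj n i j t X $$ (a, b) =
    X $$ (a, b) + (if a = i then t * X $$ (j, b) else 0) - (if b = j then t * X $$ (a, i) else 0)
    - (if a = i \<and> b = j then t * t * X $$ (j, i) else 0)"
proof -
  have "elem_conj n i j t X = addcol (- t) j i (addrow t i j X)"
    unfolding elem_conj_def using assms
    by (subst addcol_mat[of _ n n]) (auto simp: addrow_mat[of _ n n])
  then show ?thesis using assms by (auto simp: algebra_simps)
qed

lemma elem_conj_inverse:
  assumes "X \<in> carrier_mat n n" "i \<noteq> j" "i < n" "j < n"
  shows "elem_conj n i j (- t) (elem_conj n i j t X) = X"
proof -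
  have "elem_conj n i j (- t) (elem_conj n i j t X) =
      (addrow_mat n (- t) i j * addrow_mat n t i j) * X * (addrow_mat n (- t) i j * addrow_mat n t i j)"
    unfolding elem_conj_def using assms conj_compose[of "addrow_mat n (- t) i j" n "addrow_mat n t i j" X]
    by simp
  also have "\<dots> = X"
    using addrow_inverse_pair[OF assms(2-4)] assms(1) by (simp add: inverse_pair_def)
  finally show ?thesis .
qed

lemma Zv_elem_conj: "i < j \<Longrightarrow> j < n \<Longrightarrow> X \<in> Zv n p \<Longrightarrow> elem_conj n i j t X \<in> Zv n p"
  unfolding elem_conj_def by (intro Zv_borel addrow_borel_pair)

text \<open>Conjugation by a signed permutation matrix of determinant one lifting the transposition
  of \<open>j\<close> and \<open>j + 1\<close>.\<close>

definition refl_mat :: "nat \<Rightarrow> nat \<Rightarrow> complex \<Rightarrow> complex mat" where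
  "refl_mat n j t = addrow_mat n t j (Suc j) * addrow_mat n (- t) (Suc j) j * addrow_mat n t j (Suc j)"

definition refl_conj :: "nat \<Rightarrow> nat \<Rightarrow> complex mat \<Rightarrow> complex mat" where
  "refl_conj n j X = refl_mat n j 1 * X * refl_mat n j (- 1)"

definition refl_sign :: "nat \<Rightarrow> nat \<Rightarrow> complex" where
  "refl_sign j a = (if a = Suc j then - 1 else 1)"

lemma refl_mat_carrier [simp]: "refl_mat n j t \<in> carrier_mat n n"
  by (simp add: refl_mat_def)

lemma refl_mat_inverse_pair:
  assumes "Suc j < n"
  shows "inverse_pair n (refl_mat n j 1) (refl_mat n j (- 1))"
proof -
  have "inverse_pair n (addrow_mat n 1 j (Suc j) * addrow_mat n (- 1) (Suc j) j * addrow_mat n 1 j (Suc j))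
      (addrow_mat n (- 1) j (Suc j) * (addrow_mat n (- (- 1)) (Suc j) j * addrow_mat n (- 1) j (Suc j)))"
    using assms by (intro inverse_pair_mult addrow_inverse_pair) auto
  then show ?thesis by (simp add: refl_mat_def assoc_mult_mat[of _ n n _ n _ n])
qed

lemma refl_conj_elem_conj:
  assumes "X \<in> carrier_mat n n" "Suc j < n"
  shows "refl_conj n j X =
    elem_conj n j (Suc j) 1 (elem_conj n (Suc j) j (- 1) (elem_conj n j (Suc j) 1 X))"
  using assms unfolding refl_conj_def elem_conj_def refl_mat_def
  by (simp add: assoc_mult_mat[of _ n n _ n _ n])

lemma refl_conj_carrier: "X \<in> carrier_mat n n \<Longrightarrow> refl_conj n j X \<in> carrier_mat n n"
  by (simp add: refl_conj_def)

lemma refl_conj_index: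
  assumes "X \<in> carrier_mat n n" "Suc j < n" "a < n" "b < n"
  shows "refl_conj n j X $$ (a, b) =
    refl_sign j a * refl_sign j b * X $$ (transpose j (Suc j) a, transpose j (Suc j) b)"
proof -
  consider "a = j" | "a = Suc j" | "a \<noteq> j" "a \<noteq> Suc j" by blast
  then show ?thesis
    by cases (cases "b = j"; cases "b = Suc j";
      use assms in \<open>simp add: refl_conj_elem_conj elem_conj_index elem_conj_carrier refl_sign_def\<close>)+
qed

text \<open>The square of the lift is -1 on the block of \<open>j\<close> and \<open>Suc j\<close>,
  so the second iterate still changes signs. The fourth is the identity, and with it a reflection is
  undone by three more.\<close>

lemma refl_conj_4:
  assumes "X \<in> carrier_mat n n" "Suc j < n"
  shows "refl_conj n j (refl_conj n j (refl_conj n j (refl_conj n j X))) = X"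
proof (rule eq_matI)
  have car: "refl_conj n j (refl_conj n j (refl_conj n j (refl_conj n j X))) \<in> carrier_mat n n"
    by (intro refl_conj_carrier assms)
  then show "dim_row (refl_conj n j (refl_conj n j (refl_conj n j (refl_conj n j X)))) = dim_row X"
    "dim_col (refl_conj n j (refl_conj n j (refl_conj n j (refl_conj n j X)))) = dim_col X"
    using assms(1) by auto
  fix a b assume "a < dim_row X" "b < dim_col X"
  then have ab: "a < n" "b < n" using assms by auto
  have t: "transpose j (Suc j) c < n" if "c < n" for c
    using that assms(2) by (auto simp: transpose_def)
  have s: "refl_sign j (transpose j (Suc j) c) * refl_sign j c = (if c = j \<or> c = Suc j then - 1 else 1)" for c
    by (auto simp: refl_sign_def transpose_def)
  show "refl_conj n j (refl_conj n j (refl_conj n j (refl_conj n j X))) $$ (a, b) = X $$ (a, b)"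
    using assms ab t by (simp add: refl_conj_index refl_conj_carrier)
      (auto simp: refl_sign_def transpose_def)
qed

text \<open>A simple reflection permutes the positive roots other than its own; once the entry at
  (j, j + 1) is absent, strict triangularity survives.\<close>

lemma refl_conj_nspace:
  assumes "X \<in> nspace n p" "X $$ (j, Suc j) = 0" "Suc j < n"
  shows "refl_conj n j X \<in> nspace n (p \<circ> transpose j (Suc j))"
    and "refl_conj n j X $$ (j, Suc j) = 0"
proof -
  have X: "X \<in> carrier_mat n n" using assms(1) nspace_carrier by blast
  have t: "transpose j (Suc j) c < n" if "c < n" for c
    using that assms(3) by (auto simp: transpose_def)
  show "refl_conj n j X \<in> nspace n (p \<circ> transpose j (Suc j))"
  proof (rule nspaceI[OF refl_conj_carrier[OF X]])
    fix a b assume ab: "a < n" "b < n"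
      "\<not> (a < b \<and> (p \<circ> transpose j (Suc j)) a < (p \<circ> transpose j (Suc j)) b)"
    have "X $$ (transpose j (Suc j) a, transpose j (Suc j) b) = 0"
    proof (cases "transpose j (Suc j) a = j \<and> transpose j (Suc j) b = Suc j")
      case True
      with assms show ?thesis by simp
    next
      case False
      show ?thesis
      proof (rule nspace_zero[OF assms(1) t[OF ab(1)] t[OF ab(2)]], rule notI)
        assume l: "transpose j (Suc j) a < transpose j (Suc j) b \<and>
          p (transpose j (Suc j) a) < p (transpose j (Suc j) b)"
        then have "a < b" using False by (auto simp: transpose_def split: if_splits)
        with l ab(3) show False by simp
      qed
    qed
    then show "refl_conj n j X $$ (a, b) = 0" using X assms(3) ab by (simp add: refl_conj_index)
  qed
  show "refl_conj n j X $$ (j, Suc j) = 0"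
    using X assms nspace_zero[OF assms(1), of "Suc j" j] by (simp add: refl_conj_index)
qed

text \<open>The conjugation adds a multiple of row j to row j + 1 and of column j + 1 to column j.
  As \<open>p (Suc j) < p j\<close>, every place open in the source row or column is open in the
  target one.\<close>

lemma elem_conj_lower_nspace:
  assumes "X \<in> nspace n p" "p (Suc j) < p j" "Suc j < n"
  shows "elem_conj n (Suc j) j t X \<in> nspace n p"
proof (rule nspaceI)
  have X: "X \<in> carrier_mat n n" using assms(1) nspace_carrier by blast
  then show "elem_conj n (Suc j) j t X \<in> carrier_mat n n" by (rule elem_conj_carrier)
  fix a b assume ab: "a < n" "b < n" "\<not> (a < b \<and> p a < p b)"
  note z = nspace_zero[OF assms(1)]
  have up: "Suc j < b \<and> p (Suc j) < p b" if "j < b" "p j < p b"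
    using that assms(2) by (cases "b = Suc j") auto
  have left: "a < j \<and> p a < p j" if "a < Suc j" "p a < p (Suc j)"
    using that assms(2) by (cases "a = j") auto
  have "X $$ (a, b) = 0" using z ab by blast
  moreover have "X $$ (j, b) = 0" if "a = Suc j"
    using that ab assms(3) up by (intro z) auto
  moreover have "X $$ (a, Suc j) = 0" if "b = j"
    using that ab assms(3) left by (intro z) auto
  moreover have "X $$ (j, Suc j) = 0" "X $$ (j, j) = 0" "X $$ (Suc j, Suc j) = 0"
    using assms by (auto intro!: z)
  ultimately show "elem_conj n (Suc j) j t X $$ (a, b) = 0"
    using X ab assms(3) by (simp add: elem_conj_index)
qed

text \<open>Open cell of the Bruhat decomposition in rank one: the lower root element is moved past
  \<open>g\<close> at the price of a new parameter \<open>s\<close> and a new Borel element.\<close>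

lemma lower_conj_borel:
  assumes "borel_pair n g h" "Suc j < n" "g $$ (Suc j, Suc j) + t * g $$ (j, Suc j) \<noteq> 0"
  obtains s g' h' where "borel_pair n g' h'"
    "\<And>X. X \<in> carrier_mat n n \<Longrightarrow>
      elem_conj n (Suc j) j t (g * X * h) = g' * elem_conj n (Suc j) j s X * h'"
proof -
  have g: "g \<in> carrier_mat n n" "h \<in> carrier_mat n n" "inverse_pair n g h" "upper_triangular g" "det g = 1"
    using assms(1) by (auto simp: borel_pair_def inverse_pair_def)
  \<comment> \<open>The row operation creates one entry below the diagonal,
    \<open>t * g $$ (j, j)\<close> at (j + 1, j). This \<open>s\<close> makes subtraction of
    \<open>s\<close> times column j + 1 from column j cancel it.\<close>
  define s where "s = t * g $$ (j, j) / (g $$ (Suc j, Suc j) + t * g $$ (j, Suc j))"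
  have s: "t * g $$ (j, j) = s * (g $$ (Suc j, Suc j) + t * g $$ (j, Suc j))"
    using assms(3) by (simp add: s_def)
  define g' where "g' = addrow_mat n t (Suc j) j * g * addrow_mat n (- s) (Suc j) j"
  define h' where "h' = addrow_mat n s (Suc j) j * (h * addrow_mat n (- t) (Suc j) j)"
  have "inverse_pair n g' (addrow_mat n (- (- s)) (Suc j) j * (h * addrow_mat n (- t) (Suc j) j))"
    unfolding g'_def using assms(2) g(3)
    by (intro inverse_pair_mult addrow_inverse_pair) auto
  then have pair: "inverse_pair n g' h'" by (simp add: h'_def)
  have "det g' = 1"
    unfolding g'_def using g by (simp add: det_mult[of _ n] det_addrow_mat)
  moreover have "upper_triangular g'"
  proof (rule upper_triangularI)
    have eq: "g' = addcol (- s) j (Suc j) (addrow t (Suc j) j g)"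
      unfolding g'_def using assms(2) g by (subst addcol_mat[of _ n n]) (auto simp: addrow_mat[of _ n n])
    fix a b assume ab: "b < a" "a < dim_row g'"
    then have abn: "a < n" "b < n" using g by (auto simp: g'_def)
    have z: "g $$ (c, d) = 0" if "d < c" "c < n" for c d
      using that g by (auto simp: upper_triangular_def)
    show "g' $$ (a, b) = 0"
      unfolding eq using ab abn g assms(2) z[of b a] z[of "Suc j" a] z[of b j] s
      by (cases "b = j"; cases "a = Suc j") (auto simp: algebra_simps)
  qed
  ultimately have "borel_pair n g' h'" using borel_pairI[OF pair] by blast
  moreover have "elem_conj n (Suc j) j t (g * X * h) = g' * elem_conj n (Suc j) j s X * h'"
    if X: "X \<in> carrier_mat n n" for X
  proof -
    let ?P = "addrow_mat n t (Suc j) j * g" and ?Q = "h * addrow_mat n (- t) (Suc j) j"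
    let ?e = "addrow_mat n s (Suc j) j" and ?f = "addrow_mat n (- s) (Suc j) j"
    have fe: "?f * ?e = 1\<^sub>m n"
      using addrow_inverse_pair[of "Suc j" j n s] assms(2) by (simp add: inverse_pair_def)
    have "g' * elem_conj n (Suc j) j s X * h' = ?P * ?f * (?e * X * ?f) * (?e * ?Q)"
      by (simp add: g'_def h'_def elem_conj_def)
    also have "\<dots> = (?P * ?f * ?e) * X * (?f * (?e * ?Q))"
      using X g by (intro conj_compose[of _ n]) auto
    also have "?P * ?f * ?e = ?P * (?f * ?e)" using g by (intro assoc_mult_mat[of _ n n _ n _ n]) auto
    also have "?f * (?e * ?Q) = (?f * ?e) * ?Q"
      using g by (intro assoc_mult_mat[of _ n n _ n _ n, symmetric]) auto
    also have "?P * (?f * ?e) * X * ((?f * ?e) * ?Q) = ?P * X * ?Q"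
      unfolding fe using g by simp
    also have "?P * X * ?Q = elem_conj n (Suc j) j t (g * X * h)"
      unfolding elem_conj_def using g X by (intro conj_compose[of _ n, symmetric]) auto
    finally show ?thesis by simp
  qed
  ultimately show thesis by (rule that)
qed

text \<open>The complementary cell: the diagonal entry needed for the division is 0, so exchanging
  columns j and j + 1 by the inverse reflection already makes the product triangular.\<close>

lemma lower_conj_borel_refl:
  assumes "borel_pair n g h" "Suc j < n" "g $$ (Suc j, Suc j) + t * g $$ (j, Suc j) = 0"
  obtains g' h' where "borel_pair n g' h'"
    "\<And>X. X \<in> carrier_mat n n \<Longrightarrow> elem_conj n (Suc j) j t (g * X * h) = g' * refl_conj n j X * h'"
proof -
  have g: "g \<in> carrier_mat n n" "h \<in> carrier_mat n n" "inverse_pair n g h" "upper_triangular g" "det g = 1"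
    using assms(1) by (auto simp: borel_pair_def inverse_pair_def)
  let ?P = "addrow_mat n t (Suc j) j * g" and ?Q = "h * addrow_mat n (- t) (Suc j) j"
  let ?e = "refl_mat n j 1" and ?f = "refl_mat n j (- 1)"
  have ef: "inverse_pair n ?e ?f" by (rule refl_mat_inverse_pair[OF assms(2)])
  define g' where "g' = ?P * ?f"
  define h' where "h' = ?e * ?Q"
  have pair: "inverse_pair n g' h'"
    unfolding g'_def h'_def using assms(2) g(3) inverse_pair_sym[OF ef]
    by (intro inverse_pair_mult addrow_inverse_pair) auto
  have "det g' = 1"
    unfolding g'_def refl_mat_def using g by (simp add: det_mult[of _ n] det_addrow_mat)
  moreover have "upper_triangular g'"
  proof (rule upper_triangularI)
    let ?R = "addrow t (Suc j) j g"
    have R: "?R \<in> carrier_mat n n" using g by simp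
    have f: "?P * ?f = ?P * addrow_mat n (- 1) j (Suc j) * addrow_mat n 1 (Suc j) j * addrow_mat n (- 1) j (Suc j)"
      using g unfolding refl_mat_def by (simp add: assoc_mult_mat[of _ n n _ n _ n])
    have eq: "g' = addcol (- 1) (Suc j) j (addcol 1 j (Suc j) (addcol (- 1) (Suc j) j ?R))"
    proof -
      have col: "addcol a k l M \<in> carrier_mat n n" if "M \<in> carrier_mat n n" for a k l and M :: "complex mat"
        using that by (intro carrier_matI) auto
      have "?P = ?R" using addrow_mat[OF g(1), of j t "Suc j"] assms(2) by simp
      moreover have "?R * addrow_mat n (- 1) j (Suc j) = addcol (- 1) (Suc j) j ?R"
        using addcol_mat[OF R, of j "- 1" "Suc j"] assms(2) by simp
      moreover have "addcol (- 1) (Suc j) j ?R * addrow_mat n 1 (Suc j) j =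
          addcol 1 j (Suc j) (addcol (- 1) (Suc j) j ?R)"
        using addcol_mat[OF col[OF R], of "Suc j" 1 j] assms(2) by simp
      moreover have "addcol 1 j (Suc j) (addcol (- 1) (Suc j) j ?R) * addrow_mat n (- 1) j (Suc j) =
          addcol (- 1) (Suc j) j (addcol 1 j (Suc j) (addcol (- 1) (Suc j) j ?R))"
        using addcol_mat[OF col[OF col[OF R]], of j "- 1" "Suc j"] assms(2) by simp
      ultimately show ?thesis unfolding g'_def f by (simp only:)
    qed
    fix a b assume ab: "b < a" "a < dim_row g'"
    then have abn: "a < n" "b < n" using g by (auto simp: g'_def)
    have z: "g $$ (c, d) = 0" if "d < c" "c < n" for c d
      using that g by (auto simp: upper_triangular_def)
    show "g' $$ (a, b) = 0"
      unfolding eq using ab abn g assms(2,3) z[of b a] z[of "Suc j" a] z[of j a] z[of b j]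
      by (cases "b = j"; cases "b = Suc j"; cases "a = Suc j") (auto simp: algebra_simps)
  qed
  ultimately have "borel_pair n g' h'" using borel_pairI[OF pair] by blast
  moreover have "elem_conj n (Suc j) j t (g * X * h) = g' * refl_conj n j X * h'"
    if X: "X \<in> carrier_mat n n" for X
  proof -
    have fe: "?f * ?e = 1\<^sub>m n" using ef by (simp add: inverse_pair_def)
    have "g' * refl_conj n j X * h' = ?P * ?f * (?e * X * ?f) * (?e * ?Q)"
      by (simp add: g'_def h'_def refl_conj_def)
    also have "\<dots> = (?P * ?f * ?e) * X * (?f * (?e * ?Q))"
      using X g by (intro conj_compose[of _ n]) auto
    also have "?P * ?f * ?e = ?P * (?f * ?e)" using g by (intro assoc_mult_mat[of _ n n _ n _ n]) auto
    also have "?f * (?e * ?Q) = (?f * ?e) * ?Q"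
      using g by (intro assoc_mult_mat[of _ n n _ n _ n, symmetric]) auto
    also have "?P * (?f * ?e) * X * ((?f * ?e) * ?Q) = ?P * X * ?Q"
      unfolding fe using g by simp
    also have "?P * X * ?Q = elem_conj n (Suc j) j t (g * X * h)"
      unfolding elem_conj_def using g X by (intro conj_compose[of _ n, symmetric]) auto
    finally show ?thesis by simp
  qed
  ultimately show thesis by (rule that)
qed

text \<open>If \<open>p (j + 1) < p j\<close>, then \<open>Zv n p\<close> is stable under the parabolic generated by the Borel
  and the lower root subgroup: \<open>nspace n p\<close> is stable under that subgroup, and the product of the
  Borel with it is dense in the parabolic.\<close>

lemma Zv_elem_conj_lower:
  assumes "p (Suc j) < p j" "Suc j < n" "X \<in> Zv n p"
  shows "elem_conj n (Suc j) j t X \<in> Zv n p"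
  unfolding Zv_def
proof (rule zariski_closure_image[where \<phi> = "elem_conj n (Suc j) j t", OF _ _ borel_sweep_carrier[OF nspace_carrier]])
  show "poly_map n (elem_conj n (Suc j) j t)"
    unfolding elem_conj_def[abs_def] by (rule poly_map_conj) auto
  show "X \<in> zariski_closure n (conj_sweep n (Borel n) (nspace n p))" using assms by (simp add: Zv_def)
  fix Y assume "Y \<in> conj_sweep n (Borel n) (nspace n p)"
  then obtain g X h where Y: "Y = g * X * h" "borel_pair n g h" "X \<in> nspace n p"
    unfolding borel_sweep by blast
  have car: "X \<in> carrier_mat n n" "g \<in> carrier_mat n n" "h \<in> carrier_mat n n"
    using Y nspace_carrier by (auto simp: borel_pair_def inverse_pair_def)
  then have Yc: "Y \<in> carrier_mat n n" using Y(1) by auto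
  \<comment> \<open>The parameters outside the open cell. The constant term is a diagonal entry of
    \<open>g\<close>, hence nonzero, so there is at most one of them.\<close>
  let ?S = "{c. g $$ (Suc j, Suc j) + c * g $$ (j, Suc j) = 0}"
  have "g $$ (Suc j, Suc j) \<noteq> 0"
    using upper_triangular_imp_det_eq_0_iff[OF car(2)] Y(2) assms(2) car
    by (auto simp: borel_pair_def diag_mat_def)
  then have "?S \<subseteq> {- g $$ (Suc j, Suc j) / g $$ (j, Suc j)}"
    by (auto simp: add_eq_0_iff) (metis minus_divide_left mult_eq_0_iff neg_equal_0_iff_equal nonzero_eq_divide_eq)
  then have fin: "finite ?S" using finite_subset by blast
  have curve: "poly_curve n (\<lambda>c. elem_conj n (Suc j) j c Y)"
    unfolding poly_curve_def
  proof (intro conjI allI impI)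
    show "elem_conj n (Suc j) j c Y \<in> carrier_mat n n" for c using Yc by (rule elem_conj_carrier)
    fix a b assume ab: "a < n" "b < n"
    have "\<forall>c. elem_conj n (Suc j) j c Y $$ (a, b) = poly
        [:Y $$ (a, b),
          (if a = Suc j then Y $$ (j, b) else 0) - (if b = j then Y $$ (a, Suc j) else 0),
          - (if a = Suc j \<and> b = j then Y $$ (j, Suc j) else 0):] c"
      using elem_conj_index[OF Yc, of "Suc j" j a b] ab assms(2) by (auto simp: algebra_simps)
    then show "\<exists>q. \<forall>c. elem_conj n (Suc j) j c Y $$ (a, b) = poly q c" by blast
  qed
  show "elem_conj n (Suc j) j t Y \<in> zariski_closure n (conj_sweep n (Borel n) (nspace n p))"
  proof (rule poly_curve_zariski_closure[OF curve fin])
    fix c assume "c \<notin> ?S"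
    then have "g $$ (Suc j, Suc j) + c * g $$ (j, Suc j) \<noteq> 0" by simp
    then obtain s g' h' where "borel_pair n g' h'"
      "elem_conj n (Suc j) j c (g * X * h) = g' * elem_conj n (Suc j) j s X * h'"
      using lower_conj_borel[OF Y(2) assms(2)] car(1) by metis
    moreover have "elem_conj n (Suc j) j s X \<in> Zv n p"
      using elem_conj_lower_nspace[OF Y(3) assms(1,2)] nspace_subset_Zv by blast
    ultimately show "elem_conj n (Suc j) j c Y \<in> zariski_closure n (conj_sweep n (Borel n) (nspace n p))"
      unfolding Y(1) using Zv_borel[unfolded Zv_def] by (simp add: Zv_def)
  qed
qed

lemma Zv_refl_conj:
  assumes "p (Suc j) < p j" "Suc j < n" "X \<in> Zv n p"
  shows "refl_conj n j X \<in> Zv n p"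
proof -
  have "X \<in> carrier_mat n n" using assms(3) Zv_carrier by blast
  then show ?thesis
    using assms by (simp add: refl_conj_elem_conj Zv_elem_conj Zv_elem_conj_lower)
qed

lemma Zv_refl_conj_cancel:
  assumes "p (Suc j) < p j" "Suc j < n" "X \<in> carrier_mat n n" "refl_conj n j X \<in> Zv n p"
  shows "X \<in> Zv n p"
  using assms Zv_refl_conj[OF assms(1,2)] refl_conj_4[OF assms(3,2)] by metis

lemma Zv_refl_conj_nspace:
  assumes "p (Suc j) < p j" "Suc j < n" "X \<in> nspace n (p \<circ> transpose j (Suc j))" "X $$ (j, Suc j) = 0"
  shows "X \<in> Zv n p"
proof (rule Zv_refl_conj_cancel[OF assms(1,2)])
  show "X \<in> carrier_mat n n" using assms(3) nspace_carrier by blast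
  have "refl_conj n j X \<in> nspace n p"
    using refl_conj_nspace(1)[OF assms(3,4,2)] by (simp add: comp_assoc)
  then show "refl_conj n j X \<in> Zv n p" using nspace_subset_Zv by blast
qed

section \<open>Knuth moves and the operators on orbital varieties\<close>

text \<open>If a root subgroup preserves \<open>nspace n p\<close> and can generically clear the entry at
  \<open>(x, z)\<close>, then the hyperplane where that entry vanishes has the same Borel sweep closure.\<close>

lemma Zv_eq_hyperplane:
  assumes "nspace n p' \<subseteq> nspace n p"
    and hyper: "\<And>X. X \<in> nspace n p \<Longrightarrow> X $$ (x, z) = 0 \<Longrightarrow> X \<in> nspace n p'"
    and rs: "r < s" "s < n"
    and stable: "\<And>X t. X \<in> nspace n p \<Longrightarrow> elem_conj n r s t X \<in> nspace n p"
    and ab: "a < b" "p a < p b" "b < n"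
    and clear: "\<And>X. X \<in> nspace n p \<Longrightarrow> X $$ (a, b) \<noteq> 0 \<Longrightarrow> \<exists>t. elem_conj n r s t X $$ (x, z) = 0"
  shows "Zv n p = Zv n p'"
proof
  show "Zv n p' \<subseteq> Zv n p"
  proof (rule Zv_subsetI)
    show "nspace n p' \<subseteq> zariski_closure n (nspace n p')"
      by (rule zariski_closure_superset[OF nspace_carrier])
    show "nspace n p' \<subseteq> Zv n p" using assms(1) nspace_subset_Zv by blast
  qed
  show "Zv n p \<subseteq> Zv n p'"
  proof (rule Zv_subsetI[OF nspace_entry_dense[OF ab]], rule subsetI)
    fix X assume "X \<in> {X \<in> nspace n p. X $$ (a, b) \<noteq> 0}"
    then have X: "X \<in> nspace n p" "X $$ (a, b) \<noteq> 0" by auto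
    obtain t where t: "elem_conj n r s t X $$ (x, z) = 0" using clear[OF X] by blast
    have "elem_conj n r s t X \<in> Zv n p'"
      using hyper[OF stable[OF X(1)] t] nspace_subset_Zv by blast
    then have "elem_conj n r s (- t) (elem_conj n r s t X) \<in> Zv n p'"
      by (rule Zv_elem_conj[OF rs])
    moreover have "X \<in> carrier_mat n n" using X(1) nspace_carrier by blast
    ultimately show "X \<in> Zv n p'" using elem_conj_inverse[of X n r s t] rs by simp
  qed
qed

text \<open>The word reads x z y. Exchanging x and z closes just the place (x, z), whose entry can
  be cleared against the one at (x, y) by the root subgroup of (y, z). That subgroup preserves
  \<open>nspace n p\<close> because y and z are neighbours in the word.\<close>

lemma Zv_swap_witness_right:
  assumes inj: "inj_on p {..<n}" and xyz: "x < y" "y < z" "z < n"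
    and p: "p z = Suc (p x)" "p y = Suc (p z)"
    and p': "\<And>a. a < n \<Longrightarrow> p' a = (if a = x then p z else if a = z then p x else p a)"
  shows "Zv n p = Zv n p'"
proof (rule Zv_eq_hyperplane[where x = x and z = z and r = y and s = z and a = x and b = y])
  have ne: "p a = p b \<longleftrightarrow> a = b" if "a < n" "b < n" for a b
    using inj that by (auto dest: inj_onD)
  have less: "p a < p b" if "a < b" "b < n" "p' a < p' b" for a b
    using that p'[of a] p'[of b] p ne[of a z] ne[of b x] ne[of a x] ne[of b z] xyz
    by (auto split: if_splits)
  show "nspace n p' \<subseteq> nspace n p"
    using less unfolding nspace_def by auto
  show "X \<in> nspace n p'" if X: "X \<in> nspace n p" "X $$ (x, z) = 0" for X
  proof (rule nspaceI)
    fix a b assume ab: "a < n" "b < n" "\<not> (a < b \<and> p' a < p' b)"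
    show "X $$ (a, b) = 0"
    proof (cases "a = x \<and> b = z")
      case False
      have "p' a < p' b" if "a < b" "p a < p b"
        using that ab False p'[of a] p'[of b] p ne[of a z] ne[of b x] ne[of a x] ne[of b z] xyz
        by (auto split: if_splits)
      with ab X show ?thesis by (intro nspace_zero[OF X(1)]) auto
    qed (use X in auto)
  qed (use X nspace_carrier in auto)
  show "elem_conj n y z t X \<in> nspace n p" if X: "X \<in> nspace n p" for X t
  proof (rule nspaceI)
    have car: "X \<in> carrier_mat n n" using X nspace_carrier by blast
    then show "elem_conj n y z t X \<in> carrier_mat n n" by (rule elem_conj_carrier)
    fix a b assume ab: "a < n" "b < n" "\<not> (a < b \<and> p a < p b)"
    have "X $$ (z, b) = 0" if "a = y"
      using that ab p xyz ne[of b y] by (intro nspace_zero[OF X]) auto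
    moreover have "X $$ (a, y) = 0" if "b = z"
      using that ab p xyz ne[of a z] by (intro nspace_zero[OF X]) auto
    moreover have "X $$ (z, y) = 0" using xyz by (intro nspace_zero[OF X]) auto
    ultimately show "elem_conj n y z t X $$ (a, b) = 0"
      using nspace_zero[OF X ab] elem_conj_index[OF car, of y z a b t] xyz ab by auto
  qed
  show "\<exists>t. elem_conj n y z t X $$ (x, z) = 0" if X: "X \<in> nspace n p" "X $$ (x, y) \<noteq> 0" for X
  proof -
    have car: "X \<in> carrier_mat n n" using X nspace_carrier by blast
    show ?thesis
      using elem_conj_index[OF car, of y z x z "X $$ (x, z) / X $$ (x, y)"] xyz X(2)
      by (intro exI[of _ "X $$ (x, z) / X $$ (x, y)"]) auto
  qed
qed (use assms in auto)

text \<open>The word reads y x z. Now the entry at (x, z) is cleared against the one at (y, z) by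
  the root subgroup of (x, y), with y and x as neighbours.\<close>

lemma Zv_swap_witness_left:
  assumes inj: "inj_on p {..<n}" and xyz: "x < y" "y < z" "z < n"
    and p: "p x = Suc (p y)" "p z = Suc (p x)"
    and p': "\<And>a. a < n \<Longrightarrow> p' a = (if a = x then p z else if a = z then p x else p a)"
  shows "Zv n p = Zv n p'"
proof (rule Zv_eq_hyperplane[where x = x and z = z and r = x and s = y and a = y and b = z])
  have ne: "p a = p b \<longleftrightarrow> a = b" if "a < n" "b < n" for a b
    using inj that by (auto dest: inj_onD)
  have less: "p a < p b" if "a < b" "b < n" "p' a < p' b" for a b
    using that p'[of a] p'[of b] p ne[of a z] ne[of b x] ne[of a x] ne[of b z] xyz
    by (auto split: if_splits)
  show "nspace n p' \<subseteq> nspace n p"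
    using less unfolding nspace_def by auto
  show "X \<in> nspace n p'" if X: "X \<in> nspace n p" "X $$ (x, z) = 0" for X
  proof (rule nspaceI)
    fix a b assume ab: "a < n" "b < n" "\<not> (a < b \<and> p' a < p' b)"
    show "X $$ (a, b) = 0"
    proof (cases "a = x \<and> b = z")
      case False
      have "p' a < p' b" if "a < b" "p a < p b"
        using that ab False p'[of a] p'[of b] p ne[of a z] ne[of b x] ne[of a x] ne[of b z] xyz
        by (auto split: if_splits)
      with ab X show ?thesis by (intro nspace_zero[OF X(1)]) auto
    qed (use X in auto)
  qed (use X nspace_carrier in auto)
  show "elem_conj n x y t X \<in> nspace n p" if X: "X \<in> nspace n p" for X t
  proof (rule nspaceI)
    have car: "X \<in> carrier_mat n n" using X nspace_carrier by blast
    then show "elem_conj n x y t X \<in> carrier_mat n n" by (rule elem_conj_carrier)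
    fix a b assume ab: "a < n" "b < n" "\<not> (a < b \<and> p a < p b)"
    have "X $$ (y, b) = 0" if "a = x"
      using that ab p xyz ne[of b x] by (intro nspace_zero[OF X]) auto
    moreover have "X $$ (a, x) = 0" if "b = y"
      using that ab p xyz ne[of a y] by (intro nspace_zero[OF X]) auto
    moreover have "X $$ (y, x) = 0" using xyz by (intro nspace_zero[OF X]) auto
    ultimately show "elem_conj n x y t X $$ (a, b) = 0"
      using nspace_zero[OF X ab] elem_conj_index[OF car, of x y a b t] xyz ab by auto
  qed
  show "\<exists>t. elem_conj n x y t X $$ (x, z) = 0" if X: "X \<in> nspace n p" "X $$ (y, z) \<noteq> 0" for X
  proof -
    have car: "X \<in> carrier_mat n n" using X nspace_carrier by blast
    show ?thesis
      using elem_conj_index[OF car, of x y x z "- X $$ (x, z) / X $$ (y, z)"] xyz X(2)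
      by (intro exI[of _ "- X $$ (x, z) / X $$ (y, z)"]) auto
  qed
qed (use assms in auto)

text \<open>The rescaling by the square of the entry \<open>c\<close> at \<open>(i, i + 2)\<close> turns the rational map that
  clears the entry at the simple root \<open>a\<close> by the lower root subgroup of \<open>b\<close> into a polynomial one.
  Here \<open>m\<close> is, up to the sign depending on the side of \<open>a\<close>, the entry to be cleared.\<close>

definition clear_map :: "nat \<Rightarrow> nat \<Rightarrow> nat \<Rightarrow> nat \<Rightarrow> complex mat \<Rightarrow> complex mat" where
  "clear_map n i a b Y =
     (let c = Y $$ (i, i + 2); m = (if a = i then Y $$ (a, Suc a) else - Y $$ (a, Suc a))
      in mat n n (\<lambda>(r, s). c * c * Y $$ (r, s)
        + (if r = Suc b then c * m * Y $$ (b, s) else 0)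
        - (if s = b then c * m * Y $$ (r, Suc b) else 0)
        - (if r = Suc b \<and> s = b then m * m * Y $$ (b, Suc b) else 0)))"

lemma poly_functions_minus: "f \<in> poly_functions n \<Longrightarrow> (\<lambda>X. - f X) \<in> poly_functions n"
  using poly_functions.mult[OF poly_functions.const[of "- 1"]] by fastforce

lemma poly_functions_diff:
  "f \<in> poly_functions n \<Longrightarrow> g \<in> poly_functions n \<Longrightarrow> (\<lambda>X. f X - g X) \<in> poly_functions n"
  using poly_functions.add[OF _ poly_functions_minus] by fastforce

lemma poly_functions_if:
  "f \<in> poly_functions n \<Longrightarrow> g \<in> poly_functions n \<Longrightarrow> (\<lambda>X. if P then f X else g X) \<in> poly_functions n"
  by (cases P) auto

lemma poly_map_clear_map:
  assumes "i + 2 < n" "Suc a < n" "Suc b < n"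
  shows "poly_map n (clear_map n i a b)"
  unfolding poly_map_def
proof (intro conjI ballI allI impI)
  fix r s assume rs: "r < n" "s < n"
  show "\<exists>f \<in> poly_functions n. \<forall>X \<in> carrier_mat n n. clear_map n i a b X $$ (r, s) = f X"
  proof (intro bexI ballI)
    let ?m = "\<lambda>Y. if a = i then Y $$ (a, Suc a) else - Y $$ (a, Suc a)"
    show "(\<lambda>Y. Y $$ (i, i + 2) * Y $$ (i, i + 2) * Y $$ (r, s)
        + (if r = Suc b then Y $$ (i, i + 2) * ?m Y * Y $$ (b, s) else 0)
        - (if s = b then Y $$ (i, i + 2) * ?m Y * Y $$ (r, Suc b) else 0)
        - (if r = Suc b \<and> s = b then ?m Y * ?m Y * Y $$ (b, Suc b) else 0)) \<in> poly_functions n"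
      using assms rs
      by (intro poly_functions_diff poly_functions.add poly_functions_if poly_functions.mult
          poly_functions_minus poly_functions.entry poly_functions.const) auto
  qed (use rs in \<open>simp add: clear_map_def Let_def\<close>)
qed (simp add: clear_map_def Let_def)

lemma clear_map_elem_conj:
  assumes "Y \<in> carrier_mat n n" "Y $$ (i, i + 2) \<noteq> 0" "Suc b < n"
  shows "clear_map n i a b Y = (Y $$ (i, i + 2) * Y $$ (i, i + 2)) \<cdot>\<^sub>m
    elem_conj n (Suc b) b ((if a = i then Y $$ (a, Suc a) else - Y $$ (a, Suc a)) / Y $$ (i, i + 2)) Y"
    (is "_ = ?c2 \<cdot>\<^sub>m elem_conj n (Suc b) b ?t Y")
proof (rule eq_matI)
  let ?c = "Y $$ (i, i + 2)"
  let ?m = "if a = i then Y $$ (a, Suc a) else - Y $$ (a, Suc a)"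
  have car: "elem_conj n (Suc b) b ?t Y \<in> carrier_mat n n" using assms(1) by (rule elem_conj_carrier)
  then show "dim_row (clear_map n i a b Y) = dim_row (?c2 \<cdot>\<^sub>m elem_conj n (Suc b) b ?t Y)"
    "dim_col (clear_map n i a b Y) = dim_col (?c2 \<cdot>\<^sub>m elem_conj n (Suc b) b ?t Y)"
    by (auto simp: clear_map_def Let_def)
  fix r s
  assume "r < dim_row (?c2 \<cdot>\<^sub>m elem_conj n (Suc b) b ?t Y)" "s < dim_col (?c2 \<cdot>\<^sub>m elem_conj n (Suc b) b ?t Y)"
  then have rs: "r < n" "s < n" using car by auto
  define c m where cm: "c = ?c" "m = ?m"
  have t: "c * c * (m / c * u) = c * m * u" "c * c * (m / c * (m / c) * u) = m * m * u" for u
    using assms(2) cm by (auto simp: field_simps)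
  have "clear_map n i a b Y $$ (r, s) = c * c * Y $$ (r, s)
        + (if r = Suc b then c * m * Y $$ (b, s) else 0)
        - (if s = b then c * m * Y $$ (r, Suc b) else 0)
        - (if r = Suc b \<and> s = b then m * m * Y $$ (b, Suc b) else 0)"
    using rs by (simp add: clear_map_def Let_def cm)
  also have "\<dots> = c * c * (Y $$ (r, s) + (if r = Suc b then m / c * Y $$ (b, s) else 0)
      - (if s = b then m / c * Y $$ (r, Suc b) else 0)
      - (if r = Suc b \<and> s = b then m / c * (m / c) * Y $$ (b, Suc b) else 0))"
    by (simp only: right_diff_distrib distrib_left if_distrib[of "(*) (c * c)"] t mult_zero_right)
  also have "\<dots> = c * c * elem_conj n (Suc b) b (m / c) Y $$ (r, s)"
    using elem_conj_index[OF assms(1), of "Suc b" b r s] assms(3) rs by simp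
  finally show "clear_map n i a b Y $$ (r, s) = (?c2 \<cdot>\<^sub>m elem_conj n (Suc b) b ?t Y) $$ (r, s)"
    using rs car cm by simp
qed

text \<open>The operator on position functions, with \<open>a\<close> and \<open>b\<close> the indices from 0 of the two simple roots
  and \<open>i\<close> the smaller one.\<close>

definition op_pos :: "nat \<Rightarrow> nat \<Rightarrow> nat \<Rightarrow> (nat \<Rightarrow> nat) \<Rightarrow> (nat \<Rightarrow> nat)" where
  "op_pos i a b p =
     (if p i < p (i + 2) then p \<circ> transpose a (Suc a) else p \<circ> transpose b (Suc b))"

section \<open>The slice and the monotonicity of the operator\<close>

lemma clear_map_Zv:
  assumes n: "i + 2 < n" and ab: "a = i \<and> b = Suc i \<or> a = Suc i \<and> b = i"
    and pD: "p a < p (Suc a)" "p (Suc b) < p b" "p i \<noteq> p (i + 2)"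
    and Y: "Y \<in> Zv n p"
  shows "clear_map n i a b Y \<in> Zv n (op_pos i a b p)"
proof -
  let ?p' = "op_pos i a b p"
  have abn: "Suc a < n" "Suc b < n" using n ab by auto
  have p'a: "?p' (Suc a) < ?p' a"
    using ab pD by (auto simp: op_pos_def transpose_def)
  \<comment> \<open>On \<open>nspace n p\<close> the entry at (i, i + 2) can be nonzero only if
    \<open>p i < p (i + 2)\<close>; generic nonvanishing is demanded exactly then.\<close>
  define D where "D = {X \<in> nspace n p. p i < p (i + 2) \<longrightarrow> X $$ (i, i + 2) \<noteq> 0}"
  have Dsub: "D \<subseteq> nspace n p" by (auto simp: D_def)
  then have Dcar: "D \<subseteq> carrier_mat n n" using nspace_carrier by blast
  have dense: "nspace n p \<subseteq> zariski_closure n D"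
  proof (cases "p i < p (i + 2)")
    case True
    then have "D = {X \<in> nspace n p. X $$ (i, i + 2) \<noteq> 0}" by (auto simp: D_def)
    then show ?thesis using nspace_entry_dense[of i "i + 2" p n] True n by simp
  next
    case False
    then have "D = nspace n p" by (auto simp: D_def)
    then show ?thesis using zariski_closure_superset[OF nspace_carrier] by simp
  qed
  have "clear_map n i a b Y \<in> zariski_closure n (conj_sweep n (Borel n) (nspace n ?p'))"
  proof (rule zariski_closure_image[OF poly_map_clear_map[OF n abn] _ borel_sweep_carrier[OF Dcar]])
    show "Y \<in> zariski_closure n (conj_sweep n (Borel n) D)"
      using borel_sweep_dense[OF dense Dcar] Y by blast
    fix Y assume "Y \<in> conj_sweep n (Borel n) D"
    then obtain g X h where gXh: "Y = g * X * h" "borel_pair n g h" "X \<in> D"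
      unfolding borel_sweep by blast
    have X: "X \<in> nspace n p" "X \<in> carrier_mat n n" using gXh(3) Dsub Dcar by auto
    have YZ: "Y \<in> Zv n p" unfolding gXh(1) using X nspace_subset_Zv gXh(2) by (intro Zv_borel) auto
    have Yc: "Y \<in> carrier_mat n n" using YZ Zv_carrier by blast
    have "clear_map n i a b Y \<in> Zv n ?p'"
    proof (cases "Y $$ (i, i + 2) = 0")
      case True
      \<comment> \<open>Every term but the last carries a factor \<open>Y $$ (i, i + 2)\<close>; the
        last carries this entry, which vanishes because b is in the tau-invariant.\<close>
      have "Y $$ (b, Suc b) = 0" using YZ Zv_simple_root[OF abn(2), of p] pD(2) by auto
      then have "clear_map n i a b Y = 0\<^sub>m n n"
        using True by (intro eq_matI) (auto simp: clear_map_def Let_def)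
      then show ?thesis using subsetD[OF nspace_subset_Zv nspace_0] by simp
    next
      case False
      define t where "t = (if a = i then Y $$ (a, Suc a) else - Y $$ (a, Suc a)) / Y $$ (i, i + 2)"
      define R where "R = elem_conj n (Suc b) b t Y"
      have Ra: "R $$ (a, Suc a) = 0"
        unfolding R_def t_def using ab False Yc n
        by (auto simp: elem_conj_index numeral_2_eq_2)
      have Rc: "R $$ (i, i + 2) = Y $$ (i, i + 2)"
        unfolding R_def using ab Yc n by (auto simp: elem_conj_index)
      \<comment> \<open>On strictly triangular matrices Borel conjugation only rescales an entry at
        a simple root, so the zero of \<open>R\<close> there passes to every Borel conjugate
        \<open>V\<close>.\<close>
      have entry: "V $$ (a, Suc a) = 0"
        if "R = g' * V * h'" "borel_pair n g' h'" "V \<in> Zv n q" for V g' h' q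
      proof -
        have V: "V \<in> carrier_mat n n" using that(3) Zv_carrier by blast
        have RZ: "R \<in> Zv n q" unfolding that(1) using that(2,3) by (rule Zv_borel)
        have Rcar: "R \<in> carrier_mat n n" using RZ Zv_carrier by blast
        have "h' * R * g' = (h' * g') * V * (h' * g')"
          unfolding that(1) using that(2) V
          by (intro conj_compose[of _ n]) (auto simp: borel_pair_def inverse_pair_def)
        then have "V = h' * R * g'" using that(2) V by (auto simp: borel_pair_def inverse_pair_def)
        moreover have "(h' * R * g') $$ (a, Suc a) = 0"
        proof (rule upper_conj_zero[OF borel_pair_sym[OF that(2)] Rcar])
          fix r s assume rs: "a \<le> r" "r < n" "s \<le> Suc a"
          show "R $$ (r, s) = 0"
          proof (cases "s \<le> r")
            case True
            then show ?thesis using Zv_strict[OF RZ] rs by simp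
          next
            case False
            then have "r = a" "s = Suc a" using rs by auto
            then show ?thesis using Ra by simp
          qed
        qed (use abn in auto)
        ultimately show ?thesis by simp
      qed
      have "R \<in> Zv n ?p'"
      \<comment> \<open>The two Bruhat cells match the two branches of \<open>op_pos\<close>. In the
        open cell \<open>\<not> p i < p (i + 2)\<close> would empty the block of \<open>?V\<close>
        from i to i + 2, against \<open>Rc\<close>. In the other cell \<open>p i < p (i + 2)\<close>
        would leave \<open>refl_conj n b X\<close> with a nonzero entry at (a, a + 1), up to sign
        that of \<open>X\<close> at (i, i + 2).\<close>
      proof (cases "g $$ (Suc b, Suc b) + t * g $$ (b, Suc b) = 0")
        case D0: False
        obtain s g' h' where g': "borel_pair n g' h'" "R = g' * elem_conj n (Suc b) b s X * h'"
          using lower_conj_borel[OF gXh(2) abn(2) D0] X(2) unfolding R_def gXh(1) by metis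
        let ?V = "elem_conj n (Suc b) b s X"
        have V: "?V \<in> nspace n p" by (rule elem_conj_lower_nspace[OF X(1) pD(2) abn(2)])
        then have VZ: "?V \<in> Zv n p" using nspace_subset_Zv by blast
        have Va: "?V $$ (a, Suc a) = 0" using entry[OF g'(2,1) VZ] .
        have "p i < p (i + 2)"
        proof (rule ccontr)
          assume c: "\<not> p i < p (i + 2)"
          have "R $$ (i, i + 2) = 0"
            unfolding g'(2)
          proof (rule upper_conj_zero[OF g'(1)])
            fix r s' assume rs: "i \<le> r" "r < n" "s' \<le> i + 2"
            show "?V $$ (r, s') = 0"
            proof (cases "(r, s') = (a, Suc a)")
              case False
              then have "\<not> (r < s' \<and> p r < p s')"
              proof -
                have "r < s' \<Longrightarrow> r = i \<and> s' = i + 2 \<or> r = b \<and> s' = Suc b"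
                  using rs False ab by auto
                then show ?thesis using c pD(2) by auto
              qed
              then show ?thesis using rs n by (intro nspace_zero[OF V]) auto
            qed (use Va in auto)
          qed (use n V nspace_carrier in auto)
          then show False using Rc False by simp
        qed
        then have "?V \<in> nspace n (?p' \<circ> transpose a (Suc a))"
          using V by (simp add: op_pos_def comp_assoc)
        then have "?V \<in> Zv n ?p'" using Zv_refl_conj_nspace[of ?p' a] p'a abn(1) Va by blast
        then show ?thesis unfolding g'(2) by (intro Zv_borel[OF g'(1)])
      next
        case D0: True
        obtain g' h' where g': "borel_pair n g' h'" "R = g' * refl_conj n b X * h'"
          using lower_conj_borel_refl[OF gXh(2) abn(2) D0] X(2) unfolding R_def gXh(1) by metis
        have Xb: "X $$ (b, Suc b) = 0" using pD(2) abn by (intro nspace_zero[OF X(1)]) auto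
        have rX: "refl_conj n b X \<in> nspace n (p \<circ> transpose b (Suc b))"
          by (rule refl_conj_nspace(1)[OF X(1) Xb abn(2)])
        have "\<not> p i < p (i + 2)"
        proof
          assume "p i < p (i + 2)"
          then have "X $$ (i, i + 2) \<noteq> 0" using gXh(3) by (simp add: D_def)
          moreover have "refl_conj n b X $$ (a, Suc a) = 0"
            using entry[OF g'(2,1)] rX nspace_subset_Zv by blast
          ultimately show False
            using ab X(2) n by (auto simp: refl_conj_index refl_sign_def transpose_def numeral_2_eq_2 split: if_splits)
        qed
        then have "refl_conj n b X \<in> Zv n ?p'" using rX nspace_subset_Zv by (auto simp: op_pos_def)
        then show ?thesis unfolding g'(2) by (intro Zv_borel[OF g'(1)])
      qed
      then show ?thesis
        unfolding clear_map_elem_conj[OF Yc False abn(2)] R_def t_def by (rule Zv_smult)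
    qed
    then show "clear_map n i a b Y \<in> zariski_closure n (conj_sweep n (Borel n) (nspace n ?p'))"
      by (simp add: Zv_def)
  qed
  then show ?thesis by (simp add: Zv_def)
qed

text \<open>There is nothing left to clear in \<open>X\<close>, so \<open>clear_map\<close> merely
  multiplies it by a nonzero scalar, which the cone property removes.\<close>

lemma Zv_op_pos_section:
  assumes "i + 2 < n" "a = i \<and> b = Suc i \<or> a = Suc i \<and> b = i"
    and "p a < p (Suc a)" "p (Suc b) < p b" "p i \<noteq> p (i + 2)"
    and "X \<in> Zv n p" "X $$ (a, Suc a) = 0" "X $$ (i, i + 2) \<noteq> 0"
  shows "X \<in> Zv n (op_pos i a b p)"
proof -
  let ?c = "X $$ (i, i + 2)"
  have X: "X \<in> carrier_mat n n" using assms(6) Zv_carrier by blast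
  have "clear_map n i a b X = (?c * ?c) \<cdot>\<^sub>m X"
    using X assms(7) by (intro eq_matI) (auto simp: clear_map_def Let_def)
  then have "(?c * ?c) \<cdot>\<^sub>m X \<in> Zv n (op_pos i a b p)" using clear_map_Zv[OF assms(1-6)] by simp
  then have "(1 / (?c * ?c)) \<cdot>\<^sub>m ((?c * ?c) \<cdot>\<^sub>m X) \<in> Zv n (op_pos i a b p)" by (rule Zv_smult)
  moreover have "(1 / (?c * ?c)) \<cdot>\<^sub>m ((?c * ?c) \<cdot>\<^sub>m X) = X"
    using X assms(8) by (intro eq_matI) auto
  ultimately show ?thesis by simp
qed

text \<open>A generic element of the \<open>nspace\<close> of \<open>op_pos i a b q\<close> is
  brought into the slice of \<open>Zv n q\<close> by the parabolic of a: by the reflection if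
  \<open>q i < q (i + 2)\<close>, otherwise by the lower root subgroup. The slice lies in
  \<open>Zv n (op_pos i a b p)\<close>, which the same parabolic preserves, so the motion can be
  reversed there.\<close>

theorem Zv_op_pos_mono:
  assumes n: "i + 2 < n" and ab: "a = i \<and> b = Suc i \<or> a = Suc i \<and> b = i"
    and pD: "p a < p (Suc a)" "p (Suc b) < p b" "p i \<noteq> p (i + 2)"
    and qD: "q a < q (Suc a)" "q (Suc b) < q b" "q i \<noteq> q (i + 2)"
    and sub: "Zv n q \<subseteq> Zv n p"
  shows "Zv n (op_pos i a b q) \<subseteq> Zv n (op_pos i a b p)"
proof -
  let ?p' = "op_pos i a b p" and ?q' = "op_pos i a b q"
  have abn: "Suc a < n" "Suc b < n" using n ab by auto
  have p'a: "?p' (Suc a) < ?p' a" using ab pD by (auto simp: op_pos_def transpose_def)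
  have q'a: "?q' (Suc a) < ?q' a" using ab qD by (auto simp: op_pos_def transpose_def)
  have section_sub: "X \<in> Zv n ?p'" if "X \<in> Zv n q" "X $$ (a, Suc a) = 0" "X $$ (i, i + 2) \<noteq> 0" for X
    using Zv_op_pos_section[OF n ab pD _ that(2,3)] that(1) sub by blast
  show ?thesis
  proof (cases "q i < q (i + 2)")
    case True
    have q': "?q' = q \<circ> transpose a (Suc a)" using True by (simp add: op_pos_def)
    have "?q' b < ?q' (Suc b)" unfolding q' using ab True by (auto simp: transpose_def numeral_2_eq_2)
    then have dense: "nspace n ?q' \<subseteq> zariski_closure n {X \<in> nspace n ?q'. X $$ (b, Suc b) \<noteq> 0}"
      using abn by (intro nspace_entry_dense) auto
    show ?thesis
    proof (rule Zv_subsetI[OF dense], rule subsetI)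
      fix X assume "X \<in> {X \<in> nspace n ?q'. X $$ (b, Suc b) \<noteq> 0}"
      then have X: "X \<in> nspace n ?q'" "X $$ (b, Suc b) \<noteq> 0" by auto
      have Xc: "X \<in> carrier_mat n n" using X(1) nspace_carrier by blast
      have Xa: "X $$ (a, Suc a) = 0" using q'a abn by (intro nspace_zero[OF X(1)]) auto
      have "refl_conj n a X \<in> nspace n (?q' \<circ> transpose a (Suc a))"
        by (rule refl_conj_nspace(1)[OF X(1) Xa abn(1)])
      then have "refl_conj n a X \<in> Zv n q"
        using nspace_subset_Zv by (auto simp: q' comp_assoc)
      moreover have "refl_conj n a X $$ (a, Suc a) = 0"
        by (rule refl_conj_nspace(2)[OF X(1) Xa abn(1)])
      moreover have "refl_conj n a X $$ (i, i + 2) \<noteq> 0"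
        using ab Xc n X(2) by (auto simp: refl_conj_index refl_sign_def transpose_def numeral_2_eq_2)
      ultimately have "refl_conj n a X \<in> Zv n ?p'" by (rule section_sub)
      then show "X \<in> Zv n ?p'" using Zv_refl_conj_cancel[OF p'a abn(1) Xc] by blast
    qed
  next
    case False
    have q': "?q' = q \<circ> transpose b (Suc b)" using False by (simp add: op_pos_def)
    have "?q' i < ?q' (i + 2)" unfolding q' using ab qD by (auto simp: transpose_def numeral_2_eq_2)
    then have dense: "nspace n ?q' \<subseteq> zariski_closure n {X \<in> nspace n ?q'. X $$ (i, i + 2) \<noteq> 0}"
      using n by (intro nspace_entry_dense) auto
    show ?thesis
    proof (rule Zv_subsetI[OF dense], rule subsetI)
      fix X assume "X \<in> {X \<in> nspace n ?q'. X $$ (i, i + 2) \<noteq> 0}"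
      then have X: "X \<in> nspace n ?q'" "X $$ (i, i + 2) \<noteq> 0" by auto
      have Xc: "X \<in> carrier_mat n n" using X(1) nspace_carrier by blast
      \<comment> \<open>As in \<open>clear_map\<close> with the two roots exchanged: the lower root
        subgroup of a clears the entry at b against the one at (i, i + 2).\<close>
      define t where "t = (if b = i then X $$ (b, Suc b) else - X $$ (b, Suc b)) / X $$ (i, i + 2)"
      define V where "V = elem_conj n (Suc a) a t X"
      have V: "V \<in> nspace n ?q'" unfolding V_def by (rule elem_conj_lower_nspace[OF X(1) q'a abn(1)])
      have Vc: "V \<in> carrier_mat n n" using V nspace_carrier by blast
      have Vb: "V $$ (b, Suc b) = 0"
        unfolding V_def t_def using ab X(2) Xc n by (auto simp: elem_conj_index numeral_2_eq_2)
      have Vi: "V $$ (i, i + 2) = X $$ (i, i + 2)"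
        unfolding V_def using ab Xc n by (auto simp: elem_conj_index)
      have Va: "V $$ (a, Suc a) = 0" using q'a abn by (intro nspace_zero[OF V]) auto
      have "V \<in> Zv n q" using Zv_refl_conj_nspace[OF qD(2) abn(2) _ Vb] V by (simp add: q')
      then have "V \<in> Zv n ?p'" using section_sub[OF _ Va] Vi X(2) by simp
      then have "elem_conj n (Suc a) a (- t) V \<in> Zv n ?p'"
        by (rule Zv_elem_conj_lower[OF p'a abn(1)])
      then show "X \<in> Zv n ?p'" unfolding V_def using elem_conj_inverse[OF Xc] abn by simp
    qed
  qed
qed

section \<open>Nilpotent orbits\<close>

lemma jordan_matrix_append:
  "jordan_matrix (xs @ ys) = four_block_mat (jordan_matrix xs)
     (0\<^sub>m (sum_list (map fst xs)) (sum_list (map fst ys)))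
     (0\<^sub>m (sum_list (map fst ys)) (sum_list (map fst xs))) (jordan_matrix ys)"
proof -
  have "jordan_matrix (xs @ ys) = diag_block_mat [jordan_matrix xs, jordan_matrix ys]"
    using jordan_matrix_concat_diag_block_mat[of "[xs, ys]"] by (simp del: diag_block_mat.simps)
  then show ?thesis
    by (subst (asm) diag_block_mat.simps(2))
      (simp only: diag_block_mat_singleton Let_def jordan_matrix_dim)
qed

lemma similar_mat_block_swap:
  fixes A B :: "'a :: comm_ring_1 mat"
  assumes A: "A \<in> carrier_mat n n" and B: "B \<in> carrier_mat m m"
  shows "similar_mat (four_block_mat A (0\<^sub>m n m) (0\<^sub>m m n) B) (four_block_mat B (0\<^sub>m m n) (0\<^sub>m n m) A)"
proof (rule similar_matI[of _ _ "four_block_mat (0\<^sub>m n m) (1\<^sub>m n) (1\<^sub>m m) (0\<^sub>m m n)"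
      "four_block_mat (0\<^sub>m m n) (1\<^sub>m m) (1\<^sub>m n) (0\<^sub>m n m)" "n + m"])
  let ?P = "four_block_mat (0\<^sub>m n m) (1\<^sub>m n) (1\<^sub>m m) (0\<^sub>m m n) :: 'a mat"
  let ?Q = "four_block_mat (0\<^sub>m m n) (1\<^sub>m m) (1\<^sub>m n) (0\<^sub>m n m) :: 'a mat"
  let ?B = "four_block_mat B (0\<^sub>m m n) (0\<^sub>m n m) A"
  have one: "four_block_mat (1\<^sub>m k) (0\<^sub>m k l) (0\<^sub>m l k) (1\<^sub>m l) = (1\<^sub>m (k + l) :: 'a mat)" for k l
    by (intro eq_matI) auto
  show "?P * ?Q = 1\<^sub>m (n + m)"
    by (subst mult_four_block_mat[of _ n m _ n _ m _ _ n _ m]) (auto simp: one)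
  show "?Q * ?P = 1\<^sub>m (n + m)"
    by (subst mult_four_block_mat[of _ m n _ m _ n _ _ m _ n]) (auto simp: one add.commute)
  have "?P * ?B = four_block_mat (0\<^sub>m n m) A B (0\<^sub>m m n)"
    using A B by (subst mult_four_block_mat[of _ n m _ n _ m _ _ m _ n]) auto
  then show "four_block_mat A (0\<^sub>m n m) (0\<^sub>m m n) B = ?P * ?B * ?Q"
    using A B by (simp only:) (subst mult_four_block_mat[of _ n m _ n _ m _ _ n _ m], auto)
qed (use A B in auto)

text \<open>Counting Jordan blocks determines them up to order only, so reordering blocks has to be
  a similarity; a block swap brings the required block to the front.\<close>

lemma similar_jordan_matrix_mset:
  fixes as bs :: "(nat \<times> 'a :: comm_ring_1) list"
  assumes "mset as = mset bs"
  shows "similar_mat (jordan_matrix as) (jordan_matrix bs)"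
  using assms
proof (induction as arbitrary: bs)
  case Nil
  then show ?case by (auto intro!: similar_mat_refl[of _ 0] simp: jordan_matrix_def)
next
  case (Cons y as)
  then have "y \<in> set bs" using mset_eq_setD by fastforce
  then obtain xs ys where bs: "bs = xs @ y # ys" by (meson split_list)
  have mset: "mset as = mset (ys @ xs)" using Cons.prems bs by simp
  then have "similar_mat (jordan_matrix as) (jordan_matrix (ys @ xs))" by (rule Cons.IH)
  moreover have "sum_list (map fst as) = sum_list (map fst (ys @ xs))"
    using mset by (metis mset_map sum_mset_sum_list)
  ultimately have "similar_mat (jordan_matrix ([y] @ as)) (jordan_matrix ([y] @ (ys @ xs)))"
    unfolding jordan_matrix_append[of "[y]"]
    by (simp only:) (rule similar_mat_four_block_0_0[OF similar_mat_refl], auto intro!: carrier_matI)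
  moreover have "similar_mat (jordan_matrix ((y # ys) @ xs)) (jordan_matrix (xs @ (y # ys)))"
    unfolding jordan_matrix_append by (rule similar_mat_block_swap) auto
  ultimately show ?case using bs similar_mat_trans by fastforce
qed

text \<open>An eigenvector for \<open>e\<close> is scaled by \<open>e ^ k\<close> under the
  vanishing power, so every eigenvalue is 0.\<close>

lemma jordan_nf_nilpotent:
  fixes A :: "complex mat"
  assumes A: "A \<in> carrier_mat n n" and nil: "A ^\<^sub>m k = 0\<^sub>m n n"
  obtains as where "jordan_nf A as" "\<And>m e. (m, e) \<in> set as \<Longrightarrow> e = 0 \<and> m \<noteq> 0"
proof -
  obtain as where jnf: "jordan_nf A as"
    using char_poly_factorized[OF A] jordan_nf_exists[OF A] by blast
  have "e = 0 \<and> m \<noteq> 0" if me: "(m, e) \<in> set as" for m e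
  proof
    show m: "m \<noteq> 0" using jnf me unfolding jordan_nf_def by force
    have "poly (char_poly A) e = 0"
      unfolding jordan_nf_char_poly[OF jnf] poly_prod_list using me m
      by (auto simp: prod_list_zero_iff image_iff intro!: bexI[of _ "(m, e)"])
    then obtain v where ev: "eigenvector A v e"
      using eigenvalue_root_char_poly[OF A] unfolding eigenvalue_def by blast
    then have v: "v \<in> carrier_vec n" "v \<noteq> 0\<^sub>v n" using A by (auto simp: eigenvector_def)
    then obtain i where i: "i < n" "v $ i \<noteq> 0" by (metis carrier_vecD eq_vecI index_zero_vec)
    have "0\<^sub>m n n *\<^sub>v v = 0\<^sub>v n" using v(1) by (intro eq_vecI) auto
    then have "e ^ k \<cdot>\<^sub>v v = 0\<^sub>v n" using eigenvector_pow[OF A ev, of k] nil by simp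
    then have "(e ^ k \<cdot>\<^sub>v v) $ i = 0" using i by simp
    then show "e = 0" using i v by auto
  qed
  with jnf that show thesis by blast
qed

text \<open>The kernel dimensions of the powers determine the number of Jordan blocks of each size
  for the only eigenvalue 0.\<close>

lemma similar_mat_nilpotent:
  fixes A B :: "complex mat"
  assumes A: "A \<in> carrier_mat n n" "A ^\<^sub>m k = 0\<^sub>m n n"
    and B: "B \<in> carrier_mat n n" "B ^\<^sub>m l = 0\<^sub>m n n"
    and dims: "\<And>i. kernel_dim (A ^\<^sub>m i) = kernel_dim (B ^\<^sub>m i)"
  shows "similar_mat A B"
proof -
  obtain as where as: "jordan_nf A as" "\<And>m e. (m, e) \<in> set as \<Longrightarrow> e = 0 \<and> m \<noteq> 0"
    using jordan_nf_nilpotent[OF A] by blast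
  obtain bs where bs: "jordan_nf B bs" "\<And>m e. (m, e) \<in> set bs \<Longrightarrow> e = 0 \<and> m \<noteq> 0"
    using jordan_nf_nilpotent[OF B] by blast
  have char: "char_matrix A 0 = A" "char_matrix B 0 = B"
    using A B by (auto simp: char_matrix_def intro!: eq_matI)
  have "mset as = mset bs"
  proof (rule multiset_eqI)
    fix me :: "nat \<times> complex"
    obtain m e where me: "me = (m, e)" by force
    show "count (mset as) me = count (mset bs) me"
    proof (cases "m \<noteq> 0 \<and> e = 0")
      case True
      have "compute_nr_of_jordan_blocks A 0 m = compute_nr_of_jordan_blocks B 0 m"
        by (simp only: compute_nr_of_jordan_blocks_def dim_gen_eigenspace_def char dims)
      then show ?thesis
        using True compute_nr_of_jordan_blocks[OF as(1), of m 0] compute_nr_of_jordan_blocks[OF bs(1), of m 0]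
        by (simp add: me count_mset count_list_eq_length_filter)
    next
      case False
      then have "me \<notin> set as" "me \<notin> set bs" using as(2) bs(2) me by blast+
      then show ?thesis by (metis count_mset_0_iff)
    qed
  qed
  then have "similar_mat (jordan_matrix as) (jordan_matrix bs)" by (rule similar_jordan_matrix_mset)
  then show ?thesis
    using as(1) bs(1) unfolding jordan_nf_def by (meson similar_mat_sym similar_mat_trans)
qed

lemma kernel_basis_matrix:
  fixes A :: "'a :: field mat"
  assumes A: "A \<in> carrier_mat n n"
  obtains W :: "'a mat" where "W \<in> carrier_mat n (kernel_dim A)"
    "\<And>v. v \<in> carrier_vec (kernel_dim A) \<Longrightarrow> A *\<^sub>v (W *\<^sub>v v) = 0\<^sub>v n"
    "\<And>v. v \<in> carrier_vec (kernel_dim A) \<Longrightarrow> W *\<^sub>v v = 0\<^sub>v n \<Longrightarrow> v = 0\<^sub>v (kernel_dim A)"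
    "\<And>x. x \<in> carrier_vec n \<Longrightarrow> A *\<^sub>v x = 0\<^sub>v n \<Longrightarrow> \<exists>v \<in> carrier_vec (kernel_dim A). x = W *\<^sub>v v"
proof -
  interpret K: kernel n n A by (unfold_locales) (rule A)
  obtain B where B: "finite B" "K.basis B" using kernel_basis_exists[OF A] by blast
  have dim: "card B = kernel_dim A" using K.Ker.dim_basis[OF B] by simp
  have Bk: "B \<subseteq> mat_kernel A" and li: "\<not> K.lin_dep B" and gen: "K.span B = mat_kernel A"
    using B(2) unfolding K.Ker.basis_def by auto
  then have Bc: "B \<subseteq> carrier_vec n" using mat_kernel_carrier[OF A] by blast
  obtain bs where bs: "set bs = B" "distinct bs" using finite_distinct_list[OF B(1)] by blast
  define W where "W = mat_of_cols n bs"
  have len: "length bs = kernel_dim A" using bs dim distinct_card by metis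
  have W: "W \<in> carrier_mat n (kernel_dim A)" unfolding W_def using len by auto
  have cols: "cols W = bs" unfolding W_def using bs Bc by (intro cols_mat_of_cols) auto
  have dist: "distinct (cols W)" using cols bs by simp
  show thesis
  proof (rule that[OF W])
    fix v :: "'a vec" assume v: "v \<in> carrier_vec (kernel_dim A)"
    have "W *\<^sub>v v = K.NC.lincomb (\<lambda>a. v $ find_first a (cols W)) (set (cols W))"
      using K.NC.lincomb_eq_mat_mult[OF W v dist] by simp
    also have "\<dots> = K.lincomb (\<lambda>a. v $ find_first a (cols W)) B"
      using K.lincomb_same[OF Bk] cols bs by simp
    also have "\<dots> \<in> mat_kernel A" using Bk by (intro K.Ker.lincomb_closed) auto
    finally show "A *\<^sub>v (W *\<^sub>v v) = 0\<^sub>v n" using mat_kernelD[OF A] by blast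
    show "v = 0\<^sub>v (kernel_dim A)" if "W *\<^sub>v v = 0\<^sub>v n"
    proof (rule ccontr)
      assume "v \<noteq> 0\<^sub>v (kernel_dim A)"
      then have "K.NC.lin_dep (set (cols W))" using K.NC.lin_depI[OF W v _ that dist] by blast
      then show False using K.lindep_same[OF Bk] li cols bs by simp
    qed
  next
    fix x :: "'a vec" assume x: "x \<in> carrier_vec n" "A *\<^sub>v x = 0\<^sub>v n"
    then have "x \<in> K.span B" using gen mat_kernelI[OF A] by blast
    then obtain a where "x = K.lincomb a B" using K.Ker.finite_in_span[OF B(1)] Bk by auto
    then have "x = K.NC.lincomb a (set (cols W))" using K.lincomb_same[OF Bk] cols bs by simp
    then have "x = W *\<^sub>v vec (kernel_dim A) (\<lambda>i. a (col W i))"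
      using K.NC.mat_mult_eq_lincomb[OF W dist] by simp
    then show "\<exists>v \<in> carrier_vec (kernel_dim A). x = W *\<^sub>v v" by (intro bexI) auto
  qed
qed

section \<open>Semicontinuity of kernel dimensions\<close>

definition conj_transpose :: "complex mat \<Rightarrow> complex mat" where
  "conj_transpose A = mat (dim_col A) (dim_row A) (\<lambda>(i, j). cnj (A $$ (j, i)))"

lemma conj_transpose_carrier: "A \<in> carrier_mat n m \<Longrightarrow> conj_transpose A \<in> carrier_mat m n"
  by (auto simp: conj_transpose_def)

lemma conj_transpose_twice: "conj_transpose (conj_transpose A) = A"
  by (intro eq_matI) (auto simp: conj_transpose_def)

lemma conj_transpose_scalar_prod:
  assumes A: "A \<in> carrier_mat n m" and v: "v \<in> carrier_vec m" and x: "x \<in> carrier_vec n"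
  shows "(\<Sum>i<m. cnj (v $ i) * (conj_transpose A *\<^sub>v x) $ i) = (\<Sum>j<n. cnj ((A *\<^sub>v v) $ j) * x $ j)"
proof -
  have "(\<Sum>i<m. cnj (v $ i) * (conj_transpose A *\<^sub>v x) $ i) =
      (\<Sum>i<m. \<Sum>j<n. cnj (v $ i) * (cnj (A $$ (j, i)) * x $ j))"
    using A x by (intro sum.cong refl)
      (auto simp: conj_transpose_def scalar_prod_def sum_distrib_left atLeast0LessThan)
  also have "\<dots> = (\<Sum>j<n. \<Sum>i<m. cnj (v $ i) * (cnj (A $$ (j, i)) * x $ j))" by (rule sum.swap)
  also have "\<dots> = (\<Sum>j<n. cnj ((A *\<^sub>v v) $ j) * x $ j)"
    using A v by (intro sum.cong refl)
      (auto simp: scalar_prod_def sum_distrib_right atLeast0LessThan intro!: sum.cong)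
  finally show ?thesis .
qed

lemma vec_eq_zeroI: "x \<in> carrier_vec n \<Longrightarrow> \<forall>j<n. x $ j = 0 \<Longrightarrow> x = 0\<^sub>v n"
  by (intro eq_vecI) auto

lemma sum_cnj_mult:
  fixes x :: "nat \<Rightarrow> complex"
  shows "(\<Sum>j<n. cnj (x j) * x j) = of_real (\<Sum>j<n. (cmod (x j))\<^sup>2)"
  by (simp add: complex_norm_square mult.commute del: of_real_power)

lemma wide_matrix_kernel:
  fixes A :: "'a :: field mat"
  assumes A: "A \<in> carrier_mat m m'" and "m < m'"
  obtains v where "v \<in> carrier_vec m'" "v \<noteq> 0\<^sub>v m'" "A *\<^sub>v v = 0\<^sub>v m"
proof -
  \<comment> \<open>Padding with zero rows makes the matrix square and singular: the transpose kills
    the unit vector at \<open>m\<close>, the index of an added row.\<close>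
  define B where "B = mat m' m' (\<lambda>(i, j). if i < m then A $$ (i, j) else 0)"
  have B: "B \<in> carrier_mat m' m'" by (simp add: B_def)
  have "transpose_mat B *\<^sub>v unit_vec m' m = 0\<^sub>v m'"
    using assms by (intro eq_vecI) (auto simp: B_def)
  moreover have "unit_vec m' m \<noteq> (0\<^sub>v m' :: 'a vec)"
    using assms(2) by (metis index_unit_vec(1) index_zero_vec(1) zero_neq_one)
  ultimately have "det (transpose_mat B) = 0"
    using det_0_iff_vec_prod_zero_field[of "transpose_mat B" m'] B unit_vec_carrier[of m' m]
    by (metis transpose_carrier_mat)
  then have "det B = 0" using det_transpose[OF B] by simp
  then obtain v where v: "v \<in> carrier_vec m'" "v \<noteq> 0\<^sub>v m'" "B *\<^sub>v v = 0\<^sub>v m'"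
    using det_0_iff_vec_prod_zero_field[OF B] by blast
  have "A *\<^sub>v v = 0\<^sub>v m"
  proof (rule eq_vecI)
    fix i assume "i < dim_vec (0\<^sub>v m)"
    then have i: "i < m" by simp
    then have "row A i = row B i" using assms by (intro eq_vecI) (auto simp: B_def)
    then have "(A *\<^sub>v v) $ i = (B *\<^sub>v v) $ i" using i assms B by simp
    then show "(A *\<^sub>v v) $ i = 0\<^sub>v m $ i" using v i assms by simp
  qed (use A in auto)
  with v that show thesis by blast
qed

text \<open>Upper semicontinuity of the kernel dimension: with \<open>W\<close> a basis of the kernel of \<open>A0\<close>, the matrix
  \<open>A0* A0 + W W*\<close> is positive definite, and if \<open>A0* A + W W*\<close> is regular, then \<open>W*\<close> is injective on
  the kernel of \<open>A\<close>.\<close>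

lemma kernel_dim_semicontinuous:
  fixes A0 :: "complex mat"
  assumes A0: "A0 \<in> carrier_mat n n"
  obtains M N where "M \<in> carrier_mat n n" "N \<in> carrier_mat n n" "det (M * A0 + N) \<noteq> 0"
    "\<And>A. A \<in> carrier_mat n n \<Longrightarrow> det (M * A + N) \<noteq> 0 \<Longrightarrow> kernel_dim A \<le> kernel_dim A0"
proof -
  let ?m = "kernel_dim A0"
  obtain W where W: "W \<in> carrier_mat n ?m"
    and span: "\<And>x. x \<in> carrier_vec n \<Longrightarrow> A0 *\<^sub>v x = 0\<^sub>v n \<Longrightarrow> \<exists>v \<in> carrier_vec ?m. x = W *\<^sub>v v"
    using kernel_basis_matrix[OF A0] by metis
  let ?M = "conj_transpose A0" and ?V = "conj_transpose W"
  have V: "?V \<in> carrier_mat ?m n" using W by (rule conj_transpose_carrier)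
  have M: "?M \<in> carrier_mat n n" using A0 by (rule conj_transpose_carrier)
  have N: "W * ?V \<in> carrier_mat n n" using W V by simp
  have appl: "(?M * A + W * ?V) *\<^sub>v v = ?M *\<^sub>v (A *\<^sub>v v) + W *\<^sub>v (?V *\<^sub>v v)"
    if "A \<in> carrier_mat n n" "v \<in> carrier_vec n" for A v
    using that M W V by (simp add: add_mult_distrib_mat_vec[of _ n n] assoc_mult_mat_vec[of _ n n]
        assoc_mult_mat_vec[of W n ?m ?V n v])
  show thesis
  proof (rule that[OF M N])
    show "det (?M * A0 + W * ?V) \<noteq> 0"
    proof
      assume "det (?M * A0 + W * ?V) = 0"
      then obtain v where v: "v \<in> carrier_vec n" "v \<noteq> 0\<^sub>v n" "(?M * A0 + W * ?V) *\<^sub>v v = 0\<^sub>v n"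
        using det_0_iff_vec_prod_zero_field[of "?M * A0 + W * ?V" n] M A0 N by auto
      let ?x = "A0 *\<^sub>v v" and ?y = "?V *\<^sub>v v"
      have xy: "?x \<in> carrier_vec n" "?y \<in> carrier_vec ?m" using A0 V v by auto
      have zero: "?M *\<^sub>v ?x + W *\<^sub>v ?y = 0\<^sub>v n" using v(3) appl[OF A0 v(1)] by simp
      \<comment> \<open>Pairing \<open>zero\<close> with \<open>v\<close> makes the sum of the
        squared norms of \<open>?x\<close> and \<open>?y\<close> vanish, since \<open>?M\<close> and
        \<open>W\<close> are the adjoints of \<open>A0\<close> and \<open>?V\<close>.\<close>
      have "(\<Sum>j<n. cnj (?x $ j) * ?x $ j) + (\<Sum>j<?m. cnj (?y $ j) * ?y $ j) =
          (\<Sum>i<n. cnj (v $ i) * (?M *\<^sub>v ?x) $ i) + (\<Sum>i<n. cnj (v $ i) * (W *\<^sub>v ?y) $ i)"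
        using conj_transpose_scalar_prod[OF A0 v(1) xy(1)] conj_transpose_scalar_prod[OF V v(1) xy(2)]
        by (simp add: conj_transpose_twice)
      also have "\<dots> = (\<Sum>i<n. cnj (v $ i) * (?M *\<^sub>v ?x + W *\<^sub>v ?y) $ i)"
        unfolding sum.distrib[symmetric]
      proof (rule sum.cong[OF refl])
        fix i assume "i \<in> {..<n}"
        then have "(?M *\<^sub>v ?x + W *\<^sub>v ?y) $ i = (?M *\<^sub>v ?x) $ i + (W *\<^sub>v ?y) $ i"
          using W by (intro index_add_vec(1)) auto
        then show "cnj (v $ i) * (?M *\<^sub>v ?x) $ i + cnj (v $ i) * (W *\<^sub>v ?y) $ i =
            cnj (v $ i) * (?M *\<^sub>v ?x + W *\<^sub>v ?y) $ i" by (simp only: distrib_left)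
      qed
      also have "\<dots> = 0" unfolding zero by simp
      finally have "(\<Sum>j<n. (cmod (?x $ j))\<^sup>2) + (\<Sum>j<?m. (cmod (?y $ j))\<^sup>2) = 0"
        unfolding sum_cnj_mult by (metis of_real_add of_real_eq_0_iff)
      then have "(\<Sum>j<n. (cmod (?x $ j))\<^sup>2) = 0" "(\<Sum>j<?m. (cmod (?y $ j))\<^sup>2) = 0"
        using sum_nonneg[of "{..<n}" "\<lambda>j. (cmod (?x $ j))\<^sup>2"]
          sum_nonneg[of "{..<?m}" "\<lambda>j. (cmod (?y $ j))\<^sup>2"] by simp_all
      then have "\<forall>j<n. ?x $ j = 0" "\<forall>j<?m. ?y $ j = 0" by (simp_all add: sum_nonneg_eq_0_iff)
      then have x0: "?x = 0\<^sub>v n" and y0: "?y = 0\<^sub>v ?m"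
        using vec_eq_zeroI[OF xy(1)] vec_eq_zeroI[OF xy(2)] by blast+
      \<comment> \<open>Now \<open>v\<close> lies in the span of the columns of \<open>W\<close> and
        is orthogonal to all of them, so its norm is 0.\<close>
      obtain u where u: "u \<in> carrier_vec ?m" "v = W *\<^sub>v u" using span[OF v(1) x0] by blast
      have "(\<Sum>j<n. cnj (v $ j) * v $ j) = (\<Sum>i<?m. cnj (u $ i) * ?y $ i)"
        using conj_transpose_scalar_prod[OF W u(1) v(1)] u(2) by simp
      also have "\<dots> = 0" unfolding y0 by simp
      finally have "(\<Sum>j<n. (cmod (v $ j))\<^sup>2) = 0"
        unfolding sum_cnj_mult by (simp only: of_real_eq_0_iff)
      then have "\<forall>j<n. v $ j = 0" by (simp add: sum_nonneg_eq_0_iff)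
      then have "v = 0\<^sub>v n" using vec_eq_zeroI[OF v(1)] by blast
      with v(2) show False by simp
    qed
    fix A :: "complex mat" assume A: "A \<in> carrier_mat n n" and det: "det (?M * A + W * ?V) \<noteq> 0"
    show "kernel_dim A \<le> ?m"
    proof (rule ccontr)
      assume less: "\<not> kernel_dim A \<le> ?m"
      obtain U where U: "U \<in> carrier_mat n (kernel_dim A)"
        and ker: "\<And>v. v \<in> carrier_vec (kernel_dim A) \<Longrightarrow> A *\<^sub>v (U *\<^sub>v v) = 0\<^sub>v n"
        and inj: "\<And>v. v \<in> carrier_vec (kernel_dim A) \<Longrightarrow> U *\<^sub>v v = 0\<^sub>v n \<Longrightarrow> v = 0\<^sub>v (kernel_dim A)"
        using kernel_basis_matrix[OF A] by metis
      have VU: "?V * U \<in> carrier_mat ?m (kernel_dim A)" using V U by simp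
      \<comment> \<open>\<open>U\<close> has more columns than \<open>?V\<close> has rows, so
        \<open>?V\<close> kills some nonzero \<open>U *\<^sub>v v\<close>. This vector lies in the
        kernel of \<open>A\<close>, and both summands vanish on it.\<close>
      obtain v where v: "v \<in> carrier_vec (kernel_dim A)" "v \<noteq> 0\<^sub>v (kernel_dim A)" "(?V * U) *\<^sub>v v = 0\<^sub>v ?m"
        using wide_matrix_kernel[OF VU] less by auto
      have Uv: "U *\<^sub>v v \<in> carrier_vec n" "U *\<^sub>v v \<noteq> 0\<^sub>v n" using U v inj by auto
      have "?V *\<^sub>v (U *\<^sub>v v) = 0\<^sub>v ?m" using v assoc_mult_mat_vec[OF V U v(1)] by simp
      then have "(?M * A + W * ?V) *\<^sub>v (U *\<^sub>v v) = 0\<^sub>v n"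
        unfolding appl[OF A Uv(1)] ker[OF v(1)] using M W by (intro eq_vecI) auto
      then have "det (?M * A + W * ?V) = 0"
        using det_0_iff_vec_prod_zero_field[of "?M * A + W * ?V" n] M A N Uv by auto
      with det show False by simp
    qed
  qed
qed

lemma kernel_dim_pow_semicontinuous:
  assumes X0: "X0 \<in> carrier_mat n n"
  shows "\<exists>p \<in> poly_functions n. p X0 \<noteq> 0 \<and>
    (\<forall>X \<in> carrier_mat n n. p X \<noteq> 0 \<longrightarrow> kernel_dim (X ^\<^sub>m k) \<le> kernel_dim (X0 ^\<^sub>m k))"
proof -
  have pow: "X ^\<^sub>m k \<in> carrier_mat n n" if "X \<in> carrier_mat n n" for X :: "complex mat"
    using that by (rule pow_carrier_mat)
  obtain M N where MN: "M \<in> carrier_mat n n" "N \<in> carrier_mat n n" "det (M * X0 ^\<^sub>m k + N) \<noteq> 0"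
    "\<And>A. A \<in> carrier_mat n n \<Longrightarrow> det (M * A + N) \<noteq> 0 \<Longrightarrow> kernel_dim A \<le> kernel_dim (X0 ^\<^sub>m k)"
    using kernel_dim_semicontinuous[OF pow[OF X0]] by metis
  have "poly_map n (\<lambda>X. M * X ^\<^sub>m k + N)"
    by (intro poly_map_add poly_map_mult poly_map_const poly_map_pow poly_map_id MN)
  then obtain p where "p \<in> poly_functions n" "\<forall>X \<in> carrier_mat n n. det (M * X ^\<^sub>m k + N) = p X"
    using poly_map_det by blast
  with MN(3,4) X0 pow show ?thesis by (intro bexI[of _ p]) auto
qed

section \<open>Orbits under the special linear group and the generic orbit\<close>

lemma complex_root_exists:
  assumes "n > 0"
  obtains c :: complex where "c ^ n = z"
proof -
  have "rcis (root n (cmod z)) (Arg z / n) ^ n = z"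
    using assms by (simp add: DeMoivre2 rcis_cmod_Arg)
  with that show thesis by blast
qed

text \<open>Scaling an invertible matrix does not change conjugation by it, and an n-th root of the
  inverse determinant scales it into \<open>SL n\<close>.\<close>

lemma SL_orbit:
  assumes X: "X \<in> carrier_mat n n"
  shows "conj_sweep n (SL n) {X} = {Y. similar_mat Y X}"
proof (rule equalityI; rule subsetI)
  fix Y assume "Y \<in> conj_sweep n (SL n) {X}"
  then obtain g h where Y: "Y = g * X * h" "g \<in> SL n" "h \<in> carrier_mat n n" "inverts_mat g h"
    unfolding conj_sweep_def by blast
  then have g: "g \<in> carrier_mat n n" "g * h = 1\<^sub>m n" by (auto simp: SL_def inverts_mat_def)
  then have "h * g = 1\<^sub>m n" using Y(3) mat_mult_left_right_inverse by blast
  then show "Y \<in> {Y. similar_mat Y X}"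
    using Y g X by (auto intro!: similar_matI[of _ _ g h n])
next
  fix Y assume "Y \<in> {Y. similar_mat Y X}"
  then obtain m P Q where "{Y, X, P, Q} \<subseteq> carrier_mat m m" "P * Q = 1\<^sub>m m" "Q * P = 1\<^sub>m m" "Y = P * X * Q"
    by (auto dest!: similar_matD)
  moreover from this have "m = n" using X by auto
  ultimately have PQ: "P \<in> carrier_mat n n" "Q \<in> carrier_mat n n" "P * Q = 1\<^sub>m n" "Y = P * X * Q" by auto
  have "det P * det Q = 1" using PQ det_mult[of P n Q] by simp
  then have d: "det P \<noteq> 0" by auto
  obtain c where c: "c ^ n * det P = 1" "c \<noteq> 0"
  proof (cases "n = 0")
    case True
    then have "det P = 1" using PQ(1) by (simp add: det_dim_zero)
    then show thesis using that[of 1] by simp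
  next
    case False
    then obtain c where "c ^ n = 1 / det P" using complex_root_exists by blast
    then have "c ^ n * det P = 1" using d by simp
    moreover from this have "c \<noteq> 0" using False by (metis mult_zero_left power_eq_0_iff zero_neq_one zero_power neq0_conv)
    ultimately show thesis using that by blast
  qed
  let ?g = "c \<cdot>\<^sub>m P" and ?h = "(1 / c) \<cdot>\<^sub>m Q"
  have cancel: "(1 / c) \<cdot>\<^sub>m (c \<cdot>\<^sub>m M) = M" for M
    using c(2) by (intro eq_matI) auto
  have "?g * ?h = 1\<^sub>m n"
    using PQ c(2) by (simp add: mult_smult_distrib[of _ n n] mult_smult_assoc_mat[of _ n n] cancel)
  moreover have "?g * X * ?h = Y"
    using PQ c(2) X by (simp add: mult_smult_distrib[of _ n n] mult_smult_assoc_mat[of _ n n] cancel)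
  moreover have "?g \<in> SL n" using PQ c by (simp add: SL_def)
  ultimately show "Y \<in> conj_sweep n (SL n) {X}"
    unfolding conj_sweep_def using PQ by (intro CollectI exI[of _ ?g] exI[of _ X] exI[of _ ?h])
      (auto simp: inverts_mat_def)
qed

lemma kernel_dim_pow_similar:
  assumes "similar_mat X (Y :: complex mat)" "X \<in> carrier_mat n n"
  shows "kernel_dim (X ^\<^sub>m k) = kernel_dim (Y ^\<^sub>m k)"
proof -
  have Y: "Y \<in> carrier_mat n n" using similar_matD[OF assms(1)] assms(2) by auto
  have "char_matrix X 0 = X" "char_matrix Y 0 = Y"
    using assms Y by (auto simp: char_matrix_def intro!: eq_matI)
  then show ?thesis
    using fun_cong[OF fun_cong[OF dim_gen_eigenspace_similar[OF assms(1)], of 0], of k]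
    by (simp add: dim_gen_eigenspace_def)
qed

lemma nspace_pow_zero:
  assumes X: "X \<in> nspace n p"
  shows "X ^\<^sub>m n = 0\<^sub>m n n"
proof -
  have Xc: "X \<in> carrier_mat n n" using X nspace_carrier by blast
  have "(X ^\<^sub>m k) $$ (i, j) = 0" if "i < n" "j < n" "j < i + k" for i j k
    using that
  proof (induction k arbitrary: j)
    case (Suc k)
    have pow: "X ^\<^sub>m k \<in> carrier_mat n n" using Xc by (rule pow_carrier_mat)
    have "(X ^\<^sub>m k) $$ (i, l) * X $$ (l, j) = 0" if "l < n" for l
    proof (cases "l < i + k")
      case True
      then show ?thesis using Suc.IH[OF Suc.prems(1) that] by simp
    next
      case False
      then show ?thesis using nspace_zero[OF X that Suc.prems(2)] Suc.prems(3) by simp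
    qed
    then show ?case
      using pow Xc Suc.prems by (auto simp: scalar_prod_def intro!: sum.neutral)
  qed (use Xc in auto)
  then show ?thesis using Xc pow_carrier_mat[OF Xc, of n] by (intro eq_matI) auto
qed

text \<open>Irreducibility of \<open>L\<close>: finitely many nonempty relatively open subsets have
  a common point.\<close>

lemma poly_functions_generic_prod:
  assumes L: "L \<subseteq> carrier_mat n n" "closed_under_lines L" "L \<noteq> {}" and "finite K"
    and p: "\<And>k. k \<in> K \<Longrightarrow> p k \<in> poly_functions n \<and> (\<exists>X \<in> L. p k X \<noteq> 0)"
  shows "\<exists>X \<in> L. (\<Prod>k\<in>K. p k X) \<noteq> 0"
  using \<open>finite K\<close> p
proof (induction K rule: finite_induct)
  case empty
  with L(3) show ?case by auto
next
  case (insert k K)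
  then obtain X1 where X1: "X1 \<in> L" "(\<Prod>k\<in>K. p k X1) \<noteq> 0" by blast
  obtain X0 where X0: "X0 \<in> L" "p k X0 \<noteq> 0" using insert.prems by blast
  have pk: "p k \<in> poly_functions n" using insert.prems by blast
  have q: "(\<lambda>X. \<Prod>k\<in>K. p k X) \<in> poly_functions n"
    using insert.prems by (intro poly_functions_prod) auto
  show ?case
  proof (rule ccontr)
    assume "\<not> ?thesis"
    then have zero: "(\<Prod>k\<in>K. p k X) = 0" if "X \<in> {X \<in> L. p k X \<noteq> 0}" for X
      using insert.hyps that by auto
    have "X1 \<in> zariski_closure n {X \<in> L. p k X \<noteq> 0}"
      using generic_dense[OF L(1,2) pk X0] X1(1) by blast
    then have "(\<Prod>k\<in>K. p k X1) = 0" using q zero by (rule zariski_closureD)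
    with X1(2) show False by simp
  qed
qed

text \<open>The elements of \<open>nspace n p\<close> whose powers all have minimal kernel dimension form a dense
  subset, and they are all conjugate.\<close>

lemma nspace_generic_orbit:
  obtains X U where "X \<in> U" "U \<subseteq> nspace n p" "nspace n p \<subseteq> zariski_closure n U"
    "\<And>Y. Y \<in> U \<Longrightarrow> similar_mat Y X"
proof -
  let ?L = "nspace n p"
  \<comment> \<open>A minimizer is chosen for each exponent separately; that one matrix minimizes
    all of them follows only from the product \<open>Q\<close> below.\<close>
  have "\<exists>Y. Y \<in> ?L \<and> (\<forall>Z \<in> ?L. kernel_dim (Y ^\<^sub>m k) \<le> kernel_dim (Z ^\<^sub>m k))" for k
    using ex_has_least_nat[of "\<lambda>Y. Y \<in> ?L" _ "\<lambda>Y. kernel_dim (Y ^\<^sub>m k)"] nspace_0 by blast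
  then obtain Y where Y: "\<And>k. Y k \<in> ?L"
    "\<And>k Z. Z \<in> ?L \<Longrightarrow> kernel_dim (Y k ^\<^sub>m k) \<le> kernel_dim (Z ^\<^sub>m k)" by metis
  have "\<forall>k. \<exists>q. q \<in> poly_functions n \<and> q (Y k) \<noteq> 0 \<and>
      (\<forall>X \<in> carrier_mat n n. q X \<noteq> 0 \<longrightarrow> kernel_dim (X ^\<^sub>m k) \<le> kernel_dim (Y k ^\<^sub>m k))"
  proof
    fix k
    have "Y k \<in> carrier_mat n n" using Y(1)[of k] nspace_carrier by blast
    from kernel_dim_pow_semicontinuous[OF this, of k]
    show "\<exists>q. q \<in> poly_functions n \<and> q (Y k) \<noteq> 0 \<and>
      (\<forall>X \<in> carrier_mat n n. q X \<noteq> 0 \<longrightarrow> kernel_dim (X ^\<^sub>m k) \<le> kernel_dim (Y k ^\<^sub>m k))"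
      by (simp only: Bex_def)
  qed
  from choice[OF this] obtain q where qq: "\<forall>k. q k \<in> poly_functions n \<and> q k (Y k) \<noteq> 0 \<and>
      (\<forall>X \<in> carrier_mat n n. q k X \<noteq> 0 \<longrightarrow> kernel_dim (X ^\<^sub>m k) \<le> kernel_dim (Y k ^\<^sub>m k))" ..
  then have q: "\<And>k. q k \<in> poly_functions n" "\<And>k. q k (Y k) \<noteq> 0"
    "\<And>k X. X \<in> carrier_mat n n \<Longrightarrow> q k X \<noteq> 0 \<Longrightarrow> kernel_dim (X ^\<^sub>m k) \<le> kernel_dim (Y k ^\<^sub>m k)"
    by auto
  \<comment> \<open>Exponents above n add no condition because n-th powers are 0 here; a finite
    product therefore suffices.\<close>
  define Q where "Q X = (\<Prod>k\<in>{..n}. q k X)" for X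
  define U where "U = {X \<in> ?L. Q X \<noteq> 0}"
  have "\<exists>X \<in> ?L. Q X \<noteq> 0"
    unfolding Q_def
  proof (rule poly_functions_generic_prod[OF nspace_carrier nspace_closed_under_lines])
    show "?L \<noteq> {}" using nspace_0 by blast
    show "q k \<in> poly_functions n \<and> (\<exists>X \<in> ?L. q k X \<noteq> 0)" for k
      using q(1,2) Y(1) by auto
  qed simp
  then obtain X where X: "X \<in> ?L" "Q X \<noteq> 0" by blast
  have "Q \<in> poly_functions n" unfolding Q_def[abs_def] using q(1) by (intro poly_functions_prod)
  from generic_dense[where p = Q, OF nspace_carrier nspace_closed_under_lines this X]
  have dense: "?L \<subseteq> zariski_closure n U" unfolding U_def .
  have dim: "kernel_dim (Z ^\<^sub>m k) = kernel_dim (Y k ^\<^sub>m k)" if "Z \<in> U" "k \<le> n" for Z k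
  proof (rule antisym)
    have "q k Z \<noteq> 0" using that by (auto simp: U_def Q_def)
    then show "kernel_dim (Z ^\<^sub>m k) \<le> kernel_dim (Y k ^\<^sub>m k)"
      using q(3) that nspace_carrierD by (auto simp: U_def)
    show "kernel_dim (Y k ^\<^sub>m k) \<le> kernel_dim (Z ^\<^sub>m k)" using Y(2) that by (auto simp: U_def)
  qed
  have high: "Z ^\<^sub>m k = 0\<^sub>m n n" if "Z \<in> U" "n \<le> k" for Z k
  proof -
    have Z: "Z \<in> ?L" "Z \<in> carrier_mat n n" using that nspace_carrierD by (auto simp: U_def)
    from that(2) show ?thesis
      by (induction k rule: dec_induct) (use nspace_pow_zero[OF Z(1)] Z(2) in auto)
  qed
  have XU: "X \<in> U" using X by (simp add: U_def)
  show thesis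
  proof (rule that[OF XU _ dense])
    show "U \<subseteq> nspace n p" by (auto simp: U_def)
    fix Z assume Z: "Z \<in> U"
    have "Z \<in> nspace n p" "X \<in> nspace n p" using Z XU by (auto simp: U_def)
    moreover have "kernel_dim (Z ^\<^sub>m k) = kernel_dim (X ^\<^sub>m k)" for k
      using dim[OF Z, of k] dim[OF XU, of k] high[OF Z, of k] high[OF XU, of k] by (cases "k \<le> n") auto
    ultimately show "similar_mat Z X"
      using nspace_pow_zero nspace_carrierD by (intro similar_mat_nilpotent[of _ n n _ n]) auto
  qed
qed

text \<open>The open condition around \<open>X\<close> given by semicontinuity must meet the orbit
  of \<open>Y\<close>, on which kernel dimensions of powers are constant.\<close>

lemma orbit_closure_kernel_dim:
  assumes X: "X \<in> carrier_mat n n" and Y: "Y \<in> carrier_mat n n"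
    and sub: "X \<in> zariski_closure n (conj_sweep n (SL n) {Y})"
  shows "kernel_dim (Y ^\<^sub>m k) \<le> kernel_dim (X ^\<^sub>m k)"
proof -
  obtain q where q: "q \<in> poly_functions n" "q X \<noteq> 0"
    "\<And>Z. Z \<in> carrier_mat n n \<Longrightarrow> q Z \<noteq> 0 \<Longrightarrow> kernel_dim (Z ^\<^sub>m k) \<le> kernel_dim (X ^\<^sub>m k)"
    using kernel_dim_pow_semicontinuous[OF X, of k] by (auto simp only: Bex_def)
  obtain Z where Z: "Z \<in> conj_sweep n (SL n) {Y}" "q Z \<noteq> 0"
    using zariski_closureD[OF sub q(1)] q(2) by blast
  have sim: "similar_mat Z Y" using Z(1) SL_orbit[OF Y] by blast
  then have Zc: "Z \<in> carrier_mat n n" using similar_matD[OF sim] Y by auto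
  then show ?thesis using q(3)[OF Zc Z(2)] kernel_dim_pow_similar[OF sim Zc] by simp
qed

lemma orbit_subset_carrier:
  "X \<in> carrier_mat n n \<Longrightarrow> conj_sweep n (SL n) {X} \<subseteq> carrier_mat n n"
  unfolding conj_sweep_def SL_def by auto

text \<open>Each orbit meets the closure of the other, so the kernel dimensions agree in both
  directions. This makes the definite description in \<open>nil_orbit\<close> unambiguous.\<close>

lemma nilpotent_orbit_closure_inj:
  assumes Orb: "Orb \<in> nilpotent_orbits n" "Orb' \<in> nilpotent_orbits n"
    and cl: "zariski_closure n Orb = zariski_closure n Orb'"
  shows "Orb = Orb'"
proof -
  obtain X k where X: "Orb = conj_sweep n (SL n) {X}" "X \<in> carrier_mat n n" "X ^\<^sub>m k = 0\<^sub>m n n"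
    using Orb(1) by (auto simp: nilpotent_orbits_def)
  obtain Y l where Y: "Orb' = conj_sweep n (SL n) {Y}" "Y \<in> carrier_mat n n" "Y ^\<^sub>m l = 0\<^sub>m n n"
    using Orb(2) by (auto simp: nilpotent_orbits_def)
  have "X \<in> Orb" "Y \<in> Orb'"
    using X Y SL_orbit similar_mat_refl by auto
  then have "X \<in> zariski_closure n Orb'" "Y \<in> zariski_closure n Orb"
    using zariski_closure_superset[of Orb n] zariski_closure_superset[of Orb' n] cl X Y
      orbit_subset_carrier by blast+
  then have "kernel_dim (X ^\<^sub>m i) = kernel_dim (Y ^\<^sub>m i)" for i
    using orbit_closure_kernel_dim[OF X(2) Y(2), of i] orbit_closure_kernel_dim[OF Y(2) X(2), of i]
      X(1) Y(1) by (intro antisym) auto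
  then have "similar_mat X Y" by (rule similar_mat_nilpotent[OF X(2,3) Y(2,3)])
  then show ?thesis
    unfolding X(1) Y(1) SL_orbit[OF X(2)] SL_orbit[OF Y(2)]
    using similar_mat_trans similar_mat_sym by blast
qed

section \<open>The closure of an orbital variety\<close>

lemma nil_inter_nspace: "nil_inter n w = nspace n (\<lambda>a. inv_into UNIV w (Suc a))"
  by (simp add: nil_inter_def nspace_def)

text \<open>Intersecting with the orbit loses nothing up to closure: the Borel sweep of the generic
  part \<open>U\<close> lies in the orbit and is already dense in \<open>Zv n p\<close>.\<close>

theorem zariski_closure_orbital_variety:
  "zariski_closure n (orbital_variety n w) = Zv n (\<lambda>a. inv_into UNIV w (Suc a))"
proof -
  define p where "p = (\<lambda>a. inv_into UNIV w (Suc a))"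
  obtain X U where U: "X \<in> U" "U \<subseteq> nspace n p" "nspace n p \<subseteq> zariski_closure n U"
    "\<And>Y. Y \<in> U \<Longrightarrow> similar_mat Y X"
    using nspace_generic_orbit by metis
  have X: "X \<in> nspace n p" "X \<in> carrier_mat n n" using U nspace_carrierD by auto
  let ?O = "conj_sweep n (SL n) {X}"
  have Oc: "?O \<subseteq> carrier_mat n n" by (rule orbit_subset_carrier[OF X(2)])
  have orb: "?O \<in> nilpotent_orbits n"
    unfolding nilpotent_orbits_def using X nspace_pow_zero by blast
  have closure: "zariski_closure n ?O = zariski_closure n (conj_sweep n (SL n) (nspace n p))"
  proof
    show "zariski_closure n ?O \<subseteq> zariski_closure n (conj_sweep n (SL n) (nspace n p))"
      using X(1) by (intro zariski_closure_mono) (auto simp: conj_sweep_def)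
    show "zariski_closure n (conj_sweep n (SL n) (nspace n p)) \<subseteq> zariski_closure n ?O"
    proof (rule zariski_closure_subset, rule subsetI)
      fix Z assume "Z \<in> conj_sweep n (SL n) (nspace n p)"
      then obtain g Y h where Z: "Z = g * Y * h" "g \<in> SL n" "h \<in> carrier_mat n n"
        "inverts_mat g h" "Y \<in> nspace n p"
        unfolding conj_sweep_def by blast
      have g: "g \<in> carrier_mat n n" "g * h = 1\<^sub>m n" using Z by (auto simp: SL_def inverts_mat_def)
      then have hg: "h * g = 1\<^sub>m n" using Z(3) mat_mult_left_right_inverse by blast
      have "g * Y * h \<in> zariski_closure n ?O"
      proof (rule zariski_closure_image[OF poly_map_conj[OF g(1) Z(3)]])
        show "Y \<in> zariski_closure n U" using Z(5) U(3) by blast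
        show "U \<subseteq> carrier_mat n n" using U(2) nspace_carrier by blast
        fix V assume V: "V \<in> U"
        then have Vc: "V \<in> carrier_mat n n" using U(2) nspace_carrier by blast
        have "similar_mat (g * V * h) V"
          using g Z(3) hg Vc by (intro similar_matI[of _ _ g h n]) auto
        then have "g * V * h \<in> ?O"
          unfolding SL_orbit[OF X(2)] using U(4)[OF V] similar_mat_trans by blast
        then show "g * V * h \<in> zariski_closure n ?O" using zariski_closure_superset[OF Oc] by blast
      qed
      then show "Z \<in> zariski_closure n ?O" by (simp add: Z(1))
    qed
  qed
  have "nil_orbit n w = ?O"
    unfolding nil_orbit_def nil_inter_nspace p_def[symmetric]
  proof (rule the_equality)
    show "?O \<in> nilpotent_orbits n \<and>
        zariski_closure n ?O = zariski_closure n (conj_sweep n (SL n) (nspace n p))"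
      using orb closure by blast
    fix Orb assume "Orb \<in> nilpotent_orbits n \<and>
        zariski_closure n Orb = zariski_closure n (conj_sweep n (SL n) (nspace n p))"
    then show "Orb = ?O" using nilpotent_orbit_closure_inj orb closure by metis
  qed
  then have V: "orbital_variety n w = Zv n p \<inter> ?O"
    by (simp only: orbital_variety_def nil_inter_nspace Zv_def p_def)
  have "zariski_closure n (Zv n p \<inter> ?O) = Zv n p"
  proof
    show "zariski_closure n (Zv n p \<inter> ?O) \<subseteq> Zv n p"
      using zariski_closure_subset[of "Zv n p \<inter> ?O" n] unfolding Zv_def by blast
    have Uc: "U \<subseteq> carrier_mat n n" using U(2) nspace_carrier by blast
    have "conj_sweep n (Borel n) U \<subseteq> Zv n p \<inter> ?O"
    proof
      fix Z assume "Z \<in> conj_sweep n (Borel n) U"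
      then obtain g Y h where Z: "Z = g * Y * h" "borel_pair n g h" "Y \<in> U"
        unfolding borel_sweep by blast
      have "Z \<in> Zv n p" unfolding Z(1) using Z(2,3) U(2) nspace_subset_Zv by (intro Zv_borel) auto
      moreover have "similar_mat Z Y"
        unfolding Z(1) using Z(2,3) Uc
        by (intro similar_matI[of _ _ g h n]) (auto simp: borel_pair_def inverse_pair_def)
      then have "Z \<in> ?O" unfolding SL_orbit[OF X(2)] using U(4)[OF Z(3)] similar_mat_trans by blast
      ultimately show "Z \<in> Zv n p \<inter> ?O" by blast
    qed
    then show "Zv n p \<subseteq> zariski_closure n (Zv n p \<inter> ?O)"
      using borel_sweep_dense[OF U(3) Uc] zariski_closure_mono by blast
  qed
  then show ?thesis unfolding V p_def .
qed

section \<open>The geometric order\<close>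

definition Zword :: "nat \<Rightarrow> nat list \<Rightarrow> complex mat set" where
  "Zword n u = Zv n (\<lambda>a. pos u (Suc a))"

text \<open>Needed because the inverse of a permutation counts positions from 1 and
  \<open>pos\<close> counts them from 0.\<close>

lemma Zv_cong:
  assumes "\<And>a b. a < n \<Longrightarrow> b < n \<Longrightarrow> p a < p b \<longleftrightarrow> q a < q b"
  shows "Zv n p = Zv n q"
proof -
  have "nspace n p = nspace n q" unfolding nspace_def using assms by auto
  then show ?thesis by (simp add: Zv_def)
qed

lemma Zword_perm_word:
  assumes "w permutes {1..n}"
  shows "zariski_closure n (orbital_variety n w) = Zword n (perm_word n w)"
  unfolding zariski_closure_orbital_variety Zword_def
  by (rule Zv_cong) (simp add: inv_perm_word[OF assms])

lemma knuth_step_Zword: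
  assumes "knuth_step u v" "distinct u" "set u = {1..n}"
  shows "Zword n u = Zword n v"
proof -
  have inj: "inj_on (\<lambda>a. pos u (Suc a)) {..<n}"
    using pos_inj[of _ u] assms(3) by (intro inj_onI) auto
  \<comment> \<open>Letters start from 1 and matrix indices from 0, so letter x sits at index x -
    1.\<close>
  have minus: "Suc a = x \<longleftrightarrow> a = x - 1" if "x \<in> {1..n}" for a x using that by auto
  show ?thesis
    using assms(1)
  proof (cases rule: knuth_step.cases)
    case (xzy x y z l r)
    have mem: "x \<in> {1..n}" "y \<in> {1..n}" "z \<in> {1..n}" using assms(3) xzy by auto
    have dist: "distinct (l @ [x, z, y] @ r)" using assms(2) xzy by simp
    show ?thesis
      unfolding Zword_def
    proof (rule Zv_swap_witness_right[OF inj, of "x - 1" "y - 1" "z - 1"])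
      show "pos v (Suc a) = (if a = x - 1 then pos u (Suc (z - 1)) else
          if a = z - 1 then pos u (Suc (x - 1)) else pos u (Suc a))" for a
        using dist mem xzy(3,4) unfolding minus[OF mem(1), symmetric] minus[OF mem(3), symmetric] xzy(1,2)
        by (auto simp: pos_append pos_Cons)
    qed (use dist mem xzy(3,4) in \<open>auto simp: xzy(1) pos_append pos_Cons\<close>)
  next
    case (yxz x y z l r)
    have mem: "x \<in> {1..n}" "y \<in> {1..n}" "z \<in> {1..n}" using assms(3) yxz by auto
    have dist: "distinct (l @ [y, x, z] @ r)" using assms(2) yxz by simp
    show ?thesis
      unfolding Zword_def
    proof (rule Zv_swap_witness_left[OF inj, of "x - 1" "y - 1" "z - 1"])
      show "pos v (Suc a) = (if a = x - 1 then pos u (Suc (z - 1)) else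
          if a = z - 1 then pos u (Suc (x - 1)) else pos u (Suc a))" for a
        using dist mem yxz(3,4) unfolding minus[OF mem(1), symmetric] minus[OF mem(3), symmetric] yxz(1,2)
        by (auto simp: pos_append pos_Cons)
    qed (use dist mem yxz(3,4) in \<open>auto simp: yxz(1) pos_append pos_Cons\<close>)
  qed
qed

lemma knuth_equiv_Zword:
  "knuth_equiv u v \<Longrightarrow> distinct u \<Longrightarrow> set u = {1..n} \<Longrightarrow> Zword n u = Zword n v"
proof (induction rule: equivclp_induct)
  case (step v w)
  have mset: "mset v = mset u" using knuth_equiv_mset[OF step.hyps(1)] by simp
  moreover have "mset w = mset v" using step.hyps(2) knuth_step_mset by metis
  ultimately have "distinct v" "set v = {1..n}" "distinct w" "set w = {1..n}"
    using step.prems mset_eq_setD mset_eq_imp_distinct_iff by metis+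
  then have "Zword n v = Zword n w" using step.hyps(2) knuth_step_Zword by metis
  with step show ?case by simp
qed simp

text \<open>Renaming letters by a simple reflection composes the position function with the
  transposition of the shifted indices.\<close>

lemma Zword_word_op:
  assumes "adjacent_roots \<alpha> \<beta>" "\<alpha> \<ge> 1" "\<beta> \<ge> 1"
  shows "Zword n (word_op \<alpha> \<beta> u) =
    Zv n (op_pos (min \<alpha> \<beta> - 1) (\<alpha> - 1) (\<beta> - 1) (\<lambda>a. pos u (Suc a)))"
proof -
  have refl: "simple_refl \<gamma> (Suc a) = Suc (transpose (\<gamma> - 1) (Suc (\<gamma> - 1)) a)" if "\<gamma> \<ge> 1" for \<gamma> a
    using that by (auto simp: simple_refl_apply transpose_def)
  have map: "(\<lambda>a. pos (map (simple_refl \<gamma>) u) (Suc a)) =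
      (\<lambda>a. pos u (Suc a)) \<circ> transpose (\<gamma> - 1) (Suc (\<gamma> - 1))" if "\<gamma> \<ge> 1" for \<gamma>
    using that by (auto simp: pos_map_refl refl)
  have cond: "pos u (simple_refl \<alpha> \<beta>) < pos u (simple_refl \<alpha> (Suc \<beta>)) \<longleftrightarrow>
      pos u (Suc (min \<alpha> \<beta> - 1)) < pos u (Suc (min \<alpha> \<beta> - 1 + 2))"
    using assms by (auto simp: adjacent_roots_def simple_refl_apply numeral_2_eq_2)
  show ?thesis
    unfolding Zword_def word_op_def op_pos_def cond
    by (simp only: if_distrib[of "\<lambda>u a. pos u (Suc a)"] if_distribR map[OF assms(2)] map[OF assms(3)] split: if_split)
qed

lemma Zword_word_op_mono:
  assumes "adjacent_roots \<alpha> \<beta>" "\<alpha> \<in> simple_roots n" "\<beta> \<in> simple_roots n"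
    and u: "in_D \<alpha> \<beta> u" "set u = {1..n}" and v: "in_D \<alpha> \<beta> v" "set v = {1..n}"
    and sub: "Zword n v \<subseteq> Zword n u"
  shows "Zword n (word_op \<alpha> \<beta> v) \<subseteq> Zword n (word_op \<alpha> \<beta> u)"
proof -
  have ge: "\<alpha> \<ge> 1" "\<beta> \<ge> 1" using assms by (auto simp: simple_roots_def)
  let ?i = "min \<alpha> \<beta> - 1"
  have n: "?i + 2 < n" using assms(1-3) by (auto simp: simple_roots_def adjacent_roots_def)
  have ne: "pos x (Suc ?i) \<noteq> pos x (Suc (?i + 2))" if "set x = {1..n}" for x
    using pos_inj[of "Suc ?i" x "Suc (?i + 2)"] that n by auto
  show ?thesis
    unfolding Zword_word_op[OF assms(1) ge]
  proof (rule Zv_op_pos_mono[OF n])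
    show "\<alpha> - 1 = ?i \<and> \<beta> - 1 = Suc ?i \<or> \<alpha> - 1 = Suc ?i \<and> \<beta> - 1 = ?i"
      using assms(1) ge by (auto simp: adjacent_roots_def)
    show "Zv n (\<lambda>a. pos v (Suc a)) \<subseteq> Zv n (\<lambda>a. pos u (Suc a))" using sub by (simp add: Zword_def)
  qed (use u v ge ne in \<open>auto simp: in_D_def\<close>)
qed

lemma Zword_tau_mono:
  assumes "w permutes {1..n}" "y permutes {1..n}"
    and "Zword n (perm_word n y) \<subseteq> Zword n (perm_word n w)"
  shows "tau n w \<subseteq> tau n y"
proof
  fix \<alpha> assume "\<alpha> \<in> tau n w"
  then have \<alpha>: "\<alpha> \<in> simple_roots n" "pos (perm_word n w) (Suc \<alpha>) < pos (perm_word n w) \<alpha>"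
    using tau_perm_word[OF assms(1)] by auto
  then have j: "Suc (\<alpha> - 1) = \<alpha>" "Suc (\<alpha> - 1) < n" by (auto simp: simple_roots_def)
  have "\<forall>X \<in> Zword n (perm_word n w). X $$ (\<alpha> - 1, Suc (\<alpha> - 1)) = 0"
    unfolding Zword_def Zv_simple_root[OF j(2)] using \<alpha>(2) j(1) by simp
  then have "\<forall>X \<in> Zword n (perm_word n y). X $$ (\<alpha> - 1, Suc (\<alpha> - 1)) = 0" using assms(3) by blast
  then have "\<not> pos (perm_word n y) \<alpha> < pos (perm_word n y) (Suc \<alpha>)"
    unfolding Zword_def Zv_simple_root[OF j(2)] using j(1) by simp
  moreover have "pos (perm_word n y) \<alpha> \<noteq> pos (perm_word n y) (Suc \<alpha>)"
    using pos_inj[of \<alpha> "perm_word n y" "Suc \<alpha>"] \<alpha>(1) perm_word_set[OF assms(2)]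
    by (auto simp: simple_roots_def)
  ultimately show "\<alpha> \<in> tau n y" using tau_perm_word[OF assms(2)] \<alpha>(1) by auto
qed

section \<open>Transfer to tableaux\<close>

definition tab_word :: "nat \<Rightarrow> nat list list \<Rightarrow> nat list" where
  "tab_word n T = perm_word n (RS_rep n T)"

lemma tab_word:
  assumes "T \<in> SYT n"
  shows "distinct (tab_word n T)" "set (tab_word n T) = {1..n}"
  unfolding tab_word_def
  using perm_word_distinct perm_word_set SYT_rep[OF assms] by blast+

lemma geom_le_iff:
  assumes "T \<in> SYT n" "S \<in> SYT n"
  shows "geom_le n T S \<longleftrightarrow> Zword n (tab_word n S) \<subseteq> Zword n (tab_word n T)"
  using SYT_rep[OF assms(1)] SYT_rep[OF assms(2)]
  by (simp add: geom_le_def orbital_variety_tab_def Zword_perm_word tab_word_def)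

lemma geom_le_tau_mono:
  assumes "T \<in> SYT n" "S \<in> SYT n" "geom_le n T S"
  shows "tau_tab n T \<subseteq> tau_tab n S"
  unfolding tau_tab_def
  using Zword_tau_mono SYT_rep assms geom_le_iff[OF assms(1,2)] by (simp add: tab_word_def)

lemma D_tab_iff:
  assumes "\<alpha> \<in> simple_roots n" "\<beta> \<in> simple_roots n"
  shows "T \<in> D_tab n \<alpha> \<beta> \<longleftrightarrow> T \<in> SYT n \<and> in_D \<alpha> \<beta> (tab_word n T)"
  using in_D_iff[OF SYT_rep(1) assms] by (auto simp: D_tab_def tau_tab_def tab_word_def)

text \<open>Equality of words cannot be expected: the representative chosen for the new tableau need
  not be the one that the operator produced.\<close>

lemma T_op_tab_word:
  assumes "\<alpha> \<in> simple_roots n" "\<beta> \<in> simple_roots n" "T \<in> SYT n"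
  shows "T_op_tab n \<alpha> \<beta> T \<in> SYT n"
    and "knuth_equiv (tab_word n (T_op_tab n \<alpha> \<beta> T)) (word_op \<alpha> \<beta> (tab_word n T))"
proof -
  note op = T_op_perm_word[OF SYT_rep(1)[OF assms(3)] assms(1,2)]
  show SYT: "T_op_tab n \<alpha> \<beta> T \<in> SYT n" unfolding T_op_tab_def by (rule RS_in_SYT[OF op(1)])
  have "RS n (RS_rep n (T_op_tab n \<alpha> \<beta> T)) = RS n (T_op n \<alpha> \<beta> (RS_rep n T))"
    using SYT_rep(2)[OF SYT] by (simp add: T_op_tab_def)
  then show "knuth_equiv (tab_word n (T_op_tab n \<alpha> \<beta> T)) (word_op \<alpha> \<beta> (tab_word n T))"
    using RS_eq_iff[OF SYT_rep(1)[OF SYT] op(1)] by (simp add: op(2) tab_word_def)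
qed

lemma roots_subset:
  "\<alpha> \<in> simple_roots n \<Longrightarrow> \<beta> \<in> simple_roots n \<Longrightarrow> {\<alpha>, Suc \<alpha>, \<beta>, Suc \<beta>} \<subseteq> {1..n}"
  by (auto simp: simple_roots_def)

lemma adjacent_roots_sym: "adjacent_roots \<alpha> \<beta> \<Longrightarrow> adjacent_roots \<beta> \<alpha>"
  by (auto simp: adjacent_roots_def)

text \<open>On words the inversion is exact; invariance of the operator under Knuth equivalence
  carries it across the change of representative.\<close>

lemma T_op_tab_inverse:
  assumes roots: "\<alpha> \<in> simple_roots n" "\<beta> \<in> simple_roots n" "adjacent_roots \<alpha> \<beta>"
    and T: "T \<in> D_tab n \<alpha> \<beta>"
  shows "T_op_tab n \<alpha> \<beta> T \<in> D_tab n \<beta> \<alpha>"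
    and "T_op_tab n \<beta> \<alpha> (T_op_tab n \<alpha> \<beta> T) = T"
proof -
  let ?T' = "T_op_tab n \<alpha> \<beta> T"
  have SYT: "T \<in> SYT n" and D: "in_D \<alpha> \<beta> (tab_word n T)"
    using T by (auto simp: D_tab_iff[OF roots(1,2)])
  note T' = T_op_tab_word[OF roots(1,2) SYT]
  have mem: "{\<alpha>, Suc \<alpha>, \<beta>, Suc \<beta>} \<subseteq> set (tab_word n T)"
    using roots_subset[OF roots(1,2)] tab_word(2)[OF SYT] by simp
  note inv = word_op_inverse[OF roots(3) D mem]
  have ws: "mset (tab_word n ?T') = mset (word_op \<alpha> \<beta> (tab_word n T))"
    using knuth_equiv_mset[OF T'(2)] .
  have set': "set (word_op \<alpha> \<beta> (tab_word n T)) = {1..n}" "distinct (word_op \<alpha> \<beta> (tab_word n T))"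
    using tab_word[OF T'(1)] mset_eq_setD[OF ws] mset_eq_imp_distinct_iff[OF ws] by auto
  have mem': "{\<beta>, Suc \<beta>, \<alpha>, Suc \<alpha>} \<subseteq> set (word_op \<alpha> \<beta> (tab_word n T))"
    using roots_subset[OF roots(1,2)] set' by auto
  from word_op_knuth_equiv[OF equivclp_sym[OF T'(2)] adjacent_roots_sym[OF roots(3)] set'(2) mem' inv(1)]
  have D': "in_D \<beta> \<alpha> (tab_word n ?T')"
    and eq: "knuth_equiv (tab_word n T) (word_op \<beta> \<alpha> (tab_word n ?T'))"
    by (simp_all add: inv(2))
  show "?T' \<in> D_tab n \<beta> \<alpha>" using T'(1) D' by (simp add: D_tab_iff[OF roots(2,1)])
  note op = T_op_perm_word[OF SYT_rep(1)[OF T'(1)] roots(2,1)]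
  have "RS n (RS_rep n T) = RS n (T_op n \<beta> \<alpha> (RS_rep n ?T'))"
    using eq RS_eq_iff[OF SYT_rep(1)[OF SYT] op(1)] by (simp add: op(2) tab_word_def)
  then show "T_op_tab n \<beta> \<alpha> ?T' = T"
    using SYT_rep(2)[OF SYT] by (simp add: T_op_tab_def)
qed

lemma T_op_tab_geom_le:
  assumes roots: "\<alpha> \<in> simple_roots n" "\<beta> \<in> simple_roots n" "adjacent_roots \<alpha> \<beta>"
    and "T \<in> D_tab n \<alpha> \<beta>" "S \<in> D_tab n \<alpha> \<beta>" and le: "geom_le n T S"
  shows "geom_le n (T_op_tab n \<alpha> \<beta> T) (T_op_tab n \<alpha> \<beta> S)"
proof -
  have T: "T \<in> SYT n" "in_D \<alpha> \<beta> (tab_word n T)" and S: "S \<in> SYT n" "in_D \<alpha> \<beta> (tab_word n S)"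
    using assms by (auto simp: D_tab_iff)
  note T' = T_op_tab_word[OF roots(1,2) T(1)] and S' = T_op_tab_word[OF roots(1,2) S(1)]
  have "Zword n (word_op \<alpha> \<beta> (tab_word n S)) \<subseteq> Zword n (word_op \<alpha> \<beta> (tab_word n T))"
    using le T S tab_word(2)
    by (intro Zword_word_op_mono[OF roots(3,1,2)]) (auto simp: geom_le_iff)
  then show ?thesis
    using knuth_equiv_Zword[OF T'(2) tab_word[OF T'(1)]] knuth_equiv_Zword[OF S'(2) tab_word[OF S'(1)]]
    by (simp add: geom_le_iff[OF T'(1) S'(1)])
qed

lemma T_op_tab_geom_cover:
  assumes roots: "\<alpha> \<in> simple_roots n" "\<beta> \<in> simple_roots n" "adjacent_roots \<alpha> \<beta>"
    and T: "T \<in> D_tab n \<alpha> \<beta>" and S: "S \<in> D_tab n \<alpha> \<beta>" and cover: "S \<in> geom_cover n T"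
  shows "T_op_tab n \<alpha> \<beta> S \<in> geom_cover n (T_op_tab n \<alpha> \<beta> T)"
proof -
  let ?T' = "T_op_tab n \<alpha> \<beta> T" and ?S' = "T_op_tab n \<alpha> \<beta> S"
  note roots' = roots(2,1) adjacent_roots_sym[OF roots(3)]
  note T' = T_op_tab_inverse[OF roots T] and S' = T_op_tab_inverse[OF roots S]
  have SYT: "?T' \<in> SYT n" "?S' \<in> SYT n" using T'(1) S'(1) by (auto simp: D_tab_def)
  show ?thesis
    unfolding geom_cover_def
  proof (intro CollectI conjI ballI impI)
    show "?S' \<in> SYT n" by (rule SYT)
    show "geom_le n ?T' ?S'" using T_op_tab_geom_le[OF roots T S] cover by (simp add: geom_cover_def)
    show "?S' \<noteq> ?T'" using T'(2) S'(2) cover by (auto simp: geom_cover_def)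
    fix Q assume Q: "Q \<in> SYT n" and le: "geom_le n ?T' Q \<and> geom_le n Q ?S'"
    have "tau_tab n ?T' \<subseteq> tau_tab n Q" "tau_tab n Q \<subseteq> tau_tab n ?S'"
      using geom_le_tau_mono Q SYT le by blast+
    then have QD: "Q \<in> D_tab n \<beta> \<alpha>" using Q T'(1) S'(1) by (auto simp: D_tab_def)
    \<comment> \<open>The tableau in between is pulled back to one between \<open>T\<close> and
      \<open>S\<close>, where the cover hypothesis applies.\<close>
    let ?R = "T_op_tab n \<beta> \<alpha> Q"
    have "geom_le n T ?R" "geom_le n ?R S"
      using T_op_tab_geom_le[OF roots' T'(1) QD] T_op_tab_geom_le[OF roots' QD S'(1)] le
      by (simp_all add: T'(2) S'(2))
    moreover have R: "?R \<in> D_tab n \<alpha> \<beta>" "T_op_tab n \<alpha> \<beta> ?R = Q"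
      using T_op_tab_inverse[OF roots' QD] by auto
    ultimately have "?R = T \<or> ?R = S"
      using cover by (auto simp: geom_cover_def D_tab_def)
    then show "Q = ?T' \<or> Q = ?S'" using R(2) by auto
  qed
qed

theorem lemma7p6:
  fixes n \<alpha> \<beta> :: nat and T S :: "nat list list"
  assumes "\<alpha> \<in> simple_roots n" and "\<beta> \<in> simple_roots n" and "adjacent_roots \<alpha> \<beta>"
    and "T \<in> D_tab n \<alpha> \<beta>" and "S \<in> D_tab n \<alpha> \<beta>"
  shows "S \<in> geom_cover n T \<longleftrightarrow> T_op_tab n \<alpha> \<beta> S \<in> geom_cover n (T_op_tab n \<alpha> \<beta> T)"
proof
  show "S \<in> geom_cover n T \<Longrightarrow> T_op_tab n \<alpha> \<beta> S \<in> geom_cover n (T_op_tab n \<alpha> \<beta> T)"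
    by (rule T_op_tab_geom_cover[OF assms])
  assume "T_op_tab n \<alpha> \<beta> S \<in> geom_cover n (T_op_tab n \<alpha> \<beta> T)"
  \<comment> \<open>The converse is the same implication with the roots exchanged, applied to the
    images.\<close>
  from T_op_tab_geom_cover[OF assms(2,1) adjacent_roots_sym[OF assms(3)] _ _ this]
  show "S \<in> geom_cover n T"
    using T_op_tab_inverse[OF assms(1-4)] T_op_tab_inverse[OF assms(1-3,5)] by simp
qed

end
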